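(* Let $k\geq 4$ be an integer and let $\mathcal H$ be a $3$-uniform linear hypergraph on $n$ vertices that contains no Berge path of length $k$ as a subhypergraph. Then the number of hyperedges of $\mathcal H$ is at most $\frac{k-1}{6}n$.
   Context: A hypergraph $\mathcal H$ is a family of subsets (hyperedges) of a finite vertex set $V(\mathcal H)$. It is $3$-uniform if every hyperedge has exactly $3$ elements. It is linear if any two distinct hyperedges share at most one vertex. A Berge path of length $k$ in $\mathcal H$ is an alternating sequence $v_1,h_1,v_2,h_2,\dots,h_k,v_{k+1}$ of pairwise distinct vertices $v_1,\dots,v_{k+1}$ and pairwise distinct hyperedges $h_1,\dots,h_k$ of $\mathcal H$ such that $\{v_i,v_{i+1}\}\subseteq h_i$ for all $i\in\{1,\dots,k\}$. *)

theory Defs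
  imports Complex_Main
begin

definition uniform3 :: "'a set set \<Rightarrow> bool" where
  "uniform3 H \<longleftrightarrow> (\<forall>h\<in>H. card h = 3)"

definition linear_hg :: "'a set set \<Rightarrow> bool" where
  "linear_hg H \<longleftrightarrow> (\<forall>h\<in>H. \<forall>h'\<in>H. h \<noteq> h' \<longrightarrow> card (h \<inter> h') \<le> 1)"

definition berge_path :: "'a set set \<Rightarrow> 'a list \<Rightarrow> 'a set list \<Rightarrow> nat \<Rightarrow> bool" where
  "berge_path H vs es k \<longleftrightarrow>
     length vs = k + 1 \<and> length es = k \<and> distinct vs \<and> distinct es \<and>
     set es \<subseteq> H \<and> (\<forall>i<k. {vs ! i, vs ! (i + 1)} \<subseteq> es ! i)"

definition has_berge_path :: "'a set set \<Rightarrow> nat \<Rightarrow> bool" where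
  "has_berge_path H k \<longleftrightarrow> (\<exists>vs es. berge_path H vs es k)"

end

theory Submission
  imports Defs
begin

text \<open>
  Replace the hypergraph by its 2-section graph, an edge-disjoint union of triangles: Berge paths become
  paths of the graph that never turn inside a triangle. The bound becomes the
  Erdos-Gallai bound "sum of degrees at most (k - 1) n" for such restricted paths, a statement that
  is stable under deleting vertices (a triangle losing a vertex leaves an unrestricted edge). In a
  minimal counterexample every vertex set U is therefore incident with more than (k - 1) |U| / 2 edges.

  Applying this to the set of all ends of longest paths, and rotating a longest path at an end with
  many neighbours, yields a cycle of length c with 3 c + 2 \<ge> 2 k. For a longest cycle C we have c < k, and
  the gain c (k - c) / 2 from comparing C with a complete graph pays for the only obstruction to
  the classical argument, the cycle edges whose triangle has its third vertex w outside C (the cycle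
  edges \<^emph>\<open>owned\<close> by w, at most c in total). If k \<ge> c + 3, the vertices outside C can be peeled off one by one. If
  k = c + 1 or k = c + 2, one also uses that the successors on C of the neighbours of an outside
  vertex are essentially pairwise nonadjacent.
\<close>

section \<open>Paths without turns inside a triangle\<close>

text \<open>In \<open>tri\<close> only the triangles coming from hyperedges are recorded; other
  triangles of the graph restrict nothing, and \<open>tri_unique\<close> is the linearity of the
  hypergraph. The split at \<open>k \<ge> c + 3\<close> is a matter of accounting. In degree sums a
  cycle of length c has budget (k - 1) c, but even a complete graph on it uses only c (c - 1), a
  slack of c (k - c). An outside vertex owning t cycle edges exceeds its own budget by at most 3 t
  if \<open>k \<ge> c + 3\<close>, so the total excess is at most 3 c and is covered. For smaller k
  the excess is not covered, and the edges missing inside the cycle, quadratic in the number of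
  entries, have to be charged. The ratio 2/3 in the length of the cycle is the price of the
  forbidden turns: a neighbour on the path whose edge shares a triangle with the next path edge
  cannot be used for a rotation, and up to about half of the positions may be spoilt in this way.
  The bound \<open>3 * c + 2 \<ge> 2 * k\<close> is used to compare ears with the cycle: an ear has
  at most k - c vertices, about half of c, so its length can be excluded on both sides of its base
  with hardly any overlap.\<close>

locale triangle_graph =
  fixes adj :: "'a \<Rightarrow> 'a \<Rightarrow> bool" and tri :: "'a \<Rightarrow> 'a \<Rightarrow> 'a \<Rightarrow> bool"
  assumes adj_sym: "adj a b \<Longrightarrow> adj b a"
    and adj_irrefl: "\<not> adj a a"
    and tri_adj: "tri a b d \<Longrightarrow> adj a b"
    and tri_swap: "tri a b d \<Longrightarrow> tri b a d"
    and tri_rot: "tri a b d \<Longrightarrow> tri b d a"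
    and tri_unique: "tri a b d \<Longrightarrow> tri a b e \<Longrightarrow> d = e"
begin

lemma adj_commute: "adj a b \<longleftrightarrow> adj b a"
  using adj_sym by blast

lemma tri_rev: "tri a b d \<longleftrightarrow> tri d b a"
  using tri_swap tri_rot by blast

lemma tri_adj_all:
  assumes "tri a b d"
  shows "adj a b" "adj b d" "adj a d" "adj b a" "adj d b" "adj d a"
  using assms tri_adj tri_swap tri_rot by blast+

lemma tri_distinct:
  assumes "tri a b d"
  shows "a \<noteq> b" "b \<noteq> d" "a \<noteq> d"
  using tri_adj_all[OF assms] adj_irrefl by blast+

lemma tri_perms:
  assumes "tri a b d"
  shows "tri a b d" "tri a d b" "tri b a d" "tri b d a" "tri d a b" "tri d b a"
  using assms tri_swap tri_rot by blast+

lemma tri_ac: "tri a b d \<longleftrightarrow> tri b a d" "tri a b d \<longleftrightarrow> tri a d b"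
  using tri_perms by blast+

definition deg :: "'a set \<Rightarrow> 'a \<Rightarrow> int" where
  "deg U v = int (card {u \<in> U. adj v u})"

definition degsum :: "'a set \<Rightarrow> int" where
  "degsum U = (\<Sum>v\<in>U. deg U v)"

fun good :: "'a list \<Rightarrow> bool" where
  "good [] = True"
| "good [x] = True"
| "good [x, y] = adj x y"
| "good (x # y # z # zs) = (adj x y \<and> \<not> tri x y z \<and> good (y # z # zs))"

abbreviation second :: "'a list \<Rightarrow> 'a" where "second xs \<equiv> hd (tl xs)"
abbreviation penult :: "'a list \<Rightarrow> 'a" where "penult xs \<equiv> last (butlast xs)"

lemma good_Cons:
  "good (x # xs) \<longleftrightarrow> xs = [] \<or> (adj x (hd xs) \<and> (tl xs \<noteq> [] \<longrightarrow> \<not> tri x (hd xs) (second xs)) \<and> good xs)"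
  by (cases "x # xs" rule: good.cases) auto

lemma good_append:
  assumes "xs \<noteq> []" "ys \<noteq> []"
  shows "good (xs @ ys) \<longleftrightarrow> good xs \<and> good ys \<and> adj (last xs) (hd ys)
    \<and> (butlast xs \<noteq> [] \<longrightarrow> \<not> tri (penult xs) (last xs) (hd ys))
    \<and> (tl ys \<noteq> [] \<longrightarrow> \<not> tri (last xs) (hd ys) (second ys))"
  using assms(1)
proof (induction xs)
  case Nil
  then show ?case by simp
next
  case (Cons x xs)
  show ?case
  proof (cases xs)
    case Nil
    then show ?thesis using assms(2) by (auto simp: good_Cons)
  next
    case (Cons x' xs')
    note IH = Cons.IH
    show ?thesis
    proof (cases xs')
      case Nil
      then show ?thesis using assms(2) Cons Cons.IH by (auto simp: good_Cons)
    next
      case (Cons x'' xs'')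
      then show ?thesis using assms(2) \<open>xs = x' # xs'\<close> Cons.IH IH by (auto simp: good_Cons)
    qed
  qed
qed

lemma good_rev: "good (rev xs) = good xs"
proof (induction xs)
  case Nil
  then show ?case by simp
next
  case (Cons x xs)
  show ?case
  proof (cases "xs = []")
    case True
    then show ?thesis by simp
  next
    case False
    have *: "last (butlast (rev xs)) = second xs" if "tl xs \<noteq> []"
      using that False by (cases xs) (auto simp: butlast_append last_rev)
    have "butlast (rev xs) = [] \<longleftrightarrow> tl xs = []"
      using False by (cases xs) auto
    moreover have "last (rev xs) = hd xs" using False by (simp add: last_rev)
    ultimately show ?thesis
      using False Cons * by (auto simp: good_append good_Cons[of x] adj_commute tri_rev)
  qed
qed

text \<open>Longest paths and cycles are handled as functions on the integers; this turns any
  interval of such a function into a good list.\<close>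

lemma good_map:
  fixes g :: "int \<Rightarrow> 'a"
  assumes "\<And>i. a \<le> i \<Longrightarrow> i < b \<Longrightarrow> adj (g i) (g (i + 1))"
    and "\<And>i. a \<le> i \<Longrightarrow> i + 1 < b \<Longrightarrow> \<not> tri (g i) (g (i + 1)) (g (i + 2))"
  shows "good (map g [a..b])"
  using assms
proof (induction "nat (b - a)" arbitrary: a)
  case 0
  then show ?case by (cases "a = b") auto
next
  case (Suc n)
  then have ab: "a < b" by auto
  have IH: "good (map g [a+1..b])" using Suc by auto
  have 1: "[a..b] = a # [a+1..b]" "[a+1..b] = (a+1) # [a+2..b]"
    using ab upto_rec1[of a b] upto_rec1[of "a+1" b] by (simp_all add: add.assoc)
  have 2: "a + 1 < b \<Longrightarrow> [a+2..b] = (a+2) # [a+3..b]"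
    using upto_rec1[of "a+2" b] by (simp add: add.assoc)
  show ?case
  proof (cases "a + 1 < b")
    case True
    then show ?thesis using IH 1 2 Suc.prems(1)[of a] Suc.prems(2)[of a] ab
      by auto
  next
    case False
    then have "b = a + 1" using ab by simp
    then show ?thesis using 1 Suc.prems(1)[of a] by auto
  qed
qed

lemma good_nth:
  assumes "good xs"
  shows "Suc i < length xs \<Longrightarrow> adj (xs ! i) (xs ! Suc i)"
    and "Suc (Suc i) < length xs \<Longrightarrow> \<not> tri (xs ! i) (xs ! Suc i) (xs ! Suc (Suc i))"
  using assms
proof (induction xs arbitrary: i rule: good.induct)
  case (4 x y z zs)
  { case 1 then show ?case using "4.IH"(1)[of "i - 1"] "4.IH"(2)[of "i - 1"] by (cases i) auto }
  { case 2 then show ?case using "4.IH"(1)[of "i - 1"] "4.IH"(2)[of "i - 1"] by (cases i) auto }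
qed auto

lemma upto_ends:
  assumes "a \<le> b"
  shows "[a..b] \<noteq> []" "hd [a..b] = a" "last [a..b] = b"
    "tl [a..b] = [a+1..b]" "butlast [a..b] = [a..b-1]"
proof -
  have 1: "[a..b] = a # [a+1..b]" and 2: "[a..b] = [a..b-1] @ [b]"
    using assms by (rule upto_rec1, rule upto_rec2)
  show "[a..b] \<noteq> []" "hd [a..b] = a" "tl [a..b] = [a+1..b]" by (subst 1, simp)+
  show "last [a..b] = b" "butlast [a..b] = [a..b-1]" by (subst 2, simp)+
qed

lemma map_upto_ends:
  fixes g :: "int \<Rightarrow> 'a"
  assumes "a \<le> b"
  shows "hd (map g [a..b]) = g a" "last (map g [a..b]) = g b"
    "tl (map g [a..b]) = map g [a+1..b]" "butlast (map g [a..b]) = map g [a..b-1]"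
    "map g [a..b] \<noteq> []"
proof -
  note u = upto_ends[OF assms]
  show "hd (map g [a..b]) = g a" by (subst hd_map[OF u(1)], subst u(2), rule refl)
  show "last (map g [a..b]) = g b" by (subst last_map[OF u(1)], subst u(3), rule refl)
  show "tl (map g [a..b]) = map g [a+1..b]" by (subst map_tl[symmetric], subst u(4), rule refl)
  show "butlast (map g [a..b]) = map g [a..b-1]" by (subst map_butlast[symmetric], subst u(5), rule refl)
  show "map g [a..b] \<noteq> []" using u(1) by simp
qed

lemma rev_ends:
  "hd (rev xs) = last xs" "last (rev xs) = hd xs" "tl (rev xs) = rev (butlast xs)" "butlast (rev xs) = rev (tl xs)"
proof -
  show "hd (rev xs) = last xs" by (simp add: hd_rev)
  show "last (rev xs) = hd xs" by (simp add: last_rev)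
  show "tl (rev xs) = rev (butlast xs)" by (cases xs rule: rev_cases) simp_all
  show "butlast (rev xs) = rev (tl xs)" by (cases xs) simp_all
qed

definition is_path :: "'a set \<Rightarrow> 'a list \<Rightarrow> bool" where
  "is_path U xs \<longleftrightarrow> distinct xs \<and> set xs \<subseteq> U \<and> good xs"

definition is_cycle :: "'a set \<Rightarrow> 'a list \<Rightarrow> bool" where
  "is_cycle U xs \<longleftrightarrow> distinct xs \<and> set xs \<subseteq> U \<and> length xs \<ge> 3 \<and> good xs \<and> adj (last xs) (hd xs)
     \<and> \<not> tri (penult xs) (last xs) (hd xs) \<and> \<not> tri (last xs) (hd xs) (second xs)"

lemma deg_eq_0:
  assumes "\<And>u. u \<in> U \<Longrightarrow> \<not> adj v u"
  shows "deg U v = 0"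
proof -
  have "{u \<in> U. adj v u} = {}" using assms by blast
  then show ?thesis unfolding deg_def by (simp only: card.empty of_nat_0)
qed

lemma deg_Un:
  assumes "finite U" "finite X" "U \<inter> X = {}"
  shows "deg (U \<union> X) v = deg U v + deg X v"
proof -
  have "{u \<in> U \<union> X. adj v u} = {u \<in> U. adj v u} \<union> {u \<in> X. adj v u}" by auto
  then show ?thesis unfolding deg_def
    using assms by (simp add: card_Un_disjoint disjoint_iff)
qed

lemma sum_deg_commute:
  assumes "finite U" "finite X"
  shows "(\<Sum>v\<in>U. deg X v) = (\<Sum>v\<in>X. deg U v)"
proof -
  have "deg X v = (\<Sum>u\<in>X. if adj v u then 1 else 0)" if "finite X" for X v
    using that by (simp add: deg_def sum.If_cases Int_def)
  then show ?thesis using assms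
    using sum.swap[of "\<lambda>v u. if adj v u then 1 else 0" X U] by (simp add: adj_commute)
qed

text \<open>Edges between the two sets are seen from both ends, hence the factor 2.\<close>

lemma degsum_Un:
  assumes "finite U" "finite X" "U \<inter> X = {}"
  shows "degsum (U \<union> X) = degsum X + (\<Sum>u\<in>U. deg U u + 2 * deg X u)"
proof -
  have "degsum (U \<union> X) = (\<Sum>v\<in>U. deg U v + deg X v) + (\<Sum>v\<in>X. deg U v + deg X v)"
    unfolding degsum_def using assms by (simp add: sum.union_disjoint deg_Un)
  also have "\<dots> = degsum X + (\<Sum>u\<in>U. deg U u + 2 * deg X u)"
    using sum_deg_commute[OF assms(1,2)]
    by (simp add: sum.distrib degsum_def sum_distrib_left[symmetric])
  finally show ?thesis .
qed

lemma degsum_le: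
  assumes "finite U"
  shows "degsum U \<le> int (card U) * (int (card U) - 1)"
proof -
  have "deg U v \<le> int (card U) - 1" if "v \<in> U" for v
  proof -
    have "{u \<in> U. adj v u} \<subseteq> U - {v}" using adj_irrefl by auto
    then have "card {u \<in> U. adj v u} \<le> card U - 1"
      using assms that by (metis card_Diff_singleton card_mono finite_Diff)
    moreover have "card U \<ge> 1" using that assms by (metis One_nat_def Suc_leI card_gt_0_iff empty_iff)
    ultimately show ?thesis unfolding deg_def by linarith
  qed
  then have "degsum U \<le> (\<Sum>v\<in>U. int (card U) - 1)" unfolding degsum_def by (rule sum_mono)
  then show ?thesis by simp
qed

end

section \<open>A long cycle in a minimal counterexample\<close>

text \<open>Here \<open>k\<close> bounds the number of vertices of a path, since a path with
  \<open>k + 1\<close> vertices is one of length \<open>k\<close>. Integers keep all later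
  differences free of truncation.\<close>

locale critical_graph = triangle_graph adj tri
  for adj :: "'a \<Rightarrow> 'a \<Rightarrow> bool" and tri :: "'a \<Rightarrow> 'a \<Rightarrow> 'a \<Rightarrow> bool" +
  fixes V :: "'a set" and k :: int
  assumes finV: "finite V"
    and k4: "k \<ge> 4"
    and nopath: "is_path V xs \<Longrightarrow> int (length xs) \<le> k"
    and minimal: "U \<subset> V \<Longrightarrow> degsum U \<le> (k - 1) * int (card U)"
    and counterexample: "degsum V > (k - 1) * int (card V)"
begin

lemma finite_sub: "U \<subseteq> V \<Longrightarrow> finite U"
  using finV finite_subset by blast

text \<open>By minimality \<open>V - U\<close> obeys the bound, so the whole excess comes from edges
  meeting \<open>U\<close>. The sum counts each such edge twice: edges inside \<open>U\<close> once
  from each end, edges leaving \<open>U\<close> through the factor 2.\<close>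

lemma removal:
  assumes "U \<subseteq> V" "U \<noteq> {}"
  shows "(\<Sum>u\<in>U. deg U u + 2 * deg (V - U) u) > (k - 1) * int (card U)"
proof -
  have "V - U \<subset> V" using assms by auto
  from minimal[OF this] have "degsum (V - U) \<le> (k - 1) * int (card (V - U))" .
  moreover have "degsum V = degsum (V - U) + (\<Sum>u\<in>U. deg U u + 2 * deg (V - U) u)"
    using degsum_Un[of U "V - U"] assms(1) finite_sub[OF assms(1)] finV by (simp add: Un_absorb1)
  moreover have "int (card V) = int (card (V - U)) + int (card U)"
    using assms(1) finV finite_sub[OF assms(1)] by (simp add: card_Diff_subset card_mono of_nat_diff)
  ultimately show ?thesis using counterexample by (simp add: algebra_simps)
qed

lemma card_V_gt: "int (card V) > k"
proof (rule ccontr)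
  assume "\<not> ?thesis"
  then have "int (card V) * (int (card V) - 1) \<le> int (card V) * (k - 1)"
    by (intro mult_left_mono) auto
  then show False using degsum_le[OF finV] counterexample by (simp add: mult.commute)
qed

lemma deg_split: "U \<subseteq> V \<Longrightarrow> deg V v = deg U v + deg (V - U) v"
  using deg_Un[of U "V - U" v] finite_sub finV by (simp add: Un_absorb1)

lemma deg_ge:
  assumes "v \<in> V" shows "2 * deg V v \<ge> k"
proof -
  have "deg {v} v = 0" using adj_irrefl by (simp add: deg_def)
  then show ?thesis using removal[of "{v}"] assms deg_split[of "{v}" v] by simp
qed

text \<open>If no edge left \<open>X\<close>, the sum in \<open>removal\<close> would be the degree
  sum of \<open>X\<close> itself, which minimality bounds the other way.\<close>

lemma connected:
  assumes "X \<subset> V" "X \<noteq> {}"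
  shows "\<exists>x\<in>X. \<exists>y\<in>V - X. adj x y"
proof (rule ccontr)
  assume *: "\<not> ?thesis"
  have "deg (V - X) x = 0" if "x \<in> X" for x
    using * that by (intro deg_eq_0) blast
  then have "(\<Sum>u\<in>X. deg X u + 2 * deg (V - X) u) = degsum X"
    by (simp add: degsum_def)
  then show False using removal[of X] assms minimal[OF assms(1)] by auto
qed

section \<open>Longest paths and rotations\<close>

definition plen :: int where
  "plen = int (Max {length xs |xs. is_path V xs})"

text \<open>A longest path as a function on integers, so that positions can be shifted freely;
  values outside the window \<open>{0..<plen}\<close> are arbitrary.\<close>

definition path_fun :: "(int \<Rightarrow> 'a) \<Rightarrow> bool" where
  "path_fun g \<longleftrightarrow> (\<forall>i. 0 \<le> i \<and> i < plen \<longrightarrow> g i \<in> V) \<and> inj_on g {0..<plen}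
    \<and> (\<forall>i. 0 \<le> i \<and> i + 1 < plen \<longrightarrow> adj (g i) (g (i + 1)))
    \<and> (\<forall>i. 0 \<le> i \<and> i + 2 < plen \<longrightarrow> \<not> tri (g i) (g (i + 1)) (g (i + 2)))"

definition path_ends :: "'a set" where
  "path_ends = {g 0 |g. path_fun g}"

lemma finite_lengths: "finite {length xs |xs. is_path V xs}"
proof (rule finite_subset)
  show "{length xs |xs. is_path V xs} \<subseteq> {..nat k}" using nopath by fastforce
qed simp

lemma plen_max: "is_path V xs \<Longrightarrow> int (length xs) \<le> plen"
  using finite_lengths by (auto simp: plen_def intro!: Max_ge)

lemma plen_attained: obtains xs where "is_path V xs" "int (length xs) = plen"
proof -
  have "{length xs |xs. is_path V xs} \<noteq> {}" by (auto simp: is_path_def intro!: exI[of _ "[]"])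
  from Max_in[OF finite_lengths this] show ?thesis using that by (auto simp: plen_def)
qed

lemma plen_ge_2: "plen \<ge> 2"
proof -
  have "card V \<noteq> 0" using card_V_gt k4 by linarith
  then obtain v where v: "v \<in> V" by fastforce
  then have "deg V v > 0" using deg_ge[OF v] k4 by linarith
  then obtain u where "u \<in> V" "adj v u" using deg_eq_0[of V v] by force
  then have "is_path V [v, u]" using v adj_irrefl by (auto simp: is_path_def)
  then show ?thesis using plen_max by fastforce
qed

lemma path_fun_of_list:
  assumes "is_path V xs" "int (length xs) = plen"
  shows "path_fun (\<lambda>i. xs ! nat i)"
  unfolding path_fun_def
proof (intro conjI allI impI)
  show "xs ! nat i \<in> V" if "0 \<le> i \<and> i < plen" for i
    using that assms nth_mem[of "nat i" xs] unfolding is_path_def by (auto simp: subset_iff)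
  show "inj_on (\<lambda>i. xs ! nat i) {0..<plen}"
    using assms by (auto simp: inj_on_def is_path_def nth_eq_iff_index_eq)
  have "good xs" using assms by (simp add: is_path_def)
  show "adj (xs ! nat i) (xs ! nat (i + 1))" if "0 \<le> i \<and> i + 1 < plen" for i
  proof -
    have "i = int (nat i)" using that by simp
    then obtain j where "i = int j" ..
    then show ?thesis using good_nth(1)[OF \<open>good xs\<close>, of j] that assms(2) by (simp add: nat_add_distrib)
  qed
  show "\<not> tri (xs ! nat i) (xs ! nat (i + 1)) (xs ! nat (i + 2))" if "0 \<le> i \<and> i + 2 < plen" for i
  proof -
    have "i = int (nat i)" using that by simp
    then obtain j where "i = int j" ..
    then show ?thesis using good_nth(2)[OF \<open>good xs\<close>, of j] that assms(2) by (simp add: nat_add_distrib)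
  qed
qed

lemma path_ends_of_list:
  assumes "is_path V xs" "int (length xs) \<ge> plen"
  shows "hd xs \<in> path_ends"
proof -
  have l: "int (length xs) = plen" using assms plen_max by fastforce
  then have "xs \<noteq> []" using plen_ge_2 by auto
  then show ?thesis using path_fun_of_list[OF assms(1) l]
    unfolding path_ends_def by (auto simp: hd_conv_nth intro!: exI[of _ "\<lambda>i. xs ! nat i"])
qed

context
  fixes g assumes pf: "path_fun g"
begin

lemma pf_in: "0 \<le> i \<Longrightarrow> i < plen \<Longrightarrow> g i \<in> V"
  and pf_adj: "0 \<le> i \<Longrightarrow> i + 1 < plen \<Longrightarrow> adj (g i) (g (i + 1))"
  and pf_tri: "0 \<le> i \<Longrightarrow> i + 2 < plen \<Longrightarrow> \<not> tri (g i) (g (i + 1)) (g (i + 2))"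
  using pf unfolding path_fun_def by auto

lemma pf_eq: "0 \<le> i \<Longrightarrow> i < plen \<Longrightarrow> 0 \<le> j \<Longrightarrow> j < plen \<Longrightarrow> g i = g j \<longleftrightarrow> i = j"
  using pf unfolding path_fun_def inj_on_def by auto

lemma pf_seg:
  assumes "0 \<le> a" "b < plen"
  shows "good (map g [a..b])" "distinct (map g [a..b])" "set (map g [a..b]) \<subseteq> V"
proof -
  show "good (map g [a..b])" by (rule good_map) (use assms pf_adj pf_tri in auto)
  show "distinct (map g [a..b])" using assms pf_eq by (auto simp: distinct_map inj_on_def)
  show "set (map g [a..b]) \<subseteq> V" using assms pf_in by auto
qed

text \<open>Prepending \<open>z\<close> would lengthen the path; only a forbidden turn at
  \<open>g 0\<close> can prevent this.\<close>

lemma pf_outside_nbr: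
  assumes "z \<in> V" "adj (g 0) z" "z \<notin> g ` {0..<plen}"
  shows "tri (g 0) (g 1) z"
proof (rule ccontr)
  assume *: "\<not> ?thesis"
  let ?ys = "z # map g [0..plen - 1]"
  have "good ?ys" using pf_seg(1)[of 0 "plen - 1"] assms * plen_ge_2
    by (auto simp: good_Cons map_upto_ends adj_commute tri_ac)
  then have "is_path V ?ys" using pf_seg[of 0 "plen - 1"] assms by (auto simp: is_path_def)
  from plen_max[OF this] show False using plen_ge_2 by simp
qed

text \<open>This is the rotation \<open>g (i - 1), ..., g 0, g i, g (i + 1), ...\<close>. Its new
  turns are at \<open>g 0\<close> and at \<open>g i\<close>, and the last two assumptions say that
  both are allowed.\<close>

lemma pf_rotate:
  assumes "1 \<le> i" "i < plen" "adj (g 0) (g i)" "\<not> tri (g 1) (g 0) (g i)"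
    "i + 1 < plen \<Longrightarrow> \<not> tri (g 0) (g i) (g (i + 1))"
  shows "g (i - 1) \<in> path_ends"
proof -
  let ?a = "map g [0..i-1]" and ?b = "map g [i..plen-1]"
  have ne: "?a \<noteq> []" "?b \<noteq> []" using assms by auto
  have "good (rev ?a @ ?b)"
    using pf_seg(1)[of 0 "i-1"] pf_seg(1)[of i "plen-1"] assms ne
    by (subst good_append) (auto simp: good_rev map_upto_ends rev_ends)
  moreover have "distinct (rev ?a @ ?b)" "set (rev ?a @ ?b) \<subseteq> V"
    using pf_seg(2,3)[of 0 "i-1"] pf_seg(2,3)[of i "plen-1"] assms
    by (auto simp: pf_eq)
  ultimately have "is_path V (rev ?a @ ?b)" by (simp add: is_path_def)
  moreover have "int (length (rev ?a @ ?b)) \<ge> plen" using assms by auto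
  moreover have "hd (rev ?a @ ?b) = g (i - 1)" using ne assms by (simp add: rev_ends map_upto_ends)
  ultimately show ?thesis using path_ends_of_list by metis
qed

lemma pf_cycle:
  assumes "0 \<le> a" "b < plen" "b \<ge> a + 2" "adj (g b) (g a)" "\<not> tri (g (b - 1)) (g b) (g a)"
    "\<not> tri (g b) (g a) (g (a + 1))"
  shows "is_cycle V (map g [a..b])"
proof -
  have "a \<le> b" "a \<le> b - 1" "a + 1 \<le> b" using assms by auto
  then show ?thesis
    using assms pf_seg[OF assms(1,2)] by (auto simp: is_cycle_def map_upto_ends)
qed

end

text \<open>Let \<open>s\<close> be an end with many neighbours and \<open>L\<close> the position of
  its last neighbour on the path. Rotations turn usable neighbour positions into ends, so these
  compete with the neighbours that are not ends for the positions up to \<open>L\<close>. Lost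
  positions fill at most about half of that range. The result is a lower bound for \<open>L\<close>,
  and the edge from \<open>s\<close> to \<open>g L\<close> closes a cycle, possibly after dropping
  one vertex. One extremal configuration survives the count and is excluded by its rigid
  structure.\<close>

lemma long_cycle: "\<exists>xs. is_cycle V xs \<and> 3 * int (length xs) + 2 \<ge> 2 * k"
proof (rule ccontr)
  assume "\<not> ?thesis"
  then have nc: "3 * int (length xs) + 3 \<le> 2 * k" if "is_cycle V xs" for xs
    using that by force
  let ?S = path_ends
  have nc': "3 * (b - a + 1) + 3 \<le> 2 * k" if "is_cycle V (map g [a..b])" "a \<le> b" for g a b
    using nc[OF that(1)] that(2) by simp
  have SV: "?S \<subseteq> V" using plen_ge_2 pf_in by (auto simp: path_ends_def)
  have Sne: "?S \<noteq> {}"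
    using plen_attained path_fun_of_list by (metis (mono_tags, lifting) empty_Collect_eq path_ends_def)
  \<comment> \<open>Averaging \<open>removal\<close> over the set of all ends; for a single end the
    summand is \<open>deg V s + deg (V - ?S) s\<close>.\<close>
  obtain s where s: "s \<in> ?S" "deg V s + deg (V - ?S) s \<ge> k"
  proof -
    have "\<exists>s\<in>?S. deg V s + deg (V - ?S) s \<ge> k"
    proof (rule ccontr)
      assume "\<not> ?thesis"
      then have "deg ?S s + 2 * deg (V - ?S) s \<le> k - 1" if "s \<in> ?S" for s
        using that deg_split[OF SV, of s] by force
      then have "(\<Sum>s\<in>?S. deg ?S s + 2 * deg (V - ?S) s) \<le> (\<Sum>s\<in>?S. k - 1)"
        by (rule sum_mono)
      then show False using removal[OF SV Sne] by (simp add: mult.commute)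
    qed
    then show ?thesis using that by blast
  qed
  obtain g where pf: "path_fun g" and g0: "g 0 = s" using s(1) by (auto simp: path_ends_def)
  define p where "p = plen"
  have p2: "p \<ge> 2" using plen_ge_2 by (simp add: p_def)
  note geq = pf_eq[OF pf, folded p_def] and gin = pf_in[OF pf, folded p_def]
    and gadj = pf_adj[OF pf, folded p_def] and gtri = pf_tri[OF pf, folded p_def]
    and gout = pf_outside_nbr[OF pf, folded p_def, unfolded g0]
    and grot = pf_rotate[OF pf, folded p_def, unfolded g0]
    and gcyc = pf_cycle[OF pf, folded p_def]
  define I where "I = {i. 1 \<le> i \<and> i < p \<and> adj s (g i)}"
  \<comment> \<open>\<open>i \<in> Lst\<close> is lost for rotation: the edge from \<open>s\<close> to \<open>g i\<close> lies in the same triangle as the next path edge.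
    Then \<open>i + 1\<close> is usable, so every lost position is charged to a pair of consecutive positions.\<close>
  define Lst where "Lst = {i. 1 \<le> i \<and> i + 1 < p \<and> tri s (g i) (g (i + 1))}"
  define X where "X = {i. 1 \<le> i \<and> i < p \<and> tri s (g 1) (g i)}"
  define A where "A = I - Lst - X"
  define Out where "Out = {z \<in> V. adj s z \<and> z \<notin> g ` {0..<p}}"
  define Is where "Is = {i \<in> I. g i \<notin> ?S}"
  have fin: "finite I" "finite Lst" "finite X" "finite A" "finite Is" "finite Out"
  proof -
    have "I \<subseteq> {0..p}" "Lst \<subseteq> {0..p}" "X \<subseteq> {0..p}" by (auto simp: I_def Lst_def X_def)
    then show "finite I" "finite Lst" "finite X" by (auto intro: finite_subset)
    then show "finite A" "finite Is" by (auto simp: A_def Is_def)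
    show "finite Out" using finV by (auto simp: Out_def)
  qed
  have I1: "1 \<in> I" using gadj[of 0] p2 g0 by (simp add: I_def)
  have LstI: "Lst \<subseteq> I" and XI: "X \<subseteq> I"
    by (auto simp: I_def Lst_def X_def dest: tri_adj_all)
  have LX: "Lst \<inter> X = {}"
  proof -
    have False if "i \<in> Lst" "i \<in> X" for i
    proof -
      have "g (i+1) = g 1" using that tri_unique[of s "g i" "g (i+1)" "g 1"]
        by (auto simp: Lst_def X_def tri_ac)
      then show False using that geq[of "i+1" 1] p2 by (auto simp: Lst_def)
    qed
    then show ?thesis by blast
  qed
  have Lst2: "i \<ge> 2" if "i \<in> Lst" for i
    using that gtri[of 0] g0 by (cases "i = 1") (auto simp: Lst_def)
  have X2: "i \<ge> 2" if "i \<in> X" for i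
    using that tri_distinct by (cases "i = 1") (force simp: X_def)+
  have LstA: "i + 1 \<in> A" if "i \<in> Lst" for i
  proof -
    have t: "tri s (g i) (g (i+1))" "1 \<le> i" "i + 1 < p" using that by (auto simp: Lst_def)
    have "i + 1 \<notin> Lst"
      using t tri_unique[of s "g (i+1)" "g i" "g (i+1+1)"] geq[of i "i+1+1"] tri_perms[OF t(1)]
      by (auto simp: Lst_def)
    moreover have "i + 1 \<notin> X"
      using t tri_unique[of s "g (i+1)" "g i" "g 1"] geq[of i 1] tri_perms[OF t(1)] Lst2[OF that]
      by (auto simp: X_def tri_ac)
    ultimately show ?thesis using t tri_adj_all[OF t(1)] by (auto simp: A_def I_def)
  qed
  have A_S: "g (i - 1) \<in> ?S" if "i \<in> A" for i
    using that grot[of i] by (auto simp: A_def I_def Lst_def X_def tri_ac)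
  define L where "L = Max I"
  have LI: "L \<in> I" unfolding L_def by (rule Max_in) (use fin(1) I1 in auto)
  have LM: "\<And>i. i \<in> I \<Longrightarrow> i \<le> L" using fin(1) by (simp add: L_def)
  have cX: "card X \<le> 1"
  proof -
    have "i = j" if "i \<in> X" "j \<in> X" for i j
      using that tri_unique[of s "g 1" "g i" "g j"] geq[of i j] by (auto simp: X_def)
    then show ?thesis using fin by (simp add: card_le_Suc0_iff_eq)
  qed
  have OutT: "tri s (g 1) z" if "z \<in> Out" for z using gout[of z] that by (auto simp: Out_def)
  have cO: "card Out \<le> 1"
  proof -
    have "z = z'" if "z \<in> Out" "z' \<in> Out" for z z'
      using tri_unique[OF OutT OutT] that .
    then show ?thesis using fin by (simp add: card_le_Suc0_iff_eq)
  qed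
  have XO: "card X + card Out \<le> 1"
  proof -
    have "X = {} \<or> Out = {}"
    proof (rule ccontr)
      assume "\<not> ?thesis"
      then obtain i z where "i \<in> X" "z \<in> Out" by blast
      then show False using tri_unique[of s "g 1" "g i" z] OutT by (auto simp: X_def Out_def)
    qed
    then show ?thesis using cX cO by auto
  qed
  \<comment> \<open>The vertices \<open>x\<close>, \<open>s\<close> and \<open>g 1\<close> form a
    triangle, so \<open>x\<close> can take the place of \<open>s\<close>: a forbidden turn
    \<open>x, g 1, g 2\<close> would force \<open>g 2 = s\<close>.\<close>
  have swap: "path_fun (g(0 := x))" if "x \<in> Out" for x
    unfolding path_fun_def
  proof (intro conjI allI impI)
    have xx: "x \<in> V" "tri s (g 1) x" "x \<notin> g ` {0..<p}" using that OutT by (auto simp: Out_def)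
    show "(g(0 := x)) i \<in> V" if "0 \<le> i \<and> i < plen" for i
      using gin that xx by (auto simp: p_def)
    show "inj_on (g(0 := x)) {0..<plen}"
      using geq xx by (auto simp: inj_on_def p_def)
    show "adj ((g(0 := x)) i) ((g(0 := x)) (i+1))" if "0 \<le> i \<and> i + 1 < plen" for i
      using gadj[of i] that xx tri_adj_all[OF xx(2)] by (auto simp: p_def)
    show "\<not> tri ((g(0 := x)) i) ((g(0 := x)) (i+1)) ((g(0 := x)) (i+2))" if "0 \<le> i \<and> i + 2 < plen" for i
    proof (cases "i = 0")
      case True
      show ?thesis
      proof
        assume "tri ((g(0 := x)) i) ((g(0 := x)) (i+1)) ((g(0 := x)) (i+2))"
        then have "tri x (g 1) (g 2)" using True by simp
        then have "g 2 = s" using tri_unique[of x "g 1"] tri_perms[OF xx(2)] by blast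
        then show False using geq[of 2 0] that True g0 by (auto simp: p_def)
      qed
    next
      case False
      then show ?thesis using gtri[of i] that by (auto simp: p_def)
    qed
  qed
  have OutS: "Out \<subseteq> ?S"
  proof
    fix x assume "x \<in> Out"
    from swap[OF this] show "x \<in> ?S" unfolding path_ends_def by (auto intro!: exI[of _ "g(0 := x)"])
  qed
  have ginj: "inj_on g I" using geq by (auto simp: inj_on_def I_def)
  have N1: "{z \<in> V. adj s z} = g ` I \<union> Out"
  proof (intro equalityI subsetI)
    fix z assume z: "z \<in> {z \<in> V. adj s z}"
    show "z \<in> g ` I \<union> Out"
    proof (cases "z \<in> g ` {0..<p}")
      case True
      then obtain i where i: "0 \<le> i" "i < p" "z = g i" by auto
      moreover have "i \<noteq> 0" using i z adj_irrefl g0 by auto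
      ultimately show ?thesis using z by (auto simp: I_def)
    qed (use z in \<open>auto simp: Out_def\<close>)
  qed (auto simp: I_def Out_def gin)
  have d1: "deg V s = int (card I) + int (card Out)"
  proof -
    have "g ` I \<inter> Out = {}" by (auto simp: I_def Out_def)
    then show ?thesis unfolding deg_def N1
      using fin ginj by (subst card_Un_disjoint) (auto simp: card_image)
  qed
  have d2: "deg (V - ?S) s = int (card Is)"
  proof -
    have "{z \<in> V - ?S. adj s z} = {z \<in> V. adj s z} - ?S" by auto
    also have "\<dots> = g ` Is" unfolding N1 using OutS by (auto simp: Is_def)
    finally show ?thesis using ginj inj_on_subset[of g I Is]
      by (simp add: deg_def card_image Is_def)
  qed
  have cI: "card I = card A + card Lst + card X"
  proof -
    have "card (A \<union> (Lst \<union> X)) = card A + card Lst + card X"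
      using fin LX by (subst card_Un_disjoint) (auto simp: card_Un_disjoint A_def)
    moreover have "A \<union> (Lst \<union> X) = I" using LstI XI by (auto simp: A_def)
    ultimately show ?thesis by simp
  qed
  have subs1: "(\<lambda>i. i - 1) ` A \<union> Is \<subseteq> {0..L}" using LM by (force simp: A_def Is_def I_def)
  \<comment> \<open>The union is disjoint because predecessors of usable positions carry ends by
    \<open>A_S\<close>, while \<open>Is\<close> consists of positions without ends.\<close>
  have c1: "card ((\<lambda>i. i - 1) ` A \<union> Is) = card A + card Is"
    using fin A_S by (subst card_Un_disjoint) (auto simp: card_image Is_def)
  have b1: "int (card A) + int (card Is) \<le> L + 1"
    using card_mono[OF _ subs1] c1 LI by (auto simp: I_def)
  have subs2: "Lst \<union> (\<lambda>i. i + 1) ` Lst \<union> X \<subseteq> {2..L}"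
    using Lst2 X2 LM LstI XI LstA by (force simp: A_def)
  have c2: "card (Lst \<union> (\<lambda>i. i + 1) ` Lst \<union> X) = 2 * card Lst + card X"
  proof -
    have "Lst \<inter> (\<lambda>i. i + 1) ` Lst = {}" "(Lst \<union> (\<lambda>i. i + 1) ` Lst) \<inter> X = {}"
      using LstA LX by (auto simp: A_def)
    then show ?thesis using fin by (subst card_Un_disjoint, simp_all, subst card_Un_disjoint, simp_all add: card_image)
  qed
  have b2: "2 * int (card Lst) + int (card X) \<le> L - 1"
  proof -
    have "L \<ge> 1" using LI by (auto simp: I_def)
    then show ?thesis using card_mono[OF _ subs2] c2 by auto
  qed
  \<comment> \<open>Twice \<open>b1\<close> plus \<open>b2\<close>: lost positions enter the degree
    once, but use up two places in the range \<open>{2..L}\<close>.\<close>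
  have main: "2 * k \<le> 3 * L + 1 + int (card X) + 2 * int (card Out)"
    using s(2) d1 d2 cI b1 b2 by linarith
  have L2: "L \<ge> 2" using main XO k4 by linarith
  have Lp: "L < p" "adj s (g L)" using LI by (auto simp: I_def)
  \<comment> \<open>The cycle through the last neighbour loses a vertex only if a closing turn is
    forbidden: \<open>s\<close> is dropped if the triangle is at \<open>g 1\<close>, and
    \<open>g L\<close> is dropped if it is at \<open>g (L - 1)\<close>. Only the latter, with
    equality throughout, is compatible with the assumed shortness of cycles.\<close>
  have T1: "2 * k = 3 * L + 3 \<and> card Out = 1 \<and> X = {}"
  proof (cases "L \<in> X")
    case True
    then have t: "tri s (g 1) (g L)" by (auto simp: X_def)
    have "card X = 1" using True cX fin by (metis One_nat_def card_0_eq empty_iff le_Suc_eq le_zero_eq)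
    have L3: "L \<noteq> 2" using t gtri[of 0] g0 Lp by auto
    have "\<not> tri (g (L-1)) (g L) (g 1)"
    proof
      assume "tri (g (L-1)) (g L) (g 1)"
      then have "g (L - 1) = s" using tri_unique[of "g 1" "g L"] tri_perms t by blast
      then show False using geq[of "L-1" 0] L2 L3 Lp g0 by auto
    qed
    moreover have "\<not> tri (g L) (g 1) (g (1+1))"
    proof
      assume "tri (g L) (g 1) (g (1+1))"
      then have "g 2 = s" using tri_unique[of "g L" "g 1"] tri_perms[OF t] by auto
      then show False using geq[of 2 0] L2 L3 Lp g0 by auto
    qed
    ultimately have "is_cycle V (map g [1..L])"
      using L2 L3 Lp tri_adj_all[OF t] by (intro gcyc) auto
    from nc'[OF this] have "3 * L + 3 \<le> 2 * k" using L2 by simp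
    then have False using main XO \<open>card X = 1\<close> by linarith
    then show ?thesis ..
  next
    case nX: False
    show ?thesis
    proof (cases "tri s (g L) (g (L - 1))")
      case False
      have "is_cycle V (map g [0..L])"
        using nX False Lp L2 LI g0 by (intro gcyc) (auto simp: X_def adj_commute tri_ac)
      from nc'[OF this] have "3 * L + 6 \<le> 2 * k" using L2 by simp
      then have False using main XO by linarith
      then show ?thesis ..
    next
      case t: True
      have L3: "L \<noteq> 2" using t gtri[of 0] g0 Lp by (auto simp: tri_ac)
      have "\<not> tri (g (L-1-1)) (g (L-1)) (g 0)"
      proof
        assume "tri (g (L-1-1)) (g (L-1)) (g 0)"
        then have "g (L - 1 - 1) = g L" using tri_unique[of "g (L-1)" "g 0"] tri_perms t g0 by blast
        then show False using geq[of "L-1-1" L] L2 L3 Lp g0 by auto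
      qed
      moreover have "\<not> tri (g (L-1)) (g 0) (g (0+1))"
      proof
        assume "tri (g (L-1)) (g 0) (g (0+1))"
        then have "g 1 = g L" using tri_unique[of "g (L-1)" "g 0"] tri_perms[OF t] g0 by auto
        then show False using geq[of 1 L] L2 L3 Lp g0 by auto
      qed
      ultimately have "is_cycle V (map g [0..L-1])"
        using L2 L3 Lp tri_adj_all[OF t] g0 by (intro gcyc) auto
      from nc'[OF this] have "3 * L + 3 \<le> 2 * k" using L2 by simp
      then have "card Out = 1" "card X = 0" "2 * k = 3 * L + 3" using main XO by linarith+
      then show ?thesis using fin by auto
    qed
  qed
  then have kL: "2 * k = 3 * L + 3" and cOut: "card Out = 1" and X0: "X = {}" by auto
  have tight1: "(\<lambda>i. i - 1) ` A \<union> Is = {0..L}"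
  proof (rule card_seteq[OF _ subs1])
    have "L + 1 \<le> int (card A) + int (card Is)"
      using s(2) d1 d2 cI b1 b2 kL cOut X0 by simp
    then show "card {0..L} \<le> card ((\<lambda>i. i - 1) ` A \<union> Is)" using c1 by simp
  qed simp
  \<comment> \<open>Equality in the count means that lost positions and their successors alternate
    all the way up to \<open>L\<close>; the steps below use that every usable position from 2 on
    follows a lost one.\<close>
  have tight2: "Lst \<union> (\<lambda>i. i + 1) ` Lst = {2..L}"
  proof -
    have "2 * int (card Lst) \<ge> L - 1"
      using s(2) d1 d2 cI b1 b2 kL cOut X0 by simp
    then have "Lst \<union> (\<lambda>i. i + 1) ` Lst \<union> X = {2..L}"
      using c2 subs2 L2 by (intro card_seteq) auto
    then show ?thesis using X0 by simp
  qed
  obtain x where x: "x \<in> Out" using cOut by fastforce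
  have xt: "tri s (g 1) x" and xV: "x \<in> V" and xo: "x \<notin> g ` {0..<p}" using x OutT by (auto simp: Out_def)
  have xng: "x \<noteq> g i" if "0 \<le> i" "i < p" for i using xo that by auto
  have xs: "x \<noteq> s" using tri_distinct[OF xt] by auto
  define h where "h = g(0 := x)"
  have ph: "path_fun h" using swap[OF x] by (simp add: h_def)
  have h0: "h 0 = x" and hg: "\<And>i. i \<noteq> 0 \<Longrightarrow> h i = g i" by (auto simp: h_def)
  have x1u: "w = s" if "tri x (g 1) w \<or> tri (g 1) x w" for w
    using that tri_unique[of x "g 1"] tri_perms[OF xt] tri_perms by blast
  \<comment> \<open>The equation \<open>2 * k = 3 * L + 3\<close> makes \<open>k\<close> a multiple
    of 3, so \<open>k \<ge> 6\<close> and every degree is at least 3.\<close>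
  obtain z where z: "z \<in> V" "adj x z" "z \<noteq> s" "z \<noteq> g 1"
  proof -
    have "\<exists>z. z \<in> V \<and> adj x z \<and> z \<noteq> s \<and> z \<noteq> g 1"
    proof (rule ccontr)
      assume "\<not> ?thesis"
      then have "{z \<in> V. adj x z} \<subseteq> {s, g 1}" by auto
      then have "card {z \<in> V. adj x z} \<le> card {s, g 1}" by (intro card_mono) auto
      also have "\<dots> \<le> 2" by (simp add: card_insert_if)
      finally have "deg V x \<le> 2" by (simp add: deg_def)
      then show False using deg_ge[OF xV] kL k4 by presburger
    qed
    then show ?thesis using that by blast
  qed
  obtain i where i: "2 \<le> i" "i < p" "z = g i"
  proof -
    have "z \<in> h ` {0..<plen}"
    proof (rule ccontr)
      assume "z \<notin> h ` {0..<plen}"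
      from pf_outside_nbr[OF ph z(1) _ this] have "tri x (g 1) z" using z h0 hg by simp
      then show False using x1u z by blast
    qed
    then obtain i where "0 \<le> i" "i < p" "z = h i" by (auto simp: p_def)
    moreover have "i \<noteq> 0" using \<open>z = h i\<close> h0 z adj_irrefl by auto
    moreover have "i \<noteq> 1" using \<open>z = h i\<close> hg z by auto
    ultimately show ?thesis using that[of i] hg by auto
  qed
  have hrot: "g (j - 1) \<in> ?S" if "2 \<le> j" "j < p" "adj x (g j)" "j + 1 < p \<Longrightarrow> \<not> tri x (g j) (g (j + 1))" for j
  proof -
    have "h (j - 1) \<in> ?S"
    proof (rule pf_rotate[OF ph])
      show "\<not> tri (h 1) (h 0) (h j)"
      proof
        assume "tri (h 1) (h 0) (h j)"
        then have "g j = s" using x1u that h0 hg by auto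
        then show False using geq[of j 0] that g0 by auto
      qed
    qed (use that h0 hg in \<open>auto simp: p_def\<close>)
    then show ?thesis using hg that by simp
  qed
  have SA: "j + 1 \<in> A" if "g j \<in> ?S" "0 \<le> j" "j \<le> L" for j
  proof -
    have "j \<in> (\<lambda>i. i - 1) ` A \<union> Is" using tight1 that by auto
    moreover have "j \<notin> Is" using that by (auto simp: Is_def)
    ultimately show ?thesis by force
  qed
  have AL: "j - 1 \<in> Lst" if "j \<in> A" "2 \<le> j" for j
  proof -
    have "j \<le> L" using that LM by (auto simp: A_def)
    then have "j \<in> Lst \<union> (\<lambda>i. i + 1) ` Lst" using tight2 that by auto
    then show ?thesis using that by (auto simp: A_def)
  qed
  show False
  proof (cases "i \<le> L")
    case iL: True
    show False
    proof (cases "i + 1 < p \<and> tri x (g i) (g (i + 1))")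
      case False
      then have "g (i - 1) \<in> ?S" using hrot i z by auto
      then have "i \<in> A" using SA[of "i - 1"] i iL by auto
      then have l: "i - 1 \<in> Lst" using AL i by auto
      then have i3: "i \<ge> 3" and t: "tri s (g (i-1)) (g i)" using Lst2[OF l] by (auto simp: Lst_def)
      \<comment> \<open>Since \<open>s, g (i - 1), g i\<close> is a triangle, \<open>s\<close> and
        \<open>x\<close> can both be inserted between \<open>g (i - 1)\<close> and
        \<open>g i\<close>. The resulting path has all vertices of \<open>g\<close> and also
        \<open>x\<close>, one more than the maximum.\<close>
      let ?a = "map g [1..i-1]" and ?b = "map g [i..p-1]"
      have seg: "good ?a" "distinct ?a" "set ?a \<subseteq> V" "good ?b" "distinct ?b" "set ?b \<subseteq> V"
        using pf_seg[OF pf, of 1 "i-1"] pf_seg[OF pf, of i "p-1"] i by (auto simp: p_def)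
      have q1: "\<not> tri (g (i-1-1)) (g (i-1)) s"
      proof
        assume "tri (g (i-1-1)) (g (i-1)) s"
        then have "g (i-1-1) = g i" using tri_unique[of "g (i-1)" s] tri_perms t by blast
        then show False using geq[of "i-1-1" i] i i3 by auto
      qed
      have q2: "\<not> tri (g (i-1)) s x"
      proof
        assume "tri (g (i-1)) s x"
        then have "g (i-1) = g 1" using tri_unique[of s x] tri_perms xt by blast
        then show False using geq[of "i-1" 1] i i3 by auto
      qed
      have q3: "\<not> tri s x (g i)"
      proof
        assume "tri s x (g i)"
        then have "g i = g 1" using tri_unique[of s x] tri_perms xt by blast
        then show False using geq[of "i" 1] i i3 by auto
      qed
      have q4: "adj (g (i-1)) s" "adj s x" "adj x (g i)" "i < p - 1 \<longrightarrow> \<not> tri x (g i) (g (i+1))"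
        using tri_adj_all[OF t] tri_adj_all[OF xt] z i False by auto
      have "good (s # x # ?b)" using seg q2 q3 q4 i by (auto simp: good_Cons map_upto_ends)
      then have "good (?a @ s # x # ?b)"
        using seg q1 q2 q4 i3 i by (subst good_append) (auto simp: map_upto_ends)
      moreover have "distinct (?a @ s # x # ?b)" "set (?a @ s # x # ?b) \<subseteq> V"
      proof -
        have "s \<notin> g ` {1..<p}"
        proof
          assume "s \<in> g ` {1..<p}"
          then obtain j where "1 \<le> j" "j < p" "g 0 = g j" using g0 by auto
          then show False using geq[of 0 j] by auto
        qed
        then have "s \<notin> set ?a \<union> set ?b" "x \<notin> set ?a \<union> set ?b"
          using xo i i3 by auto
        moreover have "set ?a \<inter> set ?b = {}" using i i3 by (auto simp: geq)
        ultimately show "distinct (?a @ s # x # ?b)" using seg(2,5) xs by auto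
        show "set (?a @ s # x # ?b) \<subseteq> V" using seg(3,6) xV gin[of 0] g0 p2 by auto
      qed
      ultimately have "is_path V (?a @ s # x # ?b)" by (simp add: is_path_def)
      from plen_max[OF this] show False using i i3 by (simp add: p_def)
    next
      case True
      have "\<not> tri x (g (i+1)) (g (i+1+1))" if "i + 1 + 1 < p"
      proof
        assume "tri x (g (i+1)) (g (i+1+1))"
        then have "g (i+1+1) = g i" using tri_unique[of x "g (i+1)"] tri_perms True by blast
        then show False using geq[of "i+1+1" i] i that by auto
      qed
      then have "g i \<in> ?S" using hrot[of "i+1"] True i tri_adj_all by (auto dest: tri_adj_all)
      then have "i + 1 \<in> A" using SA[of i] i iL by auto
      then have "i \<in> Lst" using AL[of "i+1"] i by auto
      then have "tri s (g i) (g (i+1))" by (auto simp: Lst_def)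
      then have "x = s" using True tri_unique[of "g i" "g (i+1)"] tri_perms by blast
      then show False using xs by simp
    qed
  next
    case iL: False
    \<comment> \<open>Now \<open>x\<close> has a neighbour beyond position \<open>L\<close>. By
      \<open>kL\<close> no cycle has more than \<open>L\<close> vertices, but closing the path
      \<open>h\<close> at this neighbour, or one step before it, gives a longer one.\<close>
    have nt1: "\<not> tri (h j) (h 0) (h (0 + 1))" if "2 \<le> j" "j < p" for j
    proof
      assume "tri (h j) (h 0) (h (0 + 1))"
      then have "g j = s" using x1u[of "g j"] that h0 hg by (auto simp: tri_ac)
      then show False using geq[of j 0] that g0 by auto
    qed
    show False
    proof (cases "tri x (g i) (g (i - 1))")
      case False
      have "is_cycle V (map h [0..i])"
      proof (rule pf_cycle[OF ph])
        show "\<not> tri (h (i - 1)) (h i) (h 0)" using False h0 hg i by (auto simp: tri_ac)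
        show "\<not> tri (h i) (h 0) (h (0 + 1))" using nt1 i by auto
      qed (use i z h0 hg in \<open>auto simp: p_def adj_commute\<close>)
      from nc'[OF this] show False using kL iL i by auto
    next
      case t: True
      have "is_cycle V (map h [0..i-1])"
      proof (rule pf_cycle[OF ph])
        show "\<not> tri (h (i - 1 - 1)) (h (i - 1)) (h 0)"
        proof
          assume "tri (h (i - 1 - 1)) (h (i - 1)) (h 0)"
          then have "tri (g (i-1-1)) (g (i-1)) x" using h0 hg i iL L2 by auto
          then have "g (i-1-1) = g i" using tri_unique[of "g (i-1)" x] tri_perms t by blast
          then show False using geq[of "i-1-1" i] i iL L2 by auto
        qed
        show "\<not> tri (h (i-1)) (h 0) (h (0 + 1))" using nt1 i iL L2 by auto
      qed (use i iL L2 t tri_adj_all[OF t] h0 hg in \<open>auto simp: p_def adj_commute\<close>)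
      from nc'[OF this] show False using kL iL i L2 by auto
    qed
  qed
qed

end

section \<open>Longest cycles\<close>

text \<open>The cycle is a function on all integers with exact period \<open>c\<close>, which spares
  reductions modulo \<open>c\<close> and makes both orientations instances of the same
  locale.\<close>

locale longest_cycle = critical_graph adj tri V k
  for adj :: "'a \<Rightarrow> 'a \<Rightarrow> bool" and tri :: "'a \<Rightarrow> 'a \<Rightarrow> 'a \<Rightarrow> bool" and V :: "'a set" and k :: int +
  fixes f :: "int \<Rightarrow> 'a" and c :: int
  assumes c3: "c \<ge> 3"
    and f_eq: "f i = f j \<longleftrightarrow> c dvd i - j"
    and f_in: "f i \<in> V"
    and f_adj: "adj (f i) (f (i + 1))"
    and f_tri: "\<not> tri (f i) (f (i + 1)) (f (i + 2))"
    and max_cycle: "is_cycle V xs \<Longrightarrow> int (length xs) \<le> c"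
    and c_long: "3 * c + 2 \<ge> 2 * k"

context critical_graph
begin

lemma longest_cycle_exists: "\<exists>f c. longest_cycle adj tri V k f c"
proof -
  let ?L = "{length xs |xs. is_cycle V xs}"
  have fin: "finite ?L"
  proof (rule finite_subset)
    show "?L \<subseteq> {..nat k}"
    proof
      fix l assume "l \<in> ?L"
      then obtain xs where "is_cycle V xs" "l = length xs" by blast
      then have "is_path V xs" by (simp add: is_cycle_def is_path_def)
      from nopath[OF this] show "l \<in> {..nat k}" using \<open>l = length xs\<close> by auto
    qed
  qed simp
  obtain zs where zs: "is_cycle V zs" "3 * int (length zs) + 2 \<ge> 2 * k" using long_cycle by blast
  have "Max ?L \<in> ?L" by (rule Max_in[OF fin]) (use zs in auto)
  then obtain xs where xs: "is_cycle V xs" "length xs = Max ?L" by auto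
  have mx: "length ys \<le> length xs" if "is_cycle V ys" for ys
    using that fin xs(2) by (auto intro!: Max_ge)
  define n where "n = int (length xs)"
  define f where "f i = xs ! nat (i mod n)" for i
  have d: "distinct xs" "set xs \<subseteq> V" "length xs \<ge> 3" "good xs" "adj (last xs) (hd xs)"
    "\<not> tri (penult xs) (last xs) (hd xs)" "\<not> tri (last xs) (hd xs) (second xs)"
    using xs(1) by (auto simp: is_cycle_def)
  have n3: "n \<ge> 3" using d by (simp add: n_def)
  have ends: "hd xs = f 0" "second xs = f 1" "last xs = f (n - 1)" "penult xs = f (n - 2)"
  proof -
    have ne: "xs \<noteq> []" "tl xs \<noteq> []" "butlast xs \<noteq> []" using d(3) by (cases xs; auto)+
    show "hd xs = f 0" using ne by (simp add: f_def hd_conv_nth)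
    have "1 mod n = 1" using n3 by simp
    then show "second xs = f 1" using ne by (cases xs) (auto simp: f_def hd_conv_nth)
    have "(n - 1) mod n = n - 1" by (rule mod_pos_pos_trivial) (use n3 in auto)
    then show "last xs = f (n - 1)" using ne d(3) by (simp add: f_def last_conv_nth n_def nat_diff_distrib)
    have "(n - 2) mod n = n - 2" by (rule mod_pos_pos_trivial) (use n3 in auto)
    then show "penult xs = f (n - 2)" using ne d(3)
      by (simp add: f_def last_conv_nth n_def nat_diff_distrib nth_butlast numeral_2_eq_2)
  qed
  have m: "0 \<le> i mod n" "i mod n < n" for i using n3 by auto
  have fmod: "f (i mod n + j) = f (i + j)" for i j
    by (simp add: f_def mod_add_left_eq)
  have adj: "adj (f i) (f (i + 1))" for i
  proof -
    define j where "j = i mod n"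
    have j: "0 \<le> j" "j < n" using m by (auto simp: j_def)
    have "adj (f j) (f (j + 1))"
    proof (cases "j = n - 1")
      case True
      have "f n = f 0" by (simp add: f_def)
      then show ?thesis using True d(5) ends by simp
    next
      case False
      then have "adj (xs ! nat j) (xs ! Suc (nat j))" using good_nth(1)[OF d(4), of "nat j"] j
        by (auto simp: n_def)
      moreover have "f j = xs ! nat j" "f (j + 1) = xs ! Suc (nat j)"
        using False j by (auto simp: f_def nat_add_distrib)
      ultimately show ?thesis by simp
    qed
    then show ?thesis using fmod[of i 0] fmod[of i 1] by (simp add: j_def)
  qed
  have tri: "\<not> tri (f i) (f (i + 1)) (f (i + 2))" for i
  proof -
    define j where "j = i mod n"
    have j: "0 \<le> j" "j < n" using m by (auto simp: j_def)
    have f01: "f n = f 0" "f (n + 1) = f 1" by (auto simp: f_def)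
    have "\<not> tri (f j) (f (j + 1)) (f (j + 2))"
    proof (cases "j = n - 1 \<or> j = n - 2")
      case True
      then show ?thesis using f01 d(6,7) ends by (auto simp: add.commute)
    next
      case False
      then have j2: "j + 2 < n" using j by auto
      then have "\<not> tri (xs ! nat j) (xs ! Suc (nat j)) (xs ! Suc (Suc (nat j)))"
        using good_nth(2)[OF d(4), of "nat j"] j by (auto simp: n_def)
      moreover have "f j = xs ! nat j" "f (j + 1) = xs ! Suc (nat j)" "f (j + 2) = xs ! Suc (Suc (nat j))"
        using j2 j by (auto simp: f_def nat_add_distrib)
      ultimately show ?thesis by simp
    qed
    then show ?thesis using fmod[of i 0] fmod[of i 1] fmod[of i 2] by (simp add: j_def)
  qed
  have "longest_cycle adj tri V k f n"
  proof unfold_locales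
    show "n \<ge> 3" by (rule n3)
    show "f i = f j \<longleftrightarrow> n dvd i - j" for i j
    proof -
      have "f i = f j \<longleftrightarrow> nat (i mod n) = nat (j mod n)"
        unfolding f_def using d(1) m[of i] m[of j]
        by (intro nth_eq_iff_index_eq) (auto simp: n_def)
      also have "\<dots> \<longleftrightarrow> i mod n = j mod n" using m(1)[of i] m(1)[of j] by (simp add: eq_nat_nat_iff)
      finally show ?thesis by (simp add: mod_eq_dvd_iff)
    qed
    show "f i \<in> V" for i
    proof -
      have "nat (i mod n) < length xs" using m[of i] by (simp add: n_def nat_less_iff)
      then have "f i \<in> set xs" unfolding f_def by (rule nth_mem)
      then show ?thesis using d(2) by blast
    qed
    show "adj (f i) (f (i + 1))" for i by (rule adj)
    show "\<not> tri (f i) (f (i + 1)) (f (i + 2))" for i by (rule tri)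
    show "int (length ys) \<le> n" if "is_cycle V ys" for ys using mx[OF that] by (simp add: n_def)
    show "3 * n + 2 \<ge> 2 * k" using zs(2) mx[OF zs(1)] by (simp add: n_def)
  qed
  then show ?thesis by blast
qed

end

context longest_cycle
begin

lemma f_per: "f (i + c) = f i" "f (i - c) = f i" "f (c + i) = f i"
  by (auto simp: f_eq)

lemma f_per1: "f (i + c + 1) = f (i + 1)" "f (i + c - 1) = f (i - 1)" "f (i + c + 2) = f (i + 2)"
  using f_eq by auto

lemma f_ne: "0 < j - i \<Longrightarrow> j - i < c \<Longrightarrow> f i \<noteq> f j" "0 < i - j \<Longrightarrow> i - j < c \<Longrightarrow> f i \<noteq> f j"
  using zdvd_not_zless[of "j - i" c] zdvd_not_zless[of "i - j" c] by (auto simp: f_eq dvd_diff_commute)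

lemma f_ne_near: "f (i + 1) \<noteq> f i" "f (i - 1) \<noteq> f i" "f (i + 1) \<noteq> f (i - 1)" "f (i + 2) \<noteq> f i" "f (i+2) \<noteq> f (i+1)" 
  "f i \<noteq> f (i + 1)" "f i \<noteq> f (i - 1)" "f (i - 1) \<noteq> f (i + 1)" "f i \<noteq> f (i + 2)" "f (i+1) \<noteq> f (i+2)"
  by (rule f_ne, (use c3 in simp), (use c3 in simp))+

text \<open>Interpreting the locale for the reversed cycle yields the mirror image of every later
  statement.\<close>

lemma reflected: "longest_cycle adj tri V k (\<lambda>i. f (- i)) c"
proof unfold_locales
  show "f (- i) = f (- j) \<longleftrightarrow> c dvd i - j" for i j by (simp add: f_eq dvd_diff_commute)
  have e: "- (i + 1) = - i - 2 + 1" "- i = - i - 2 + 2" "- (i + 2) = - i - 2" for i :: int by auto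
  show "adj (f (- i)) (f (- (i + 1)))" for i using f_adj[of "- (i + 1)"] by (simp add: adj_sym)
  show "\<not> tri (f (- i)) (f (- (i + 1))) (f (- (i + 2)))" for i
    using f_tri[of "- i - 2"] tri_rev unfolding e(1,3) by (subst e(2)) blast
qed (use c3 f_in max_cycle c_long in auto)

definition C :: "'a set" where "C = range f"
definition W :: "'a set" where "W = V - C"

lemma C_eq: "C = f ` {a..<a + c}"
proof -
  have "f i \<in> f ` {a..<a + c}" for i
  proof -
    have "f i = f ((i - a) mod c + a)"
      unfolding f_eq using dvd_minus_mod[of c "i - a"] by (simp add: diff_diff_eq add.commute)
    moreover have "(i - a) mod c + a \<in> {a..<a + c}" using c3 by auto
    ultimately show ?thesis by blast
  qed
  then show ?thesis by (auto simp: C_def)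
qed

lemma f_C[simp]: "f i \<in> C" by (simp add: C_def)

lemma f_inj: "inj_on f {a..<a + c}"
proof (rule inj_onI)
  fix i j assume "i \<in> {a..<a + c}" "j \<in> {a..<a + c}" "f i = f j"
  then show "i = j" using f_ne(1)[where i=i and j=j] f_ne(2)[where i=i and j=j] by (cases i j rule: linorder_cases) auto
qed

lemma card_C: "int (card C) = c"
  using C_eq[of 0] f_inj[of 0] c3 by (simp add: card_image)

lemma C_sub: "C \<subseteq> V" using f_in by (auto simp: C_def)

lemma fin_C: "finite C" and fin_W: "finite W"
  using finite_sub C_sub finV by (auto simp: W_def)

lemma card_W: "int (card W) = int (card V) - c"
  using card_C C_sub finV fin_C card_mono[OF finV C_sub] by (simp add: W_def card_Diff_subset of_nat_diff)

lemma arc: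
  shows "good (map f [a..b])" "b - a < c \<Longrightarrow> distinct (map f [a..b])" "set (map f [a..b]) \<subseteq> C"
proof -
  show "good (map f [a..b])" by (rule good_map) (use f_adj f_tri in auto)
  show "distinct (map f [a..b])" if "b - a < c"
  proof -
    have "{a..b} \<subseteq> {a..<a + c}" using that by auto
    then have "inj_on f {a..b}" by (rule inj_on_subset[OF f_inj])
    then show ?thesis by (simp add: distinct_map)
  qed
  show "set (map f [a..b]) \<subseteq> C" by auto
qed

text \<open>The ear \<open>ws\<close> replaces the \<open>j - i - 1\<close> cycle vertices strictly
  between \<open>f i\<close> and \<open>f j\<close>. The result is a cycle, so maximality of
  \<open>c\<close> bounds the ear.\<close>

lemma ear_cycle:
  assumes ws: "ws \<noteq> []" "distinct ws" "set ws \<subseteq> W"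
    and ij: "i < j" "j < i + c"
    and g: "good (f i # ws @ [f j])" "\<not> tri (f (i - 1)) (f i) (hd ws)" "\<not> tri (last ws) (f j) (f (j + 1))"
  shows "int (length ws) < j - i"
proof -
  let ?a = "map f [j..i + c]"
  let ?ys = "ws @ ?a"
  have ja: "j \<le> i + c" "j \<le> i + c - 1" "j + 1 \<le> i + c" using ij by auto
  have gw: "good ws" "adj (last ws) (f j)" "adj (f i) (hd ws)" "butlast ws \<noteq> [] \<longrightarrow> \<not> tri (penult ws) (last ws) (f j)"
    using g(1) ws(1) good_append[OF ws(1), of "[f j]"] by (auto simp: good_Cons)
  have sec: "\<not> tri (f i) (hd ws) (second (ws @ [f j]))"
    using g(1) ws(1) by (auto simp: good_Cons)
  have sec': "second ?ys = second (ws @ [f j])"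
    using ws(1) ja by (cases ws) (auto simp: map_upto_ends hd_append)
  have good: "good ?ys"
    using gw g(3) ws(1) ja arc(1) by (subst good_append) (auto simp: map_upto_ends)
  have la: "last ?ys = f i" "hd ?ys = hd ws" "penult ?ys = f (i - 1)"
    using ws(1) ja f_per1(2)[of i] by (auto simp: map_upto_ends f_per butlast_append)
  have "is_cycle V ?ys"
    unfolding is_cycle_def la sec'
  proof (intro conjI)
    show "distinct ?ys" using ws arc(2)[of "i + c" j] arc(3)[of j "i + c"] ij by (auto simp: W_def)
    show "set ?ys \<subseteq> V" using ws arc(3)[of j "i + c"] C_sub by (auto simp: W_def)
    show "length ?ys \<ge> 3" using ws(1) ja by (cases ws) auto
    show "\<not> tri (f i) (hd ws) (hd (tl (ws @ [f j])))" by (rule sec)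
  qed (use good gw g in auto)
  from max_cycle[OF this] show ?thesis using ja by simp
qed

text \<open>The path follows \<open>ws\<close> and then runs once around the cycle, from
  \<open>f i\<close> to \<open>f (i - 1)\<close>.\<close>

lemma ear_path:
  assumes ws: "ws \<noteq> []" "distinct ws" "set ws \<subseteq> W"
    and g: "good (ws @ [f i])" "\<not> tri (last ws) (f i) (f (i + 1))"
  shows "int (length ws) + c \<le> k"
proof -
  let ?a = "map f [i..i + c - 1]"
  have ia: "i \<le> i + c - 1" "i + 1 \<le> i + c - 1" using c3 by auto
  have "good (ws @ ?a)" using g arc(1) ws(1) ia good_append[OF ws(1), of "[f i]"]
    by (subst good_append) (auto simp: map_upto_ends)
  then have "is_path V (ws @ ?a)"
    using ws arc[where a=i and b="i + c - 1"] C_sub by (auto simp: is_path_def W_def)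
  from nopath[OF this] show ?thesis using ia by simp
qed

text \<open>An edge lies in at most one triangle. This is why a path arriving from outside can
  always go around the cycle in one of the two directions.\<close>

lemma dir: "\<not> tri w (f i) (f (i + 1)) \<or> \<not> tri w (f i) (f (i - 1))"
  using tri_unique f_ne_near by metis

lemma ear_path_any:
  assumes ws: "ws \<noteq> []" "distinct ws" "set ws \<subseteq> W" and g: "good (ws @ [f i])"
  shows "int (length ws) + c \<le> k"
proof (cases "tri (last ws) (f i) (f (i + 1))")
  case False
  then show ?thesis using ear_path assms by blast
next
  case True
  then have n: "\<not> tri (last ws) (f i) (f (i - 1))" using dir by blast
  interpret r: longest_cycle adj tri V k "\<lambda>i. f (- i)" c by (rule reflected)
  have "r.C = C" by (auto simp: r.C_def C_def) (metis minus_minus rangeI)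
  then have "r.W = W" by (simp add: r.W_def W_def)
  then show ?thesis using r.ear_path[of ws "- i"] assms n by (simp add: algebra_simps)
qed

lemma C_ne_V: "C \<noteq> V"
proof
  assume "C = V"
  then have "int (card V) = c" using card_C by simp
  moreover have "is_path V (map f [0..c - 1])"
    using arc[where a=0 and b="c - 1"] C_sub by (auto simp: is_path_def)
  from nopath[OF this] have "c \<le> k" using c3 by simp
  ultimately show False using card_V_gt by simp
qed

lemma c_less: "c < k"
proof -
  have "C \<subset> V" "C \<noteq> {}" using C_ne_V C_sub by (auto simp: C_def)
  from connected[OF this] obtain x y where "x \<in> C" "y \<in> V - C" "adj x y" by blast
  then obtain i where "adj y (f i)" "y \<in> W" by (auto simp: C_def W_def adj_commute)
  then show ?thesis using ear_path_any[of "[y]" i] by simp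
qed

text \<open>Indices of the cycle are integers; a set of cyclic positions is counted in the window
  \<open>{0..<c}\<close>.\<close>

definition cnt :: "(int \<Rightarrow> bool) \<Rightarrow> int" where
  "cnt P = int (card {i. 0 \<le> i \<and> i < c \<and> P i})"

definition periodic :: "(int \<Rightarrow> bool) \<Rightarrow> bool" where
  "periodic P \<longleftrightarrow> (\<forall>i. P (i + c) = P i)"

lemma periodic_mod: "periodic P \<Longrightarrow> P (i mod c) = P i"
proof -
  assume P: "periodic P"
  have *: "P (j + int n * c) = P j" for j n
  proof (induction n)
    case (Suc n)
    have "P (j + int n * c + c) = P (j + int n * c)" using P unfolding periodic_def by blast
    then show ?case using Suc by (simp add: algebra_simps)
  qed simp
  show ?thesis
  proof (cases "i div c \<ge> 0")
    case True
    then show ?thesis using *[of "i mod c" "nat (i div c)"] by simp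
  next
    case False
    then have "P (i + int (nat (- (i div c))) * c) = P i" using * by blast
    moreover have "i + int (nat (- (i div c))) * c = i mod c"
      using False by (simp add: minus_div_mult_eq_mod[symmetric])
    ultimately show ?thesis by simp
  qed
qed

lemma cnt_window:
  assumes "periodic P"
  shows "int (card {i. a \<le> i \<and> i < a + c \<and> P i}) = cnt P"
proof -
  have "bij_betw (\<lambda>i. i mod c) {i. a \<le> i \<and> i < a + c \<and> P i} {i. 0 \<le> i \<and> i < c \<and> P i}"
  proof (rule bij_betw_byWitness[where f' = "\<lambda>j. (j - a) mod c + a"])
    show "\<forall>i\<in>{i. a \<le> i \<and> i < a + c \<and> P i}. (i mod c - a) mod c + a = i"
      using c3 by (auto simp: mod_diff_left_eq)
    show "\<forall>i\<in>{i. 0 \<le> i \<and> i < c \<and> P i}. ((i - a) mod c + a) mod c = i"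
      using c3 by (auto simp: mod_add_left_eq)
    show "(\<lambda>i. i mod c) ` {i. a \<le> i \<and> i < a + c \<and> P i} \<subseteq> {i. 0 \<le> i \<and> i < c \<and> P i}"
      using c3 assms periodic_mod by auto
    show "(\<lambda>j. (j - a) mod c + a) ` {i. 0 \<le> i \<and> i < c \<and> P i} \<subseteq> {i. a \<le> i \<and> i < a + c \<and> P i}"
    proof safe
      fix i assume i: "0 \<le> i" "i < c" "P i"
      have "((i - a) mod c + a) mod c = i" using i by (simp add: mod_add_left_eq)
      then show "P ((i - a) mod c + a)" using periodic_mod[OF assms] i by metis
      show "a \<le> (i - a) mod c + a" "(i - a) mod c + a < a + c" using c3 by auto
    qed
  qed
  then show ?thesis by (simp add: cnt_def bij_betw_same_card)
qed

lemma cnt_shift: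
  assumes "periodic P"
  shows "cnt (\<lambda>i. P (i + a)) = cnt P"
proof -
  have "(\<lambda>i. i + a) ` {i. 0 \<le> i \<and> i < c \<and> P (i + a)} = {i. a \<le> i \<and> i < a + c \<and> P i}"
  proof (intro equalityI subsetI)
    fix j assume "j \<in> {i. a \<le> i \<and> i < a + c \<and> P i}"
    then show "j \<in> (\<lambda>i. i + a) ` {i. 0 \<le> i \<and> i < c \<and> P (i + a)}"
      by (intro image_eqI[of _ _ "j - a"]) auto
  qed auto
  then have "card {i. 0 \<le> i \<and> i < c \<and> P (i + a)} = card {i. a \<le> i \<and> i < a + c \<and> P i}"
    by (metis (no_types, lifting) add_right_imp_eq card_image inj_onI)
  then show ?thesis using cnt_window[OF assms, of a] by (simp add: cnt_def)
qed

lemma cnt_finite: "finite {i. 0 \<le> i \<and> i < c \<and> P i}" 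
  by (rule finite_subset[of _ "{0..c}"]) auto

lemma cnt_nonneg: "cnt P \<ge> 0" by (simp add: cnt_def)

lemma cnt_True: "cnt (\<lambda>i. True) = c"
proof -
  have "{i. 0 \<le> i \<and> i < c \<and> True} = {0..<c}" by auto
  then show ?thesis using c3 by (simp add: cnt_def)
qed

lemma cnt_mono: "(\<And>i. P i \<Longrightarrow> Q i) \<Longrightarrow> cnt P \<le> cnt Q"
  unfolding cnt_def using cnt_finite by (auto intro!: card_mono)

lemma cnt_le_c: "cnt P \<le> c" using cnt_mono[of P "\<lambda>_. True"] cnt_True by simp

lemma cnt_disj: "(\<And>i. P i \<Longrightarrow> \<not> Q i) \<Longrightarrow> cnt (\<lambda>i. P i \<or> Q i) = cnt P + cnt Q"
proof -
  assume d: "\<And>i. P i \<Longrightarrow> \<not> Q i"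
  have "{i. 0 \<le> i \<and> i < c \<and> (P i \<or> Q i)} = {i. 0 \<le> i \<and> i < c \<and> P i} \<union> {i. 0 \<le> i \<and> i < c \<and> Q i}" by auto
  then show ?thesis unfolding cnt_def using d cnt_finite
    by (simp add: card_Un_disjoint disjoint_iff)
qed

lemma cnt_cong: "(\<And>i. P i = Q i) \<Longrightarrow> cnt P = cnt Q" by (simp add: cnt_def)

text \<open>A vertex \<open>w\<close> outside the cycle can enter it at a neighbour \<open>f i\<close> and continue backwards or
  forwards; exactly one of the two is blocked if \<open>w\<close> owns an adjacent cycle edge.\<close>

definition own where "own w i \<longleftrightarrow> tri w (f i) (f (i + 1))"
definition bwd where "bwd w i \<longleftrightarrow> adj w (f i) \<and> \<not> tri w (f i) (f (i - 1))"
definition fwd where "fwd w i \<longleftrightarrow> adj w (f i) \<and> \<not> tri w (f i) (f (i + 1))"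
definition both where "both w i \<longleftrightarrow> bwd w i \<and> fwd w i"
abbreviation nbr where "nbr w i \<equiv> adj w (f i)"

lemma periodics: "periodic (own w)" "periodic (bwd w)" "periodic (fwd w)" "periodic (both w)" "periodic (nbr w)"
  by (auto simp: periodic_def own_def bwd_def fwd_def both_def f_per f_per1)

text \<open>Everything follows from uniqueness of the triangle on an edge. In particular two cycle
  edges owned by the same vertex never share an end, so each owned edge accounts for two neighbours
  of its own.\<close>

lemma own_facts:
  assumes "own w i"
  shows "bwd w i" "fwd w (i + 1)" "nbr w i" "nbr w (i + 1)" "\<not> fwd w i" "\<not> bwd w (i + 1)" "\<not> both w i" "\<not> both w (i + 1)"
    "\<not> own w (i + 1)" "\<not> own w (i - 1)"
proof -
  have t: "tri w (f i) (f (i + 1))" "tri w (f (i + 1)) (f i)" using assms by (auto simp: own_def tri_ac)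
  note ta = tri_adj_all[OF t(1)]
  have u1: "d = f (i + 1)" if "tri w (f i) d" for d using tri_unique[OF that t(1)] .
  have u2: "d = f i" if "tri w (f (i + 1)) d" for d using tri_unique[OF that t(2)] .
  show "bwd w i" "fwd w (i + 1)" "nbr w i" "nbr w (i + 1)" "\<not> fwd w i" "\<not> bwd w (i + 1)" "\<not> both w i" "\<not> both w (i + 1)"
    "\<not> own w (i + 1)" "\<not> own w (i - 1)"
    using ta t u1[of "f (i - 1)"] u2[of "f (i + 1 + 1)"] f_ne_near[of i] tri_ac
    by (auto simp: bwd_def fwd_def both_def own_def add.assoc)
qed

lemma nbr_cases: "nbr w i \<longleftrightarrow> both w i \<or> own w i \<or> own w (i - 1)"
proof
  assume "nbr w i"
  then show "both w i \<or> own w i \<or> own w (i - 1)"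
    by (auto simp: both_def bwd_def fwd_def own_def tri_ac)
next
  assume "both w i \<or> own w i \<or> own w (i - 1)"
  then show "nbr w i" using own_facts(3)[of w i] own_facts(4)[of w "i - 1"] by (auto simp: both_def bwd_def)
qed

lemma bwd_cases: "bwd w i \<longleftrightarrow> both w i \<or> own w i"
  using own_facts(1,5)[of w i] by (auto simp: both_def fwd_def own_def bwd_def)

definition nboth where "nboth w = cnt (both w)"
definition nown where "nown w = cnt (own w)"

lemma deg_cnt: "deg C w = cnt (nbr w)"
proof -
  have "{u \<in> C. adj w u} = f ` {i. 0 \<le> i \<and> i < c \<and> nbr w i}" using C_eq[of 0] by auto
  moreover have "inj_on f {i. 0 \<le> i \<and> i < c \<and> nbr w i}"
    by (rule inj_on_subset[OF f_inj[of 0]]) auto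
  ultimately show ?thesis by (simp add: deg_def cnt_def card_image)
qed

lemma deg_C: "deg C w = nboth w + 2 * nown w"
proof -
  have "cnt (nbr w) = cnt (\<lambda>i. both w i \<or> (own w i \<or> own w (i - 1)))" by (rule cnt_cong) (rule nbr_cases)
  also have "\<dots> = cnt (both w) + cnt (\<lambda>i. own w i \<or> own w (i - 1))"
  proof (rule cnt_disj)
    fix i assume "both w i"
    then show "\<not> (own w i \<or> own w (i - 1))" using own_facts(7)[of w i] own_facts(8)[of w "i - 1"] by auto
  qed
  also have "cnt (\<lambda>i. own w i \<or> own w (i - 1)) = cnt (own w) + cnt (\<lambda>i. own w (i - 1))"
    by (rule cnt_disj) (rule own_facts(10))
  also have "cnt (\<lambda>i. own w (i - 1)) = cnt (own w)" using cnt_shift[OF periodics(1), of w "-1"] by simp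
  finally show ?thesis by (simp add: deg_cnt nboth_def nown_def)
qed

lemma cnt_bwd: "cnt (bwd w) = nboth w + nown w"
proof -
  have "cnt (bwd w) = cnt (\<lambda>i. both w i \<or> own w i)" by (rule cnt_cong) (rule bwd_cases)
  also have "\<dots> = nboth w + nown w" unfolding nboth_def nown_def using own_facts(7) by (intro cnt_disj) auto
  finally show ?thesis .
qed

text \<open>Otherwise \<open>w\<close> could be inserted between \<open>f i\<close> and
  \<open>f (i + 1)\<close>, giving a longer cycle; the turn at \<open>w\<close> is the only possible
  obstacle.\<close>

lemma insertion:
  assumes "w \<in> W" "bwd w i" "fwd w (i + 1)" shows "own w i"
proof (rule ccontr)
  assume n: "\<not> own w i"
  have "int (length [w]) < i + 1 - i"
    by (rule ear_cycle) (use assms n c3 in \<open>auto simp: bwd_def fwd_def own_def adj_commute tri_ac add.assoc\<close>)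
  then show False by simp
qed

lemma both_indep: "w \<in> W \<Longrightarrow> both w i \<Longrightarrow> \<not> both w (i + 1)"
  using insertion[of w i] own_facts(7)[of w i] by (auto simp: both_def)

text \<open>Count cycle edges: a position in \<open>both w\<close> meets two of them, no edge meets
  two such positions by \<open>both_indep\<close>, and none of these edges is owned by
  \<open>w\<close>.\<close>

lemma both_own_bound:
  assumes "w \<in> W" shows "2 * nboth w + nown w \<le> c"
proof -
  have "cnt (\<lambda>i. (both w i \<or> both w (i + 1)) \<or> own w i) \<le> c" by (rule cnt_le_c)
  moreover have "cnt (\<lambda>i. (both w i \<or> both w (i + 1)) \<or> own w i) = cnt (\<lambda>i. both w i \<or> both w (i + 1)) + cnt (own w)"
    using own_facts(7,8) by (intro cnt_disj) blast
  moreover have "cnt (\<lambda>i. both w i \<or> both w (i + 1)) = cnt (both w) + cnt (\<lambda>i. both w (i + 1))"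
    using both_indep[OF assms] by (intro cnt_disj) auto
  moreover have "cnt (\<lambda>i. both w (i + 1)) = cnt (both w)" by (rule cnt_shift) (rule periodics)
  ultimately show ?thesis by (simp add: nboth_def nown_def)
qed

lemma sum_cnt_disjoint:
  assumes "finite U" "\<And>u u' i. u \<in> U \<Longrightarrow> u' \<in> U \<Longrightarrow> P u i \<Longrightarrow> P u' i \<Longrightarrow> u = u'"
  shows "(\<Sum>u\<in>U. cnt (P u)) = cnt (\<lambda>i. \<exists>u\<in>U. P u i)"
  using assms
proof (induction U rule: finite_induct)
  case empty
  then show ?case by (simp add: cnt_def)
next
  case (insert x A)
  have "cnt (\<lambda>i. \<exists>u\<in>insert x A. P u i) = cnt (\<lambda>i. P x i \<or> (\<exists>u\<in>A. P u i))" by (rule cnt_cong) auto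
  also have "\<dots> = cnt (P x) + cnt (\<lambda>i. \<exists>u\<in>A. P u i)"
    using insert by (intro cnt_disj) blast
  also have "cnt (\<lambda>i. \<exists>u\<in>A. P u i) = (\<Sum>u\<in>A. cnt (P u))"
    by (rule insert.IH[symmetric]) (use insert.prems in blast)
  finally show ?case using insert by simp
qed

lemma own_unique: "own u i \<Longrightarrow> own u' i \<Longrightarrow> u = u'"
  unfolding own_def by (rule tri_unique[OF tri_perms(4) tri_perms(4)])

lemma sum_nown: "U \<subseteq> W \<Longrightarrow> (\<Sum>w\<in>U. nown w) = cnt (\<lambda>i. \<exists>w\<in>U. own w i)"
  unfolding nown_def using fin_W own_unique by (intro sum_cnt_disjoint) (auto intro: finite_subset)

end

section \<open>Cycles of length at most k - 3\<close>

context longest_cycle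
begin

lemma reflected_sets:
  "longest_cycle.C (\<lambda>i. f (- i)) = C" "longest_cycle.W V (\<lambda>i. f (- i)) = W"
proof -
  interpret r: longest_cycle adj tri V k "\<lambda>i. f (- i)" c by (rule reflected)
  show "r.C = C" by (auto simp: r.C_def C_def) (metis minus_minus rangeI)
  then show "r.W = W" by (simp add: r.W_def W_def)
qed

lemma ear_cycle_rev:
  assumes ws: "ws \<noteq> []" "distinct ws" "set ws \<subseteq> W"
    and ij: "j < i" "i < j + c"
    and g: "good (f i # ws @ [f j])" "\<not> tri (f (i + 1)) (f i) (hd ws)" "\<not> tri (last ws) (f j) (f (j - 1))"
  shows "int (length ws) < i - j"
proof -
  interpret r: longest_cycle adj tri V k "\<lambda>i. f (- i)" c by (rule reflected)
  have "int (length ws) < - j - (- i)"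
    by (rule r.ear_cycle) (use assms reflected_sets in \<open>auto simp: add.commute\<close>)
  then show ?thesis by simp
qed

text \<open>The list omits the base \<open>f j\<close>. Only the turn coming from
  \<open>f (j - 1)\<close> is required to be allowed; the opposite orientation is repaired by
  \<open>j'\<close> below.\<close>

definition ear :: "'a set \<Rightarrow> int \<Rightarrow> 'a list \<Rightarrow> bool" where
  "ear U j ws \<longleftrightarrow> ws \<noteq> [] \<and> distinct ws \<and> set ws \<subseteq> U \<and> good (f j # ws) \<and> \<not> tri (f (j - 1)) (f j) (hd ws)"

definition max_ear :: "'a set \<Rightarrow> int \<Rightarrow> bool" where
  "max_ear U l \<longleftrightarrow> (\<forall>j ws. ear U j ws \<longrightarrow> int (length ws) \<le> l)"

text \<open>If the turn at the base is forbidden, then \<open>f (j - 1)\<close>, \<open>f j\<close>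
  and the first vertex of \<open>ws\<close> form a triangle, and \<open>f (j - 1)\<close> can serve
  as base instead.\<close>

lemma ear_normalize:
  assumes "ws \<noteq> []" "distinct ws" "set ws \<subseteq> U" "good (f j # ws)" "U \<subseteq> W"
  shows "\<exists>j'. ear U j' ws"
proof (cases "tri (f (j - 1)) (f j) (hd ws)")
  case False
  then show ?thesis using assms by (auto simp: ear_def)
next
  case t: True
  have "good (f (j - 1) # ws)"
  proof -
    have "\<not> tri (f (j - 1)) (hd ws) (second ws)" if "tl ws \<noteq> []"
    proof
      assume "tri (f (j - 1)) (hd ws) (second ws)"
      then have "second ws = f j" using t tri_unique[of "f (j - 1)" "hd ws"] tri_perms by blast
      moreover have "second ws \<in> set ws" using that by (cases ws; cases "tl ws") auto
      ultimately show False using assms by (auto simp: W_def)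
    qed
    then show ?thesis using assms(1,4) tri_adj_all[OF t] by (auto simp: good_Cons)
  qed
  moreover have "\<not> tri (f (j - 1 - 1)) (f (j - 1)) (hd ws)"
  proof
    assume "tri (f (j - 1 - 1)) (f (j - 1)) (hd ws)"
    then have "f (j - 1 - 1) = f j" using t tri_unique[of "f (j - 1)" "hd ws"] tri_perms by blast
    then show False using f_ne(1)[where i="j - 1 - 1" and j=j] c3 by simp
  qed
  ultimately show ?thesis using assms by (auto simp: ear_def)
qed

lemma ear_length: "ear U j ws \<Longrightarrow> U \<subseteq> W \<Longrightarrow> int (length ws) + c \<le> k"
  using ear_path_any[of "rev ws" j] good_rev[of "f j # ws"] by (auto simp: ear_def)

lemma deg_insert_card:
  assumes "finite A" "{u \<in> U. adj w u} \<subseteq> A"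
  shows "deg U w \<le> int (card A)"
  unfolding deg_def using card_mono[OF assms] by simp

lemma cnt_le_1:
  assumes "\<And>i i'. P i \<Longrightarrow> P i' \<Longrightarrow> f i = f i'"
  shows "cnt P \<le> 1"
proof -
  have "i = i'" if "0 \<le> i" "i < c" "P i" "0 \<le> i'" "i' < c" "P i'" for i i'
    using assms[OF that(3,6)] inj_onD[OF f_inj[of 0]] that by auto
  then show ?thesis unfolding cnt_def using cnt_finite[of P] by (simp add: card_le_Suc0_iff_eq)
qed

lemma cnt_eq_0: "(\<And>i. \<not> P i) \<Longrightarrow> cnt P = 0"
  by (simp add: cnt_def)

context
  fixes U :: "'a set" and j :: int and bs :: "'a list" and w :: 'a
  assumes UW: "U \<subseteq> W" and bs: "bs \<noteq> []"
    and e: "ear U j (bs @ [w])" and mx: "max_ear U (int (length bs) + 1)"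
begin

lemma ear_parts:
  "distinct bs" "w \<notin> set bs" "set bs \<subseteq> U" "w \<in> U" "good (f j # bs)" "adj (last bs) w"
  "\<not> tri (penult (f j # bs)) (last bs) w" "\<not> tri (f (j - 1)) (f j) (hd bs)" "good (f j # bs @ [w])"
  using e bs good_append[of "f j # bs" "[w]"] by (auto simp: ear_def)

lemma last_bs: "last bs \<in> U" "last bs \<in> set bs" using ear_parts bs by auto

lemma extend:
  assumes "z \<in> U" "adj w z" "z \<notin> set bs"
  shows "tri (last bs) w z"
proof (rule ccontr)
  assume n: "\<not> ?thesis"
  have zw: "z \<noteq> w" using assms adj_irrefl by auto
  have "good ((f j # bs @ [w]) @ [z])"
    using n assms ear_parts bs by (subst good_append) (auto simp: butlast_append)
  then have "ear U j (bs @ [w, z])"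
    using ear_parts assms zw bs by (auto simp: ear_def)
  then have "int (length (bs @ [w, z])) \<le> int (length bs) + 1" using mx unfolding max_ear_def by blast
  then show False by simp
qed

lemma closing_good:
  assumes "adj w z" "\<not> tri (last bs) w z"
  shows "good (f j # (bs @ [w]) @ [z])"
  using good_append[of "f j # bs @ [w]" "[z]"] ear_parts bs assms by (auto simp: butlast_append)

text \<open>Closing the ear at \<open>f (j + m)\<close> would trade \<open>m - 1\<close> cycle
  vertices for \<open>length bs + 1\<close> new ones. Only a forbidden turn at \<open>w\<close>
  prevents it.\<close>

lemma fwd_excluded:
  assumes "1 \<le> m" "m \<le> int (length bs) + 1" "m < c" "fwd w (j + m)"
  shows "tri (last bs) w (f (j + m))"
proof (rule ccontr)
  assume n: "\<not> ?thesis"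
  have "int (length (bs @ [w])) < j + m - j"
    by (rule ear_cycle) (use n assms closing_good ear_parts UW bs in \<open>auto simp: fwd_def\<close>)
  then show False using assms by simp
qed

text \<open>The base for the reversed orientation. It moves by at most one step, so the arcs
  excluded on the two sides stay disjoint in \<open>deg_long_cycle\<close>.\<close>

definition j' :: int where "j' = (if tri (f (j + 1)) (f j) (hd bs) then j + 1 else j)"

lemma j'_cases: "j' = j \<or> j' = j + 1" by (simp add: j'_def)

lemma base_rev: "good (f j' # bs)" "\<not> tri (f (j' + 1)) (f j') (hd bs)" "good (f j' # bs @ [w])"
proof -
  have main: "good (f j' # bs) \<and> \<not> tri (f (j' + 1)) (f j') (hd bs) \<and> good (f j' # bs @ [w])"
  proof (cases "tri (f (j + 1)) (f j) (hd bs)")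
    case False
    then show ?thesis using ear_parts by (simp add: j'_def)
  next
    case t: True
    then have j': "j' = j + 1" by (simp add: j'_def)
    have u: "z = f j" if "tri (f (j + 1)) (hd bs) z" for z
      using t that tri_unique[of "f (j + 1)" "hd bs"] tri_perms by blast
    have nW: "f j \<notin> U" using UW by (auto simp: W_def)
    have "\<not> tri (f (j + 1)) (hd bs) (second (bs @ [w]))"
    proof
      assume "tri (f (j + 1)) (hd bs) (second (bs @ [w]))"
      then have "second (bs @ [w]) = f j" by (rule u)
      moreover have "second (bs @ [w]) \<in> set (bs @ [w])" using bs by (cases bs; cases "tl bs") auto
      ultimately show False using ear_parts nW by auto
    qed
    moreover have "good (bs @ [w])" using ear_parts(9) bs by (auto simp: good_Cons)
    ultimately have g: "good (f (j + 1) # bs @ [w])" using tri_adj_all[OF t] bs by (auto simp: good_Cons)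
    then have "good (f (j + 1) # bs)" using good_append[of "f (j + 1) # bs" "[w]"] by auto
    moreover have "\<not> tri (f (j + 1 + 1)) (f (j + 1)) (hd bs)"
    proof
      assume "tri (f (j + 1 + 1)) (f (j + 1)) (hd bs)"
      then have "f (j + 1 + 1) = f j" using u tri_perms by blast
      then show False using f_ne_near(4)[of j] by (simp add: add.assoc)
    qed
    ultimately show ?thesis using g j' by simp
  qed
  then show "good (f j' # bs)" "\<not> tri (f (j' + 1)) (f j') (hd bs)" "good (f j' # bs @ [w])" by auto
qed

lemma bwd_excluded:
  assumes "1 \<le> m" "m \<le> int (length bs) + 1" "m < c" "bwd w (j' - m)"
  shows "tri (last bs) w (f (j' - m))"
proof (rule ccontr)
  assume n: "\<not> ?thesis"
  have "good ((f j' # bs @ [w]) @ [f (j' - m)])"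
    using n assms base_rev bs by (subst good_append) (auto simp: butlast_append bwd_def)
  then have "int (length (bs @ [w])) < j' - (j' - m)"
    by (intro ear_cycle_rev) (use n assms base_rev ear_parts UW bs in \<open>auto simp: bwd_def\<close>)
  then show False using assms by simp
qed

definition X :: "int \<Rightarrow> bool" where "X i \<longleftrightarrow> tri (last bs) w (f i)"

lemma own_not_X: assumes "own w i" shows "\<not> X i" "\<not> X (i + 1)"
proof -
  have "last bs \<notin> C" using last_bs UW by (auto simp: W_def)
  moreover have t: "tri w (f i) (f (i + 1))" using assms by (simp add: own_def)
  ultimately show "\<not> X i" "\<not> X (i + 1)"
    using tri_unique[of w "f i" "f (i + 1)" "last bs"] tri_unique[of w "f (i + 1)" "f i" "last bs"]
      tri_perms[OF t] tri_perms f_C unfolding X_def by metis+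
qed

lemma X_unique: "X i \<Longrightarrow> X i' \<Longrightarrow> f i = f i'"
  using tri_unique by (auto simp: X_def)

lemma periodic_X: "periodic X" by (auto simp: periodic_def X_def f_per)

lemma deg_parts:
  "deg (C \<union> U) w = deg U w + cnt (\<lambda>i. nbr w i \<and> \<not> X i) + cnt X"
proof -
  have "deg (C \<union> U) w = deg C w + deg U w"
    using deg_Un[of C U w] fin_C fin_W finite_subset[OF UW] UW by (auto simp: W_def)
  moreover have "cnt (nbr w) = cnt (\<lambda>i. (nbr w i \<and> \<not> X i) \<or> X i)"
    by (rule cnt_cong) (auto simp: X_def dest: tri_adj_all)
  moreover have "\<dots> = cnt (\<lambda>i. nbr w i \<and> \<not> X i) + cnt X" by (rule cnt_disj) auto
  ultimately show ?thesis by (simp add: deg_cnt)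
qed

text \<open>By \<open>extend\<close>, a neighbour of \<open>w\<close> in \<open>U\<close> lies on
  \<open>bs\<close> or is the third vertex of the triangle on the last ear edge. That vertex is
  unique, so it is either in \<open>U\<close> or on the cycle, where \<open>X\<close> records it,
  and contributes only once.\<close>

lemma deg_U_X: "deg U w + cnt X \<le> int (length bs) + 1"
  "\<not> adj w (hd bs) \<Longrightarrow> deg U w + cnt X \<le> int (length bs)"
  "\<not> (\<exists>x\<in>U - set bs. tri (last bs) w x) \<Longrightarrow> cnt X = 0 \<Longrightarrow> deg U w \<le> int (length bs)"
proof -
  let ?T = "{x \<in> U - set bs. tri (last bs) w x}"
  have fT: "finite U" using finite_subset[OF UW fin_W] .
  have T1: "card ?T \<le> 1"
  proof -
    have "x = x'" if "x \<in> ?T" "x' \<in> ?T" for x x' using tri_unique[of "last bs" w x x'] that by blast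
    moreover have "finite ?T" using fT by simp
    ultimately show ?thesis by (simp only: One_nat_def card_le_Suc0_iff_eq) blast
  qed
  have sub: "{u \<in> U. adj w u} \<subseteq> {u \<in> set bs. adj w u} \<union> ?T" using extend by auto
  have d: "deg U w \<le> int (card {u \<in> set bs. adj w u}) + int (card ?T)"
  proof -
    have "deg U w \<le> int (card ({u \<in> set bs. adj w u} \<union> ?T))"
      by (rule deg_insert_card[OF _ sub]) (use fT in auto)
    also have "\<dots> \<le> int (card {u \<in> set bs. adj w u} + card ?T)" by (rule of_nat_mono[OF card_Un_le])
    finally show ?thesis by simp
  qed
  have TX: "int (card ?T) + cnt X \<le> 1"
  proof (cases "?T = {}")
    case True
    then have "card ?T = 0" by (simp only: card.empty)
    moreover have "cnt X \<le> 1" by (rule cnt_le_1) (rule X_unique)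
    ultimately show ?thesis by linarith
  next
    case False
    then obtain x where x: "x \<in> U" "tri (last bs) w x" by blast
    have "\<not> X i" for i
    proof
      assume "X i"
      then have "x = f i" using tri_unique[OF x(2)] by (simp add: X_def)
      then show False using x(1) UW by (auto simp: W_def)
    qed
    then have "cnt X = 0" by (rule cnt_eq_0)
    then show ?thesis using T1 by linarith
  qed
  have b: "card {u \<in> set bs. adj w u} \<le> length bs"
    using card_mono[of "set bs" "{u \<in> set bs. adj w u}"] card_length[of bs] by auto
  show "deg U w + cnt X \<le> int (length bs) + 1" using d TX b by simp
  show "deg U w + cnt X \<le> int (length bs)" if "\<not> adj w (hd bs)"
  proof -
    have "{u \<in> set bs. adj w u} \<subseteq> set bs - {hd bs}" using that by auto
    then have "card {u \<in> set bs. adj w u} \<le> card (set bs - {hd bs})" by (intro card_mono) auto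
    also have "\<dots> < card (set bs)" using bs by (intro card_Diff1_less) auto
    finally have "card {u \<in> set bs. adj w u} < length bs" using card_length[of bs] by linarith
    then show ?thesis using d TX by linarith
  qed
  show "deg U w \<le> int (length bs)" if "\<not> (\<exists>x\<in>U - set bs. tri (last bs) w x)" "cnt X = 0"
  proof -
    have "?T = {}" using that by blast
    then have "card ?T = 0" by (simp only: card.empty)
    then show ?thesis using d b by linarith
  qed
qed

text \<open>An ear with \<open>l\<close> vertices keeps \<open>l - 1\<close> cycle edges on each
  side of its base free from entries of \<open>w\<close>. In the count behind
  \<open>both_own_bound\<close> these \<open>2 * l - 2\<close> edges pay, up to the constant 2, for
  the at most \<open>l\<close> neighbours not seen there.\<close>

lemma deg_long_cycle:
  assumes "c \<ge> 2 * (int (length bs) + 1)"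
  shows "2 * deg (C \<union> U) w \<le> c + 2 + 3 * nown w"
proof -
  define l where "l = int (length bs) + 1"
  have l2: "l \<ge> 2" using bs by (cases bs) (auto simp: l_def)
  have cl: "c \<ge> 2 * l" using assms by (simp add: l_def)
  define R where "R i \<longleftrightarrow> both w i \<and> \<not> X i" for i
  have wW: "w \<in> W" using ear_parts UW by auto
  have fx: "\<not> (fwd w (j + m) \<and> \<not> X (j + m))" if "1 \<le> m" "m \<le> l" for m
    using fwd_excluded[of m] that cl l2 by (auto simp: X_def l_def)
  have bx: "\<not> (bwd w (j' - m) \<and> \<not> X (j' - m))" if "1 \<le> m" "m \<le> l" for m
    using bwd_excluded[of m] that cl l2 by (auto simp: X_def l_def)
  have perR: "periodic R" using periodics(4)[of w] periodic_X by (auto simp: periodic_def R_def)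
  \<comment> \<open>The index \<open>i\<close> stands for the cycle edge from \<open>f i\<close> to
    \<open>f (i + 1)\<close>; it is in \<open>P\<close> if it meets an entry in \<open>R\<close> or
    is owned by \<open>w\<close>.\<close>
  define P where "P i \<longleftrightarrow> (R i \<or> R (i + 1)) \<or> own w i" for i
  have perP: "periodic P"
  proof -
    have "R (i + c + 1) = R (i + 1)" for i using perR unfolding periodic_def by (metis add.commute add.left_commute)
    then show ?thesis using perR periodics(1)[of w] by (auto simp: periodic_def P_def)
  qed
  have cP: "cnt P = 2 * cnt R + nown w"
  proof -
    have "cnt P = cnt (\<lambda>i. (R i \<or> R (i + 1)) \<or> own w i)" by (rule cnt_cong) (simp add: P_def)
    also have "\<dots> = cnt (\<lambda>i. R i \<or> R (i + 1)) + cnt (own w)"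
      using own_facts(7,8) by (intro cnt_disj) (auto simp: R_def)
    also have "cnt (\<lambda>i. R i \<or> R (i + 1)) = cnt R + cnt (\<lambda>i. R (i + 1))"
      using both_indep[OF wW] by (intro cnt_disj) (auto simp: R_def)
    also have "cnt (\<lambda>i. R (i + 1)) = cnt R" by (rule cnt_shift[OF perR])
    finally show ?thesis by (simp add: nown_def)
  qed
  have P1: "\<not> P (j + m)" if "1 \<le> m" "m < l" for m
  proof -
    have "\<not> R (j + m)" using fx[of m] that by (auto simp: R_def both_def)
    moreover have "\<not> R (j + m + 1)" using fx[of "m + 1"] that by (auto simp: R_def both_def add.assoc)
    moreover have "\<not> own w (j + m)"
      using fx[of "m + 1"] that own_facts(2)[of w "j + m"] own_not_X(2)[of "j + m"] by (auto simp: add.assoc)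
    ultimately show ?thesis by (simp add: P_def)
  qed
  have P2: "\<not> P (j' - m)" if "2 \<le> m" "m \<le> l" for m
  proof -
    have "\<not> R (j' - m)" using bx[of m] that by (auto simp: R_def both_def)
    moreover have "\<not> R (j' - m + 1)" using bx[of "m - 1"] that by (auto simp: R_def both_def algebra_simps)
    moreover have "\<not> own w (j' - m)"
      using bx[of m] that own_facts(1)[of w "j' - m"] own_not_X(1)[of "j' - m"] by auto
    ultimately show ?thesis by (simp add: P_def)
  qed
  let ?win = "{i. j' - l \<le> i \<and> i < j' - l + c \<and> P i}"
  let ?A = "{j + 1..j + l - 1}" and ?B = "{j' - l..j' - 2}"
  have fw: "finite ?win" by (rule finite_subset[of _ "{j' - l..j' - l + c}"]) auto
  have dA: "?win \<inter> ?A = {}" using P1[of "i - j" for i] by fastforce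
  have dB: "?win \<inter> ?B = {}" using P2[of "j' - i" for i] by fastforce
  have dAB: "?A \<inter> ?B = {}" using j'_cases by auto
  have "?win \<union> (?A \<union> ?B) \<subseteq> {j' - l..<j' - l + c}" using cl l2 j'_cases by auto
  then have "card (?win \<union> (?A \<union> ?B)) \<le> card {j' - l..<j' - l + c}" by (intro card_mono) auto
  moreover have "card (?win \<union> (?A \<union> ?B)) = card ?win + (card ?A + card ?B)"
    using fw dA dB dAB by (subst card_Un_disjoint) (auto simp: card_Un_disjoint)
  ultimately have "cnt P + (l - 1) + (l - 1) \<le> c"
    using cnt_window[OF perP, of "j' - l"] l2 c3 by auto
  then have RB: "2 * cnt R + nown w \<le> c - 2 * l + 2" using cP by simp
  have "cnt (\<lambda>i. nbr w i \<and> \<not> X i) \<le> cnt R + 2 * nown w"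
  proof -
    have "cnt (\<lambda>i. nbr w i \<and> \<not> X i) \<le> cnt (\<lambda>i. R i \<or> (own w i \<or> own w (i - 1)))"
      by (rule cnt_mono) (use nbr_cases in \<open>auto simp: R_def\<close>)
    also have "\<dots> = cnt R + cnt (\<lambda>i. own w i \<or> own w (i - 1))"
    proof (rule cnt_disj)
      fix i assume "R i"
      then show "\<not> (own w i \<or> own w (i - 1))"
        using own_facts(7)[of w i] own_facts(8)[of w "i - 1"] by (auto simp: R_def)
    qed
    also have "cnt (\<lambda>i. own w i \<or> own w (i - 1)) = cnt (own w) + cnt (\<lambda>i. own w (i - 1))"
      by (rule cnt_disj) (rule own_facts(10))
    also have "cnt (\<lambda>i. own w (i - 1)) = cnt (own w)" using cnt_shift[OF periodics(1), of w "-1"] by simp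
    finally show ?thesis by (simp add: nown_def)
  qed
  then show ?thesis using deg_parts deg_U_X(1) RB by (simp add: l_def)
qed

text \<open>On so short a cycle the ranges of \<open>fwd_excluded\<close> and
  \<open>bwd_excluded\<close> cover every position but the base. A neighbour blocked in the relevant
  direction is an end of an owned edge, whose other end is then excluded.\<close>

lemma short_cycle_nbr:
  assumes "c \<le> 2 * int (length bs) + 1" "int (length bs) + 1 < c" "nbr w i" "\<not> X i"
  shows "f i = f j"
proof -
  define l where "l = int (length bs) + 1"
  have l2: "l \<ge> 2" using bs by (cases bs) (auto simp: l_def)
  have cl: "c \<le> 2 * l - 1" "l < c" using assms by (auto simp: l_def)
  have fx: "\<not> (fwd w (j + m) \<and> \<not> X (j + m))" if "1 \<le> m" "m \<le> l" for m
    using fwd_excluded[of m] that cl l2 by (auto simp: X_def l_def)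
  have bx: "\<not> (bwd w (j' - m) \<and> \<not> X (j' - m))" if "1 \<le> m" "m \<le> l" for m
    using bwd_excluded[of m] that cl l2 by (auto simp: X_def l_def)
  obtain i0 where i0: "f i = f i0" "j \<le> i0" "i0 < j + c"
  proof -
    have "f i \<in> f ` {j..<j + c}" using C_eq[of j] f_C[of i] by simp
    then show ?thesis using that by auto
  qed
  define m where "m = i0 - j"
  have m: "0 \<le> m" "m < c" "f i = f (j + m)" using i0 by (auto simp: m_def)
  have nm: "nbr w (j + m)" "\<not> X (j + m)" using assms(3,4) m(3) by (auto simp: X_def)
  define s where "s = j' - j"
  have s: "s = 0 \<or> s = 1" using j'_cases by (auto simp: s_def)
  have bx': "\<not> (bwd w (j + n) \<and> \<not> X (j + n))" if "s - l \<le> n - c" "n - c \<le> s - 1" for n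
  proof -
    have "f (j' - (s + c - n)) = f (j + n)" "f (j' - (s + c - n) - 1) = f (j + n - 1)"
      by (simp_all add: f_eq s_def)
    then show ?thesis using bx[of "s + c - n"] that by (simp add: bwd_def X_def)
  qed
  show ?thesis
  proof (rule ccontr)
    assume "f i \<noteq> f j"
    then have m1: "m \<ge> 1" using m by (cases "m = 0") auto
    show False
    proof (cases "fwd w (j + m)")
      case True
      then have ml: "m > l" using fx[of m] nm m1 by force
      show False
      proof (cases "bwd w (j + m)")
        case True
        then show False using bx'[of m] nm ml cl s m by auto
      next
        case False
        then have o: "own w (j + m - 1)" using True nm by (auto simp: bwd_def own_def tri_ac)
        then have "bwd w (j + (m - 1))" "\<not> X (j + (m - 1))"
          using own_facts(1)[OF o] own_not_X(1)[OF o] by (auto simp: algebra_simps)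
        then show False using bx'[of "m - 1"] ml cl s m by auto
      qed
    next
      case False
      then have o: "own w (j + m)" using nm by (auto simp: fwd_def own_def)
      note oo = own_facts(1)[OF o] own_facts(2)[OF o] own_not_X[OF o]
      have "\<not> (s - l \<le> m - c)" using bx'[of m] oo s m by auto
      then have "m + 1 \<le> l" using cl s by auto
      then show False using fx[of "m + 1"] oo m1 by (auto simp: add.assoc)
    qed
  qed
qed

text \<open>If \<open>X\<close> held somewhere, \<open>bs\<close> without \<open>w\<close> would be
  an ear from \<open>f j\<close> to that vertex. Both arcs between its ends would have to be longer
  than \<open>length bs\<close>, which the cycle cannot accommodate. To leave \<open>f j\<close> in
  both directions one needs \<open>j' = j\<close>, and this follows because otherwise
  \<open>bwd_excluded\<close> applies at \<open>f j\<close> or at \<open>f (j - 1)\<close>.\<close>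

lemma short_cycle_X:
  assumes "c \<le> 2 * int (length bs) + 1" "int (length bs) + 1 < c" "X i" "nbr w j" "\<not> X j"
  shows False
proof -
  define l where "l = int (length bs) + 1"
  have l2: "l \<ge> 2" using bs by (cases bs) (auto simp: l_def)
  have cl: "c \<le> 2 * l - 1" "l < c" using assms by (auto simp: l_def)
  have bx: "\<not> (bwd w (j' - m) \<and> \<not> X (j' - m))" if "1 \<le> m" "m \<le> l" for m
    using bwd_excluded[of m] that cl l2 by (auto simp: X_def l_def)
  have j0: "j' = j"
  proof (rule ccontr)
    assume "j' \<noteq> j"
    then have j1: "j' = j + 1" using j'_cases by simp
    show False
    proof (cases "bwd w j")
      case True
      then show False using bx[of 1] l2 assms j1 by auto
    next
      case False
      then have o: "own w (j - 1)" using assms by (auto simp: bwd_def own_def tri_ac)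
      then show False using bx[of 2] l2 own_facts(1)[OF o] own_not_X(1)[OF o] j1 by auto
    qed
  qed
  have t: "tri (last bs) w (f i)" using assms by (simp add: X_def)
  have ad: "adj (last bs) (f i)" using tri_adj_all[OF t] by blast
  have third: "z = w" if "tri (last bs) (f i) z" for z
    using that t tri_unique[of "last bs" "f i"] tri_perms by blast
  have wC: "w \<notin> C" using ear_parts UW by (auto simp: W_def)
  have wf: "w \<noteq> f n" for n using wC f_C by metis
  have nt: "\<not> tri (last bs) (f i) (f n)" for n using third wf by metis
  have g: "good (f j # bs @ [f i])"
  proof -
    have "penult (f j # bs) \<in> set (f j # butlast bs)" using bs by (cases "butlast bs = []") auto
    then have "penult (f j # bs) \<in> insert (f j) (set bs)" using in_set_butlastD[of _ bs] by auto
    then have "penult (f j # bs) \<noteq> w" using ear_parts wf by auto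
    then have "\<not> tri (penult (f j # bs)) (last bs) (f i)" using third tri_perms by blast
    then show ?thesis using good_append[of "f j # bs" "[f i]"] ear_parts bs ad by auto
  qed
  obtain i0 where i0: "f i = f i0" "j \<le> i0" "i0 < j + c"
  proof -
    have "f i \<in> f ` {j..<j + c}" using C_eq[of j] f_C[of i] by simp
    then show ?thesis using that by auto
  qed
  have "i0 \<noteq> j" using assms(3,5) i0 by (auto simp: X_def)
  then have ij: "j < i0" using i0 by simp
  have bsW: "set bs \<subseteq> W" using ear_parts UW by auto
  have "int (length bs) < i0 - j"
    by (rule ear_cycle[OF bs ear_parts(1) bsW ij i0(3)]) (use g ear_parts nt i0 in auto)
  moreover have "int (length bs) < j - (i0 - c)"
  proof (rule ear_cycle_rev[OF bs ear_parts(1) bsW])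
    have "f (i0 - c) = f i" using i0 f_per by simp
    then show "good (f j # bs @ [f (i0 - c)])" "\<not> tri (last bs) (f (i0 - c)) (f (i0 - c - 1))"
      using g nt by auto
    show "\<not> tri (f (j + 1)) (f j) (hd bs)" using base_rev(2) j0 by simp
  qed (use ij i0 in auto)
  ultimately show False using cl by (simp add: l_def)
qed

text \<open>Apart from \<open>X\<close> the cycle contributes at most the neighbour
  \<open>f j\<close>, so the degree is at most \<open>length bs + 2\<close> and the assumption makes
  every estimate sharp.\<close>

lemma deg_short_cycle:
  assumes "c \<le> 2 * int (length bs) + 1" "int (length bs) + 1 < c" "deg (C \<union> U) w > int (length bs) + 1"
  shows "adj w (hd bs)" "adj w (f j)" "\<exists>x\<in>U - set bs. tri (last bs) w x"
proof -
  have c1: "cnt (\<lambda>i. nbr w i \<and> \<not> X i) \<le> 1"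
    by (rule cnt_le_1) (metis short_cycle_nbr[OF assms(1,2)])
  have s: "cnt (\<lambda>i. nbr w i \<and> \<not> X i) = 0" if "\<not> (nbr w j \<and> \<not> X j)"
    by (rule cnt_eq_0) (metis short_cycle_nbr[OF assms(1,2)] X_def that)
  show "adj w (hd bs)" using deg_parts deg_U_X(2) c1 assms(3) by force
  have nj: "nbr w j \<and> \<not> X j" using s deg_parts deg_U_X(1) assms(3) by force
  then show "adj w (f j)" ..
  have "cnt X = 0" by (rule cnt_eq_0) (use short_cycle_X[OF assms(1,2)] nj in blast)
  then show "\<exists>x\<in>U - set bs. tri (last bs) w x"
    using deg_parts deg_U_X(3) c1 assms(3) by linarith
qed

end

text \<open>The last vertex of a longest ear has few neighbours in \<open>U\<close>, and the ear
  itself keeps it away from part of the cycle. If the cycle is too short for this count and every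
  vertex of \<open>U\<close> had large degree, the sharp case of \<open>deg_short_cycle\<close>
  would let the ear be extended.\<close>

lemma peel_vertex:
  assumes U: "U \<subseteq> W" and att: "v \<in> U" "adj v (f i)" and q3: "k \<ge> c + 3"
  shows "\<exists>w\<in>U. 2 * deg (C \<union> U) w \<le> k - 1 + 3 * nown w"
proof -
  let ?L = "{length ws |ws. \<exists>j. ear U j ws}"
  have fin: "finite ?L"
  proof (rule finite_subset)
    show "?L \<subseteq> {..nat k}" using ear_length[OF _ U] c3 by fastforce
  qed simp
  have "good [f i, v]" using att by (simp add: adj_commute)
  then obtain j0 where "ear U j0 [v]" using ear_normalize[of "[v]" U i] att U by auto
  then have "Max ?L \<in> ?L" by (intro Max_in[OF fin]) blast
  then obtain ws j where ws: "ear U j ws" "length ws = Max ?L" by auto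
  have mx: "max_ear U (int (length ws))"
    unfolding max_ear_def using ws(2) fin by (auto intro!: Max_ge)
  define w where "w = last ws"
  define bs where "bs = butlast ws"
  have wsb: "ws = bs @ [w]" using ws(1) by (auto simp: ear_def w_def bs_def)
  have wU: "w \<in> U" using ws(1) wsb by (auto simp: ear_def)
  have wW: "w \<in> W" using wU U by auto
  have lk: "int (length bs) + 1 + c \<le> k" using ear_length[OF ws(1) U] wsb by simp
  have q: "c \<ge> 2 * (k - c) - 2" using c_long by simp
  show ?thesis
  proof (cases "bs = []")
    case True
    then have e1: "ear U j [w]" and m1: "max_ear U 1" using ws(1) mx wsb by auto
    have "deg U w \<le> 1"
    proof -
      have "tri (f j) w z" if "z \<in> U" "adj w z" for z
      proof (rule ccontr)
        assume n: "\<not> tri (f j) w z"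
        have "w \<noteq> z" using that adj_irrefl by auto
        then have "ear U j [w, z]" using e1 that n by (auto simp: ear_def)
        then have "int (length [w, z]) \<le> 1" using m1 unfolding max_ear_def by blast
        then show False by simp
      qed
      then have "z = z'" if "z \<in> {u \<in> U. adj w u}" "z' \<in> {u \<in> U. adj w u}" for z z'
        using tri_unique[of "f j" w z z'] that by blast
      moreover have "finite {u \<in> U. adj w u}" using finite_subset[OF U fin_W] by simp
      ultimately have "card {u \<in> U. adj w u} \<le> 1"
        by (simp only: One_nat_def card_le_Suc0_iff_eq) blast
      then show ?thesis by (simp add: deg_def)
    qed
    moreover have "deg (C \<union> U) w = deg C w + deg U w"
      using deg_Un[of C U w] fin_C finite_subset[OF U fin_W] U by (auto simp: W_def)
    ultimately have "2 * deg (C \<union> U) w \<le> k - 1 + 3 * nown w"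
      using deg_C[of w] both_own_bound[OF wW] q3 by simp
    then show ?thesis using wU by blast
  next
    case bs: False
    have e: "ear U j (bs @ [w])" and m: "max_ear U (int (length bs) + 1)" using ws(1) mx wsb by (auto simp: add.commute)
    note ctx = U bs e m
    show ?thesis
    proof (cases "c \<ge> 2 * (int (length bs) + 1)")
      case True
      from deg_long_cycle[OF ctx this] have "2 * deg (C \<union> U) w \<le> k - 1 + 3 * nown w" using q3 by linarith
      then show ?thesis using wU by blast
    next
      case False
      then have c1: "c \<le> 2 * int (length bs) + 1" by simp
      \<comment> \<open>The lower bound on \<open>c\<close> from the long cycle leaves only ears of
        the maximal possible length \<open>k - c\<close>.\<close>
      have qr: "k - c = int (length bs) + 1" using q lk c1 by presburger
      have c2: "int (length bs) + 1 < c" and le: "2 * (int (length bs) + 1) \<le> k - 1" and l3: "length bs \<ge> 2"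
        using q qr q3 by auto
      have nn: "nown v \<ge> 0" for v by (simp add: nown_def cnt_nonneg)
      show ?thesis
      proof (rule ccontr)
        assume no: "\<not> ?thesis"
        have big: "deg (C \<union> U) v > int (length bs) + 1" if "v \<in> U" for v
          using no that nn[of v] le by force
        note s = deg_short_cycle[OF ctx c1 c2 big[OF wU]]
        obtain x where x: "x \<in> U" "tri (last bs) w x" and xbs: "x \<notin> set bs" using s(3) by blast
        note ep = ear_parts[OF ctx]
        have third: "z = w" if "tri (last bs) x z" for z
          using that x tri_unique[of "last bs" x] tri_perms by blast
        have third': "z = last bs" if "tri w x z" for z
          using that x tri_unique[of w x] tri_perms by blast
        have lb: "last bs \<in> U" using last_bs[OF ctx] by simp
        have wf: "f n \<noteq> v" if "v \<in> U" for n v using that U f_C[of n] by (auto simp: W_def)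
        have pn: "penult (f j # bs) \<in> insert (f j) (set bs)"
          using bs in_set_butlastD[of _ bs] by (cases "butlast bs = []") auto
        have "\<not> tri (penult (f j # bs)) (last bs) x"
        proof
          assume "tri (penult (f j # bs)) (last bs) x"
          then have "penult (f j # bs) = w" using third tri_perms by blast
          then show False using pn ep(2) wf[OF ep(4)] by auto
        qed
        then have gx: "good (f j # bs @ [x])"
          using good_append[of "f j # bs" "[x]"] ep(5) bs tri_adj_all[OF x(2)] by auto
        \<comment> \<open>The vertices \<open>w\<close> and \<open>x\<close> complete the same
          triangle at the end of the ear, so they are interchangeable and both satisfy the sharp
          case.\<close>
        have ex: "ear U j (bs @ [x])" using gx ep x xbs bs by (auto simp: ear_def)
        note sx = deg_short_cycle[OF U bs ex m c1 c2 big[OF x(1)]]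
        obtain b1 b2 bs' where b: "bs = b1 # b2 # bs'" using l3 by (cases bs; cases "tl bs") auto
        have b1: "b1 \<noteq> last bs" using ep(1) b by auto
        have gb: "good bs" using ep(5) bs by (auto simp: good_Cons)
        have wx: "w \<noteq> x" "adj w x" using x tri_distinct tri_adj_all by blast+
        \<comment> \<open>The sequence \<open>u, v, b1, b2, ...\<close> started from
          \<open>f j\<close> would be a longer ear unless its turn at \<open>b1\<close> is
          forbidden. In both orders this makes \<open>w\<close> and \<open>x\<close> the third
          vertex of the edge from \<open>b1\<close> to \<open>b2\<close>.\<close>
        have tr: "tri v b1 b2" if uv: "u = w \<and> v = x \<or> u = x \<and> v = w" for u v
        proof (rule ccontr)
          assume n: "\<not> tri v b1 b2"
          have a: "adj v b1" "adj u (f j)" "adj u v" "u \<noteq> v" "u \<in> U" "v \<in> U" "u \<notin> set bs" "v \<notin> set bs"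
            using uv s sx b wx x ep xbs by (auto simp: adj_commute)
          have "z = last bs" if "tri u v z" for z using uv third' that tri_perms by blast
          then have "\<not> tri (f j) u v" "\<not> tri u v b1" using wf[OF lb] b1 tri_perms by blast+
          then have "good (f j # u # v # bs)" using a n gb b by (auto simp: adj_commute)
          then have "\<exists>j'. ear U j' (u # v # bs)"
            using a ep(1,3) U by (intro ear_normalize) auto
          then obtain j' where "ear U j' (u # v # bs)" by blast
          then have "int (length (u # v # bs)) \<le> int (length bs) + 1" using m unfolding max_ear_def by blast
          then show False by simp
        qed
        have "w = x" using tri_unique[of b1 b2 w x] tr[of x w] tr[of w x] tri_perms by blast
        then show False using wx by simp
      qed
    qed
  qed
qed

text \<open>Vertices are removed from \<open>U\<close> by \<open>peel_vertex\<close> as long as one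
  is attached to the cycle. What is left has no edge to the cycle and obeys the bound by
  minimality.\<close>

lemma peel_bound:
  assumes "U \<subseteq> W" and q3: "k \<ge> c + 3"
  shows "degsum (C \<union> U) \<le> c * (c - 1) + (\<Sum>w\<in>U. k - 1 + 3 * nown w)"
  using assms(1)
proof (induction "card U" arbitrary: U rule: less_induct)
  case less
  have finU: "finite U" using finite_subset[OF less.prems fin_W] .
  have dC: "degsum C \<le> c * (c - 1)" using degsum_le[OF fin_C] card_C by simp
  have nn: "nown v \<ge> 0" for v by (simp add: nown_def cnt_nonneg)
  show ?case
  proof (cases "\<exists>v\<in>U. \<exists>i. adj v (f i)")
    case True
    then obtain v i where "v \<in> U" "adj v (f i)" by blast
    from peel_vertex[OF less.prems this q3] obtain w where
      w: "w \<in> U" "2 * deg (C \<union> U) w \<le> k - 1 + 3 * nown w" by blast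
    let ?U = "U - {w}"
    have IH: "degsum (C \<union> ?U) \<le> c * (c - 1) + (\<Sum>w\<in>?U. k - 1 + 3 * nown w)"
      by (rule less.hyps[OF card_Diff1_less[OF finU w(1)]]) (use less.prems in auto)
    have wC: "w \<notin> C" using w less.prems by (auto simp: W_def)
    have e: "C \<union> U = {w} \<union> (C \<union> ?U)" using w by auto
    have d0: "deg {w} w = 0" using adj_irrefl by (intro deg_eq_0) auto
    have "deg (C \<union> U) w = deg (C \<union> ?U) w"
      unfolding e using deg_Un[of "{w}" "C \<union> ?U" w] finU fin_C wC d0 by auto
    moreover have "degsum (C \<union> U) = degsum (C \<union> ?U) + 2 * deg (C \<union> ?U) w"
      unfolding e using degsum_Un[of "{w}" "C \<union> ?U"] finU fin_C wC d0 by auto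
    moreover have "(\<Sum>w\<in>U. k - 1 + 3 * nown w) = (k - 1 + 3 * nown w) + (\<Sum>w\<in>?U. k - 1 + 3 * nown w)"
      using finU w(1) by (rule sum.remove)
    ultimately show ?thesis using IH w(2) by linarith
  next
    case False
    then have "deg C u = 0" if "u \<in> U" for u
      using that by (intro deg_eq_0) (auto simp: C_def)
    then have "degsum (C \<union> U) = degsum C + degsum U"
      using degsum_Un[of U C] finU fin_C less.prems by (auto simp: W_def Un_commute degsum_def)
    moreover have "U \<subset> V" using less.prems f_in[of 0] f_C[of 0] by (auto simp: W_def)
    then have "degsum U \<le> (k - 1) * int (card U)" by (rule minimal)
    moreover have "(k - 1) * int (card U) \<le> (\<Sum>w\<in>U. k - 1 + 3 * nown w)"
      using sum_mono[of U "\<lambda>_. k - 1" "\<lambda>w. k - 1 + 3 * nown w"] nn by (simp add: mult.commute)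
    ultimately show ?thesis using dC by linarith
  qed
qed

lemma codim_le_2: "k \<le> c + 2"
proof (rule ccontr)
  assume "\<not> ?thesis"
  then have q3: "k \<ge> c + 3" by simp
  have "degsum (C \<union> W) \<le> c * (c - 1) + (\<Sum>w\<in>W. k - 1 + 3 * nown w)"
    by (rule peel_bound[OF order_refl q3])
  also have "(\<Sum>w\<in>W. k - 1 + 3 * nown w) = (k - 1) * int (card W) + 3 * (\<Sum>w\<in>W. nown w)"
    by (simp add: sum.distrib sum_distrib_left)
  also have "(\<Sum>w\<in>W. nown w) \<le> c" using sum_nown[of W] cnt_le_c by simp
  finally have "degsum (C \<union> W) \<le> c * (c - 1) + (k - 1) * int (card W) + 3 * c" by simp
  moreover have "C \<union> W = V" using C_sub by (auto simp: W_def)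
  ultimately have "(k - 1) * int (card V) < c * (c - 1) + (k - 1) * int (card W) + 3 * c"
    using counterexample by simp
  then have "(k - 1) * c < c * (c - 1) + 3 * c" using card_W by (simp add: algebra_simps)
  then have "c * (k - 1) < c * (c + 2)" by (simp add: algebra_simps)
  then show False using q3 c3 by (simp add: mult_less_cancel_left)
qed

end

section \<open>Nonadjacent successors\<close>

context longest_cycle
begin

text \<open>Ordered pairs are counted, in line with degree sums, where every edge counts
  twice.\<close>

definition nonadj :: int where
  "nonadj = int (card {(i, j). 0 \<le> i \<and> i < c \<and> 0 \<le> j \<and> j < c \<and> i \<noteq> j \<and> \<not> adj (f i) (f j)})"

lemma degsum_C: "degsum C = c * (c - 1) - nonadj"
proof -
  let ?I = "{0..<c}"
  let ?A = "{(i, j). 0 \<le> i \<and> i < c \<and> 0 \<le> j \<and> j < c \<and> adj (f i) (f j)}"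
  let ?E = "{(i, j). 0 \<le> i \<and> i < c \<and> i = j}"
  let ?N = "{(i, j). 0 \<le> i \<and> i < c \<and> 0 \<le> j \<and> j < c \<and> i \<noteq> j \<and> \<not> adj (f i) (f j)}"
  have fin: "finite ?A" "finite ?E" "finite ?N"
    by (rule finite_subset[of _ "?I \<times> ?I"], auto)+
  have e: "?I \<times> ?I = ?A \<union> (?E \<union> ?N)" by auto
  have "card (?I \<times> ?I) = card ?A + card (?E \<union> ?N)"
    unfolding e by (rule card_Un_disjoint) (use fin adj_irrefl in auto)
  moreover have "card (?E \<union> ?N) = card ?E + card ?N"
    by (rule card_Un_disjoint) (use fin in auto)
  moreover have "card (?I \<times> ?I) = card ?I * card ?I" by (rule card_cartesian_product)
  moreover have "card ?E = card ?I"
  proof -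
    have "?E = (\<lambda>i. (i, i)) ` ?I" by auto
    then show ?thesis by (simp add: card_image inj_on_def)
  qed
  moreover have "int (card ?A) = degsum C"
  proof -
    have "?A = (SIGMA i:?I. {j. 0 \<le> j \<and> j < c \<and> adj (f i) (f j)})" by auto
    then have "int (card ?A) = (\<Sum>i\<in>?I. cnt (nbr (f i)))"
      using cnt_finite by (simp add: cnt_def)
    also have "\<dots> = (\<Sum>v\<in>f ` ?I. deg C v)"
      using f_inj[of 0] by (subst sum.reindex) (auto simp: deg_cnt)
    also have "f ` ?I = C" using C_eq[of 0] by simp
    finally show ?thesis by (simp add: degsum_def)
  qed
  ultimately have "card ?I * card ?I = card ?A + (card ?I + card ?N)" "int (card ?A) = degsum C" by linarith+
  then have "int (card ?I * card ?I) = int (card ?A + (card ?I + card ?N))" "int (card ?A) = degsum C"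
    by (simp_all only:)
  then have "int (card ?I) * int (card ?I) = degsum C + (int (card ?I) + nonadj)"
    unfolding nonadj_def by (simp only: of_nat_add of_nat_mult)
  moreover have "int (card ?I) = c" using c3 by simp
  ultimately have "c * c = degsum C + (c + nonadj)" by (simp only:)
  then show ?thesis by (simp add: algebra_simps)
qed

lemma card_functional:
  assumes "finite G" "\<And>i j j'. (i, j) \<in> G \<Longrightarrow> (i, j') \<in> G \<Longrightarrow> j = j'"
    and "\<And>i j. (i, j) \<in> G \<Longrightarrow> 0 \<le> i \<and> i < c \<and> P i"
  shows "int (card G) \<le> cnt P"
proof -
  have "inj_on fst G" using assms(2) by (auto simp: inj_on_def)
  then have "card G = card (fst ` G)" by (simp add: card_image)
  also have "\<dots> \<le> card {i. 0 \<le> i \<and> i < c \<and> P i}"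
    using assms(3) cnt_finite[of P] by (intro card_mono) auto
  finally show ?thesis by (simp add: cnt_def)
qed

lemma card_functional':
  assumes "finite G" "\<And>i j j'. (j, i) \<in> G \<Longrightarrow> (j', i) \<in> G \<Longrightarrow> j = j'"
    and "\<And>i j. (j, i) \<in> G \<Longrightarrow> 0 \<le> i \<and> i < c \<and> P i"
  shows "int (card G) \<le> cnt P"
proof -
  have "card (prod.swap ` G) = card G" by (simp add: card_image)
  moreover have "int (card (prod.swap ` G)) \<le> cnt P"
    by (rule card_functional) (use assms in auto)
  ultimately show ?thesis by simp
qed

definition third_in_C :: "int \<Rightarrow> bool" where
  "third_in_C i \<longleftrightarrow> (\<exists>m. tri (f i) (f (i + 1)) (f m))"

text \<open>A cycle edge has only one third vertex, on the cycle or outside. Thus chords blocked by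
  triangles on the cycle cost owned edges.\<close>

lemma third_in_C_bound: "cnt third_in_C + cnt (\<lambda>i. \<exists>w\<in>W. own w i) \<le> c"
proof -
  have "cnt (\<lambda>i. third_in_C i \<or> (\<exists>w\<in>W. own w i)) = cnt third_in_C + cnt (\<lambda>i. \<exists>w\<in>W. own w i)"
  proof (rule cnt_disj)
    fix i assume "third_in_C i"
    then obtain m where m: "tri (f i) (f (i + 1)) (f m)" by (auto simp: third_in_C_def)
    show "\<not> (\<exists>w\<in>W. own w i)"
    proof
      assume "\<exists>w\<in>W. own w i"
      then obtain w where w: "w \<in> W" "tri w (f i) (f (i + 1))" by (auto simp: own_def)
      have "f m = w" using tri_unique[OF m tri_perms(4)[OF w(2)]] .
      then show False using w(1) by (auto simp: W_def)
    qed
  qed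
  then show ?thesis using cnt_le_c[of "\<lambda>i. third_in_C i \<or> (\<exists>w\<in>W. own w i)"] by simp
qed

lemma f_window_eq: "0 \<le> i \<Longrightarrow> i < c \<Longrightarrow> 0 \<le> j \<Longrightarrow> j < c \<Longrightarrow> f i = f j \<longleftrightarrow> i = j"
  using inj_onD[OF f_inj[of 0]] by auto

text \<open>The successors of two entries in \<open>D\<close> are nonadjacent, with these
  exceptions: one entry is the successor of the other, or the chord makes a forbidden turn with the
  cycle edge following one of its ends. Each such edge has one third vertex, so turns cost
  \<open>third_in_C\<close> twice. All other exceptions are gathered in \<open>E\<close>, a partial
  function of its first argument with domain inside \<open>H\<close>. The parameters are free
  because \<open>D\<close> is used both for all outside vertices together and for a single
  one.\<close>

lemma nonadj_bound:
  assumes per: "periodic D"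
    and adj: "\<And>i j. D i \<Longrightarrow> D j \<Longrightarrow> f i \<noteq> f j \<Longrightarrow> adj (f (i + 1)) (f (j + 1)) \<Longrightarrow> f j \<noteq> f (i + 1) \<Longrightarrow> f i \<noteq> f (j + 1)
      \<Longrightarrow> \<not> tri (f (i + 1)) (f (i + 2)) (f (j + 1)) \<Longrightarrow> \<not> tri (f (j + 1)) (f (j + 2)) (f (i + 1)) \<Longrightarrow> E i j"
    and E: "\<And>i j j'. E i j \<Longrightarrow> E i j' \<Longrightarrow> f j = f j'" "\<And>i j. E i j \<Longrightarrow> H i"
  shows "cnt D * (cnt D - 1) \<le> nonadj + 2 * cnt (\<lambda>i. D i \<and> D (i + 1)) + 2 * cnt third_in_C + cnt H"
proof -
  let ?I = "{i. 0 \<le> i \<and> i < c \<and> D i}"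
  let ?P = "{(i, j). i \<in> ?I \<and> j \<in> ?I \<and> i \<noteq> j}"
  define K1 where "K1 = {(i, j). i \<in> ?I \<and> j \<in> ?I \<and> f j = f (i + 1)}"
  define K2 where "K2 = {(i, j). i \<in> ?I \<and> j \<in> ?I \<and> f i = f (j + 1)}"
  define T1 where "T1 = {(i, j). i \<in> ?I \<and> j \<in> ?I \<and> tri (f (i + 1)) (f (i + 2)) (f (j + 1))}"
  define T2 where "T2 = {(i, j). i \<in> ?I \<and> j \<in> ?I \<and> tri (f (j + 1)) (f (j + 2)) (f (i + 1))}"
  define EE where "EE = {(i, j). i \<in> ?I \<and> j \<in> ?I \<and> E i j}"
  define NA where "NA = {(i, j). i \<in> ?I \<and> j \<in> ?I \<and> i \<noteq> j \<and> \<not> adj (f (i + 1)) (f (j + 1))}"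
  have fin: "finite ?P" "finite K1" "finite K2" "finite T1" "finite T2" "finite EE" "finite NA"
  proof -
    have "finite (?I \<times> ?I)" using cnt_finite by (intro finite_cartesian_product)
    note F = finite_subset[OF _ this]
    show "finite ?P" by (rule F) auto
    show "finite K1" by (rule F) (auto simp: K1_def)
    show "finite K2" by (rule F) (auto simp: K2_def)
    show "finite T1" by (rule F) (auto simp: T1_def)
    show "finite T2" by (rule F) (auto simp: T2_def)
    show "finite EE" by (rule F) (auto simp: EE_def)
    show "finite NA" by (rule F) (auto simp: NA_def)
  qed
  have sub: "?P \<subseteq> NA \<union> (K1 \<union> (K2 \<union> (T1 \<union> (T2 \<union> EE))))"
  proof
    fix x assume "x \<in> ?P"
    obtain i j where x: "x = (i, j)" by (cases x)
    have ij: "0 \<le> i" "i < c" "D i" "0 \<le> j" "j < c" "D j" "i \<noteq> j"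
      using \<open>x \<in> ?P\<close> by (simp_all add: x)
    have ne: "f i \<noteq> f j" using f_window_eq[OF ij(1,2,4,5)] ij(7) by blast
    show "x \<in> NA \<union> (K1 \<union> (K2 \<union> (T1 \<union> (T2 \<union> EE))))"
    proof (rule ccontr)
      assume "\<not> ?thesis"
      then have n: "x \<notin> NA" "x \<notin> K1" "x \<notin> K2" "x \<notin> T1" "x \<notin> T2" "x \<notin> EE" by blast+
      have "adj (f (i + 1)) (f (j + 1))" using n(1) ij by (simp add: x NA_def)
      moreover have "f j \<noteq> f (i + 1)" using n(2) ij by (simp add: x K1_def)
      moreover have "f i \<noteq> f (j + 1)" using n(3) ij by (simp add: x K2_def)
      moreover have "\<not> tri (f (i + 1)) (f (i + 2)) (f (j + 1))" using n(4) ij by (simp add: x T1_def)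
      moreover have "\<not> tri (f (j + 1)) (f (j + 2)) (f (i + 1))" using n(5) ij by (simp add: x T2_def)
      ultimately have "E i j" using adj[OF ij(3,6) ne] by blast
      then show False using n(6) ij by (simp add: x EE_def)
    qed
  qed
  have "card ?P \<le> card (NA \<union> (K1 \<union> (K2 \<union> (T1 \<union> (T2 \<union> EE)))))"
    by (rule card_mono) (use fin sub in auto)
  also have "\<dots> \<le> card NA + (card K1 + (card K2 + (card T1 + (card T2 + card EE))))"
    using card_Un_le[of NA "K1 \<union> (K2 \<union> (T1 \<union> (T2 \<union> EE)))"] card_Un_le[of K1 "K2 \<union> (T1 \<union> (T2 \<union> EE))"]
      card_Un_le[of K2 "T1 \<union> (T2 \<union> EE)"] card_Un_le[of T1 "T2 \<union> EE"] card_Un_le[of T2 EE] by linarith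
  finally have 1: "int (card ?P) \<le> int (card NA) + int (card K1) + int (card K2) + int (card T1) + int (card T2) + int (card EE)"
    by simp
  have 2: "int (card ?P) = cnt D * (cnt D - 1)"
  proof -
    have e: "?I \<times> ?I = ?P \<union> (\<lambda>i. (i, i)) ` ?I" by auto
    have fi: "finite ((\<lambda>i. (i, i)) ` ?I)" using cnt_finite by (rule finite_imageI)
    have "?P \<inter> (\<lambda>i. (i, i)) ` ?I = {}" by auto
    from card_Un_disjoint[OF fin(1) fi this]
    have "card (?I \<times> ?I) = card ?P + card ((\<lambda>i. (i, i)) ` ?I)" by (simp only: e)
    moreover have "card ((\<lambda>i. (i, i)) ` ?I) = card ?I" by (simp add: card_image inj_on_def)
    ultimately have "card ?I * card ?I = card ?P + card ?I" using card_cartesian_product[of ?I ?I] by linarith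
    then have "int (card ?I * card ?I) = int (card ?P + card ?I)" by (simp only:)
    then have "cnt D * cnt D = int (card ?P) + cnt D" unfolding cnt_def by (simp only: of_nat_add of_nat_mult)
    then show ?thesis by (simp add: algebra_simps)
  qed
  have DD: "D (i + 1)" if "D j" "f j = f (i + 1)" for i j
  proof -
    have "j mod c = (i + 1) mod c" using that(2) by (simp add: f_eq mod_eq_dvd_iff)
    then show ?thesis using periodic_mod[OF per, of j] periodic_mod[OF per, of "i + 1"] that(1) by simp
  qed
  have 3: "int (card K1) \<le> cnt (\<lambda>i. D i \<and> D (i + 1))"
  proof (rule card_functional)
    fix i j j' assume "(i, j) \<in> K1" "(i, j') \<in> K1"
    then show "j = j'" using f_window_eq[of j j'] by (simp add: K1_def)
  next
    fix i j assume "(i, j) \<in> K1"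
    then show "0 \<le> i \<and> i < c \<and> D i \<and> D (i + 1)" using DD[of j i] by (simp add: K1_def)
  qed (rule fin)
  have 4: "int (card K2) \<le> cnt (\<lambda>i. D i \<and> D (i + 1))"
  proof (rule card_functional')
    fix i j j' assume "(j, i) \<in> K2" "(j', i) \<in> K2"
    then show "j = j'" using f_window_eq[of j j'] by (simp add: K2_def)
  next
    fix i j assume "(j, i) \<in> K2"
    then show "0 \<le> i \<and> i < c \<and> D i \<and> D (i + 1)" using DD[of j i] by (simp add: K2_def)
  qed (rule fin)
  have inj1: "f (i + 1) = f (j + 1) \<longleftrightarrow> f i = f j" for i j by (simp add: f_eq)
  have tshift: "cnt (\<lambda>i. third_in_C (i + 1)) = cnt third_in_C"
    by (rule cnt_shift) (auto simp: periodic_def third_in_C_def f_per f_per1)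
  have 5: "int (card T1) \<le> cnt (\<lambda>i. third_in_C (i + 1))"
  proof (rule card_functional)
    fix i j j' assume "(i, j) \<in> T1" "(i, j') \<in> T1"
    then show "j = j'" using tri_unique[of "f (i + 1)" "f (i + 2)"] inj1[of j j'] f_window_eq[of j j']
      by (auto simp: T1_def)
  next
    fix i j assume "(i, j) \<in> T1"
    then show "0 \<le> i \<and> i < c \<and> third_in_C (i + 1)" by (auto simp: T1_def third_in_C_def add.assoc)
  qed (rule fin)
  have 6: "int (card T2) \<le> cnt (\<lambda>i. third_in_C (i + 1))"
  proof (rule card_functional')
    fix i j j' assume "(j, i) \<in> T2" "(j', i) \<in> T2"
    then show "j = j'" using tri_unique[of "f (i + 1)" "f (i + 2)"] inj1[of j j'] f_window_eq[of j j']
      by (auto simp: T2_def)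
  next
    fix i j assume "(j, i) \<in> T2"
    then show "0 \<le> i \<and> i < c \<and> third_in_C (i + 1)" by (auto simp: T2_def third_in_C_def add.assoc)
  qed (rule fin)
  have 7: "int (card EE) \<le> cnt H"
  proof (rule card_functional)
    fix i j j' assume "(i, j) \<in> EE" "(i, j') \<in> EE"
    then show "j = j'" using E(1)[of i j j'] f_window_eq[of j j'] by (auto simp: EE_def)
  next
    fix i j assume "(i, j) \<in> EE"
    then show "0 \<le> i \<and> i < c \<and> H i" using E(2)[of i j] by (simp add: EE_def)
  qed (rule fin)
  have 8: "int (card NA) \<le> nonadj"
  proof -
    let ?g = "\<lambda>(i, j). ((i + 1) mod c, (j + 1) mod c)"
    let ?N = "{(i, j). 0 \<le> i \<and> i < c \<and> 0 \<le> j \<and> j < c \<and> i \<noteq> j \<and> \<not> adj (f i) (f j)}"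
    have fm: "f (i mod c) = f i" for i unfolding f_eq by (subst dvd_diff_commute) (rule dvd_minus_mod)
    have inj: "i = i'" if "(i + 1) mod c = (i' + 1) mod c" "0 \<le> i" "i < c" "0 \<le> i'" "i' < c" for i i'
    proof -
      have "f i = f i'" using fm[of "i + 1"] fm[of "i' + 1"] that(1) inj1[of i i'] by simp
      then show ?thesis using f_window_eq that by simp
    qed
    have "inj_on ?g NA"
    proof (rule inj_onI)
      fix x y assume xy: "x \<in> NA" "y \<in> NA" "?g x = ?g y"
      obtain i j i' j' where e: "x = (i, j)" "y = (i', j')" by (cases x, cases y)
      then show "x = y" using inj[of i i'] inj[of j j'] xy by (simp add: NA_def)
    qed
    then have "card NA = card (?g ` NA)" by (simp add: card_image)
    also have "\<dots> \<le> card ?N"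
    proof (rule card_mono)
      show "finite ?N" by (rule finite_subset[of _ "{0..<c} \<times> {0..<c}"]) auto
      show "?g ` NA \<subseteq> ?N"
      proof
        fix y assume "y \<in> ?g ` NA"
        then obtain x where "x \<in> NA" "y = ?g x" by (rule imageE)
        moreover obtain i j where e: "x = (i, j)" by (cases x)
        ultimately show "y \<in> ?N" using inj[of i j] c3 by (auto simp: NA_def fm)
      qed
    qed
    finally show ?thesis by (simp add: nonadj_def)
  qed
  show ?thesis using 1 2 3 4 5 6 7 8 tshift by linarith
qed

text \<open>The path is \<open>f i, f (i - 1), ..., f (j + 1), f (i + 1), ..., f j\<close>, crossing
  over by the chord. At both ends it runs into the cycle backwards, so \<open>bwd\<close> is exactly
  what is needed to extend it there.\<close>

lemma chord_path:
  assumes "f i \<noteq> f j" "adj (f (i + 1)) (f (j + 1))" "f j \<noteq> f (i + 1)" "f i \<noteq> f (j + 1)"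
    "\<not> tri (f (i + 1)) (f (i + 2)) (f (j + 1))" "\<not> tri (f (j + 1)) (f (j + 2)) (f (i + 1))"
  obtains L where "good L" "distinct L" "set L \<subseteq> C" "int (length L) = c" "hd L = f i" "second L = f (i - 1)"
    "last L = f j" "penult L = f (j - 1)" "L \<noteq> []" "tl L \<noteq> []" "butlast L \<noteq> []"
proof -
  obtain d where d: "f j = f (i + d)" "0 \<le> d" "d < c"
  proof -
    have "f j \<in> f ` {i..<i + c}" using C_eq[of i] f_C[of j] by simp
    then show ?thesis using that[of "m - i" for m] by auto
  qed
  have j1: "f (j + n) = f (i + d + n)" for n using d(1) by (simp add: f_eq algebra_simps)
  have "d \<noteq> 0" "d \<noteq> 1" using assms d by auto
  moreover have "d \<noteq> c - 1"
  proof
    assume "d = c - 1"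
    then have "f (j + 1) = f i" using j1[of 1] f_per by simp
    then show False using assms by simp
  qed
  ultimately have dd: "2 \<le> d" "d \<le> c - 2" using d by auto
  let ?a = "map f [i + d + 1..i + c]" and ?b = "map f [i + 1..i + d]"
  have le: "i + d + 1 \<le> i + c" "i + d + 2 \<le> i + c" "i + 1 \<le> i + d" "i + 2 \<le> i + d" using dd by auto
  define L where "L = rev ?a @ ?b"
  have ne: "?a \<noteq> []" "?b \<noteq> []" using le by auto
  have "adj (f (i + 1)) (f (i + d + 1))" "\<not> tri (f (i + 1)) (f (i + 2)) (f (i + d + 1))"
    "\<not> tri (f (i + d + 1)) (f (i + d + 2)) (f (i + 1))"
    using assms(2,5,6) j1 by auto
  then have "good L" unfolding L_def using ne arc(1) le
    by (subst good_append) (auto simp: good_rev map_upto_ends rev_ends adj_commute tri_ac add.assoc)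
  moreover have "distinct L"
  proof -
    have "distinct (map f [i + 1..i + c])" by (rule arc(2)) simp
    moreover have "[i + 1..i + c] = [i + 1..i + d] @ [i + d + 1..i + c]"
      using upto_split2[of "i + 1" "i + d" "i + c"] dd by simp
    ultimately show ?thesis unfolding L_def by auto
  qed
  moreover have "set L \<subseteq> C" by (auto simp: L_def)
  moreover have "int (length L) = c" using dd by (simp add: L_def)
  moreover have "hd L = f i" using ne le by (simp add: L_def rev_ends map_upto_ends f_per)
  moreover have "second L = f (i - 1)"
  proof -
    have "tl (rev ?a) \<noteq> []" using le by (simp add: rev_ends map_upto_ends)
    then have "second L = hd (tl (rev ?a))" using ne by (simp add: L_def)
    also have "\<dots> = f (i + c - 1)" using le by (simp add: rev_ends map_upto_ends)
    finally show ?thesis by (simp add: f_per1)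
  qed
  moreover have "last L = f j" using ne le d by (simp add: L_def map_upto_ends)
  moreover have "penult L = f (j - 1)"
    using ne le j1[of "-1"] by (simp add: L_def butlast_append map_upto_ends)
  moreover have "L \<noteq> []" "tl L \<noteq> []" "butlast L \<noteq> []"
    using \<open>int (length L) = c\<close> c3 by (cases L; cases "tl L"; auto)+
  ultimately show ?thesis using that by blast
qed

text \<open>Joining both ends of \<open>chord_path\<close> to \<open>w\<close> gives a cycle with
  \<open>c + 1\<close> vertices unless the turn at \<open>w\<close> is forbidden.\<close>

lemma chord_cycle:
  assumes "f i \<noteq> f j" "adj (f (i + 1)) (f (j + 1))" "f j \<noteq> f (i + 1)" "f i \<noteq> f (j + 1)"
    "\<not> tri (f (i + 1)) (f (i + 2)) (f (j + 1))" "\<not> tri (f (j + 1)) (f (j + 2)) (f (i + 1))"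
    and w: "w \<in> W" "bwd w i" "bwd w j"
  shows "tri w (f i) (f j)"
proof (rule ccontr)
  assume n: "\<not> ?thesis"
  obtain L where L: "good L" "distinct L" "set L \<subseteq> C" "int (length L) = c" "hd L = f i" "second L = f (i - 1)"
    "last L = f j" "penult L = f (j - 1)" "L \<noteq> []" "tl L \<noteq> []" "butlast L \<noteq> []"
    using chord_path[OF assms(1-6)] by blast
  have "is_cycle V (w # L)"
    unfolding is_cycle_def
  proof (intro conjI)
    show "good (w # L)" using L w by (auto simp: good_Cons bwd_def)
    show "3 \<le> length (w # L)" using L(4) c3 by simp
    show "\<not> tri (penult (w # L)) (last (w # L)) (hd (w # L))"
      using L w by (auto simp: bwd_def tri_ac)
    show "\<not> tri (last (w # L)) (hd (w # L)) (second (w # L))" using L n by (auto simp: tri_ac)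
  qed (use L w C_sub in \<open>auto simp: W_def bwd_def adj_commute\<close>)
  from max_cycle[OF this] show False using L(4) by simp
qed

lemma chord_ends:
  assumes "f i \<noteq> f j" "adj (f (i + 1)) (f (j + 1))" "f j \<noteq> f (i + 1)" "f i \<noteq> f (j + 1)"
    "\<not> tri (f (i + 1)) (f (i + 2)) (f (j + 1))" "\<not> tri (f (j + 1)) (f (j + 2)) (f (i + 1))"
    and w: "w \<in> W" "bwd w i" "w' \<in> W" "bwd w' j" "w \<noteq> w'"
  shows "c + 2 \<le> k"
proof -
  obtain L where L: "good L" "distinct L" "set L \<subseteq> C" "int (length L) = c" "hd L = f i" "second L = f (i - 1)"
    "last L = f j" "penult L = f (j - 1)" "L \<noteq> []" "tl L \<noteq> []" "butlast L \<noteq> []"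
    using chord_path[OF assms(1-6)] by blast
  have "good (w # L)" using L w by (auto simp: good_Cons bwd_def)
  then have "good ((w # L) @ [w'])"
    using L w by (subst good_append) (auto simp: bwd_def adj_commute tri_ac)
  then have "is_path V ((w # L) @ [w'])"
    using L w C_sub by (auto simp: is_path_def W_def)
  from nopath[OF this] show ?thesis using L(4) by simp
qed

text \<open>The cycle opened between \<open>f i\<close> and \<open>f (i + 1)\<close> is extended by
  a vertex at each end.\<close>

lemma arc_ends:
  assumes w: "w \<in> W" "bwd w i" "w' \<in> W" "fwd w' (i + 1)" "w \<noteq> w'"
  shows "c + 2 \<le> k"
proof -
  let ?a = "map f [i + 1..i + c]"
  have le: "i + 1 \<le> i + c" "i + 2 \<le> i + c" "i + 1 \<le> i + c - 1" using c3 by auto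
  have ne: "?a \<noteq> []" using le by simp
  have a: "hd ?a = f (i + 1)" "second ?a = f (i + 2)" "last ?a = f i" "penult ?a = f (i - 1)" "tl ?a \<noteq> []" "butlast ?a \<noteq> []"
    using le by (auto simp: map_upto_ends f_per f_per1 add.assoc)
  have "good (w # rev ?a)" using w a ne arc(1)[of "i + 1" "i + c"]
    by (auto simp: good_Cons good_rev rev_ends bwd_def)
  then have "good ((w # rev ?a) @ [w'])"
    using w a ne by (subst good_append) (auto simp: rev_ends fwd_def adj_commute tri_ac add.assoc)
  moreover have "distinct ?a" by (rule arc(2)) simp
  ultimately have "is_path V ((w # rev ?a) @ [w'])"
    using w C_sub arc(3)[of "i + 1" "i + c"] by (auto simp: is_path_def W_def)
  from nopath[OF this] show ?thesis using le by simp
qed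

lemma nown_bound: "2 * nown w \<le> c"
proof -
  have "cnt (\<lambda>i. own w i \<or> own w (i + 1)) = cnt (own w) + cnt (\<lambda>i. own w (i + 1))"
    by (rule cnt_disj) (rule own_facts(9))
  moreover have "cnt (\<lambda>i. own w (i + 1)) = cnt (own w)" by (rule cnt_shift) (rule periodics)
  ultimately show ?thesis using cnt_le_c[of "\<lambda>i. own w i \<or> own w (i + 1)"] by (simp add: nown_def)
qed

lemma degsum_V: "degsum V = degsum C + (\<Sum>w\<in>W. deg W w + 2 * deg C w)"
proof -
  have "W \<union> C = V" using C_sub by (auto simp: W_def)
  then show ?thesis using degsum_Un[of W C] fin_C fin_W by (auto simp: W_def)
qed

end

section \<open>Cycles of length k - 1\<close>

context longest_cycle
begin

text \<open>At most three edges meet the pair, a degree sum of at most 6, whereas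
  \<open>removal\<close> demands more than \<open>2 * (k - 1) \<ge> 6\<close>.\<close>

lemma isolated_pair_removable:
  assumes "w \<in> W" "w' \<in> W" "w \<noteq> w'" "{z \<in> V - {w, w'}. adj w z} \<subseteq> {y}" "{z \<in> V - {w, w'}. adj w' z} \<subseteq> {y}"
  shows False
proof -
  let ?U = "{w, w'}"
  have one: "deg (V - ?U) u \<le> 1" if "u \<in> ?U" for u
  proof -
    have "{z \<in> V - ?U. adj u z} \<subseteq> {y}" using that assms(4,5) by blast
    then have "deg (V - ?U) u \<le> int (card {y})" by (intro deg_insert_card) auto
    then show ?thesis by simp
  qed
  have U1: "deg ?U u \<le> 1" if "u \<in> ?U" for u
  proof -
    have "{z \<in> ?U. adj u z} \<subseteq> ?U - {u}" using adj_irrefl by auto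
    then have "deg ?U u \<le> int (card (?U - {u}))" by (intro deg_insert_card) auto
    also have "card (?U - {u}) = 1" using that assms(3) by auto
    finally show ?thesis by simp
  qed
  have "(\<Sum>u\<in>?U. deg ?U u + 2 * deg (V - ?U) u) \<le> (\<Sum>u\<in>?U. 3)"
    by (rule sum_mono) (use one U1 in force)
  also have "\<dots> = 6" using assms(3) by simp
  finally have "(\<Sum>u\<in>?U. deg ?U u + 2 * deg (V - ?U) u) \<le> 6" .
  moreover have "(k - 1) * int (card ?U) < (\<Sum>u\<in>?U. deg ?U u + 2 * deg (V - ?U) u)"
    by (rule removal) (use assms in \<open>auto simp: W_def\<close>)
  moreover have "int (card ?U) = 2" using assms(3) by simp
  ultimately show False using k4 by simp
qed

lemma reach_all:
  assumes "\<And>w w' i. w \<in> W \<Longrightarrow> adj w (f i) \<Longrightarrow> w' \<in> W \<Longrightarrow> adj w w' \<Longrightarrow> \<exists>i'. adj w' (f i')"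
    and "w \<in> W"
  shows "\<exists>i. adj w (f i)"
proof -
  let ?X = "C \<union> {w \<in> W. \<exists>i. adj w (f i)}"
  have "?X = V"
  proof (rule ccontr)
    assume "?X \<noteq> V"
    moreover have "C \<noteq> {}" using f_C[of 0] by (metis empty_iff)
    ultimately have "?X \<subset> V" "?X \<noteq> {}" using C_sub by (auto simp: W_def)
    from connected[OF this] obtain x y where xy: "x \<in> ?X" "y \<in> V - ?X" "adj x y" by blast
    then have yW: "y \<in> W" by (auto simp: W_def)
    show False
    proof (cases "x \<in> C")
      case True
      then obtain i where "x = f i" by (auto simp: C_def)
      then show False using xy yW by (auto simp: adj_commute)
    next
      case False
      then obtain i where "x \<in> W" "adj x (f i)" using xy by auto
      then show False using assms(1)[of x i y] xy yW by blast
    qed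
  qed
  then show ?thesis using assms(2) by (auto simp: W_def)
qed

context
  assumes k1: "k = c + 1"
begin

text \<open>A path around the cycle has room for one outside vertex only, so every entry of
  \<open>w\<close> or \<open>w'\<close> must be blocked by the triangle on their common edge. Its
  third vertex \<open>f i\<close> is then the only further neighbour of either, and the pair can be
  removed.\<close>

lemma W_indep1:
  assumes "w \<in> W" "adj w (f i)" "w' \<in> W" "adj w w'"
  shows False
proof -
  have tri1: "tri w (f m) z" if "w \<in> W" "z \<in> W" "adj w (f m)" "adj w z" for w z m
  proof (rule ccontr)
    assume n: "\<not> ?thesis"
    have "z \<noteq> w" using that adj_irrefl by auto
    then have "int (length [z, w]) + c \<le> k"
      using that n by (intro ear_path_any[of _ m]) (auto simp: adj_commute tri_ac)
    then show False using k1 by simp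
  qed
  have t: "tri w (f i) w'" using tri1 assms by blast
  have only: "{z \<in> V - {u, u'}. adj u z} \<subseteq> {f i}" if "tri u (f i) u'" "u \<in> W" "u' \<in> W" for u u'
  proof
    fix z assume z: "z \<in> {z \<in> V - {u, u'}. adj u z}"
    show "z \<in> {f i}"
    proof (cases "z \<in> C")
      case True
      then obtain m where m: "z = f m" by (auto simp: C_def)
      have "tri u (f m) u'" using tri1[of u u' m] that z m tri_adj_all[OF that(1)] by auto
      then have "f m = f i" using that(1) tri_unique[of u u' "f m" "f i"] tri_perms by blast
      then show ?thesis using m by simp
    next
      case False
      then have "tri u (f i) z" using tri1[of u z i] that z tri_adj_all[OF that(1)] by (auto simp: W_def)
      then have "z = u'" using that(1) tri_unique[of u "f i" z u'] by blast
      then show ?thesis using z by simp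
    qed
  qed
  show False
    by (rule isolated_pair_removable[of w w' "f i"])
      (use assms t only[OF t] only[OF tri_perms(6)[OF t]] tri_distinct[OF t] in \<open>auto simp: insert_commute\<close>)
qed

lemma W_attached1: "w \<in> W \<Longrightarrow> \<exists>i. adj w (f i)"
  by (rule reach_all) (use W_indep1 in blast)

lemma deg_W1: "w \<in> W \<Longrightarrow> deg W w = 0"
  using W_attached1 W_indep1 by (intro deg_eq_0) blast

lemma bwd_fwd1: "w \<in> W \<Longrightarrow> w' \<in> W \<Longrightarrow> bwd w i \<Longrightarrow> fwd w' (i + 1) \<Longrightarrow> w = w'"
  using arc_ends[of w i w'] k1 by fastforce

text \<open>Since \<open>bwd_fwd1\<close> keeps different vertices from entering at consecutive
  positions, all of \<open>W\<close> together satisfies the edge count known for one vertex. This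
  settles \<open>a \<ge> 3\<close>; for \<open>a = 2\<close> the missing edges between successors
  are needed.\<close>

lemma codim_ne_1: False
proof -
  define R where "R i \<longleftrightarrow> (\<exists>w\<in>W. both w i)" for i
  define Own where "Own i \<longleftrightarrow> (\<exists>w\<in>W. own w i)" for i
  have perR: "periodic R" using periodics(4) by (simp add: periodic_def R_def)
  have perO: "periodic Own" using periodics(1) by (simp add: periodic_def Own_def)
  have RR: "\<not> R (i + 1)" if Ri: "R i" for i
  proof
    assume "R (i + 1)"
    then obtain w w' where w: "w \<in> W" "both w i" "w' \<in> W" "both w' (i + 1)" using Ri by (auto simp: R_def)
    then have "w = w'" using bwd_fwd1[of w w' i] by (auto simp: both_def)
    then show False using both_indep[of w i] w by blast
  qed
  have OR: "\<not> R i \<and> \<not> R (i + 1)" if Oi: "Own i" for i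
  proof -
    obtain w where w: "w \<in> W" "own w i" using Oi by (auto simp: Own_def)
    have "\<not> R i"
    proof
      assume "R i"
      then obtain w' where w': "w' \<in> W" "both w' i" by (auto simp: R_def)
      then have "w' = w" using bwd_fwd1[of w' w i] own_facts(2)[OF w(2)] w by (auto simp: both_def)
      then show False using own_facts(7)[OF w(2)] w' by simp
    qed
    moreover have "\<not> R (i + 1)"
    proof
      assume "R (i + 1)"
      then obtain w' where w': "w' \<in> W" "both w' (i + 1)" by (auto simp: R_def)
      then have "w = w'" using bwd_fwd1[of w w' i] own_facts(1)[OF w(2)] w by (auto simp: both_def)
      then show False using own_facts(8)[OF w(2)] w' by simp
    qed
    ultimately show ?thesis ..
  qed
  define \<rho> where "\<rho> = cnt R"
  define T where "T = cnt Own"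
  define a where "a = int (card W)"
  have T_sum: "T = (\<Sum>w\<in>W. nown w)" using sum_nown[of W] cnt_cong[of Own "\<lambda>i. \<exists>w\<in>W. own w i"] by (simp add: T_def Own_def)
  have b1: "2 * \<rho> + T \<le> c"
  proof -
    have "cnt (\<lambda>i. (R i \<or> R (i + 1)) \<or> Own i) = cnt (\<lambda>i. R i \<or> R (i + 1)) + cnt Own"
      by (rule cnt_disj) (use OR in blast)
    also have "cnt (\<lambda>i. R i \<or> R (i + 1)) = cnt R + cnt (\<lambda>i. R (i + 1))"
      by (rule cnt_disj) (rule RR)
    also have "cnt (\<lambda>i. R (i + 1)) = cnt R" by (rule cnt_shift[OF perR])
    finally show ?thesis using cnt_le_c[of "\<lambda>i. (R i \<or> R (i + 1)) \<or> Own i"] by (simp add: \<rho>_def T_def)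
  qed
  have nn: "\<rho> \<ge> 0" "T \<ge> 0" by (simp_all add: \<rho>_def T_def cnt_nonneg)
  have a2: "a \<ge> 2" using card_W card_V_gt k1 by (simp add: a_def)
  have cV: "int (card V) = c + a" using card_W by (simp add: a_def)
  have dV: "degsum V \<le> c * (c - 1) - nonadj + 2 * (a * \<rho>) + 4 * T"
  proof -
    have "degsum V = degsum C + (\<Sum>w\<in>W. 2 * nboth w + 4 * nown w)"
      unfolding degsum_V using deg_W1 deg_C by simp
    also have "\<dots> = degsum C + 2 * (\<Sum>w\<in>W. nboth w) + 4 * T"
      by (simp add: sum.distrib sum_distrib_left T_sum)
    also have "(\<Sum>w\<in>W. nboth w) \<le> (\<Sum>w\<in>W. \<rho>)"
      by (rule sum_mono) (auto simp: nboth_def \<rho>_def R_def intro!: cnt_mono)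
    finally show ?thesis using degsum_C by (simp add: a_def)
  qed
  have main: "c * (c + a) < c * (c - 1) - nonadj + 2 * (a * \<rho>) + 4 * T"
    using counterexample dV cV k1 by simp
  have na0: "nonadj \<ge> 0" by (simp add: nonadj_def)
  show False
  proof (cases "a = 2")
    case False
    then have a3: "a \<ge> 3" using a2 by simp
    show False
    \<comment> \<open>In both cases \<open>main\<close> gives
      \<open>c * (a + 1) < 2 * a * \<rho> + 4 * T\<close>, and the right side is
      \<open>(a - 4) * (2 * \<rho>) + 4 * (2 * \<rho> + T)\<close>, to be estimated by
      \<open>b1\<close>.\<close>
    proof (cases "a = 3")
      case True
      then show False using main b1 nn na0 by (simp add: algebra_simps)
    next
      case False
      then have "(a - 4) * (2 * \<rho>) \<le> (a - 4) * c" using a3 b1 nn by (intro mult_left_mono) auto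
      then show False using main b1 nn na0 c3 by (simp add: algebra_simps)
    qed
  next
    case a2: True
    define D where "D i \<longleftrightarrow> (\<exists>w\<in>W. bwd w i)" for i
    \<comment> \<open>Distinct vertices entering at \<open>f i\<close> and \<open>f j\<close> would
      give a path with \<open>c + 2\<close> vertices. So only one vertex enters at
      \<open>f i\<close>, and its triangle on that edge determines \<open>f j\<close>.\<close>
    define E where "E i j \<longleftrightarrow> (\<exists>w\<in>W. bwd w i \<and> (\<forall>w'\<in>W. bwd w' i \<longrightarrow> w' = w) \<and> tri w (f i) (f j) \<and> f j \<noteq> f (i + 1))" for i j
    have D_cases: "D i \<longleftrightarrow> R i \<or> Own i" for i using bwd_cases by (auto simp: D_def R_def Own_def)
    have Q: "cnt D = \<rho> + T"
    proof -
      have "cnt D = cnt (\<lambda>i. R i \<or> Own i)" by (rule cnt_cong) (rule D_cases)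
      also have "\<dots> = \<rho> + T" unfolding \<rho>_def T_def by (rule cnt_disj) (use OR in blast)
      finally show ?thesis .
    qed
    have "cnt D * (cnt D - 1) \<le> nonadj + 2 * cnt (\<lambda>i. D i \<and> D (i + 1)) + 2 * cnt third_in_C + cnt R"
    proof (rule nonadj_bound)
      show "periodic D" using periodics(2) by (simp add: periodic_def D_def)
    next
      fix i j
      assume Dij: "D i" "D j" and h: "f i \<noteq> f j" "adj (f (i + 1)) (f (j + 1))" "f j \<noteq> f (i + 1)" "f i \<noteq> f (j + 1)"
        "\<not> tri (f (i + 1)) (f (i + 2)) (f (j + 1))" "\<not> tri (f (j + 1)) (f (j + 2)) (f (i + 1))"
      have same: "w = w'" if "w \<in> W" "bwd w i" "w' \<in> W" "bwd w' j" for w w'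
        using chord_ends[OF h that] k1 by fastforce
      obtain w where w: "w \<in> W" "bwd w i" using Dij by (auto simp: D_def)
      obtain w' where w': "w' \<in> W" "bwd w' j" using Dij by (auto simp: D_def)
      have "w' = w" using same w w' by blast
      then have "tri w (f i) (f j)" using chord_cycle[OF h w] w' by simp
      moreover have "u = w" if "u \<in> W" "bwd u i" for u using same[OF that w'] \<open>w' = w\<close> by simp
      ultimately show "E i j" unfolding E_def using w h(3) by blast
    next
      fix i j j' assume "E i j" "E i j'"
      then obtain w w' where "w \<in> W" "bwd w i" "\<forall>w'\<in>W. bwd w' i \<longrightarrow> w' = w" "tri w (f i) (f j)"
        "w' \<in> W" "bwd w' i" "tri w' (f i) (f j')" by (auto simp: E_def)
      then show "f j = f j'" using tri_unique by blast
    next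
      fix i j assume "E i j"
      then obtain w where w: "w \<in> W" "bwd w i" "tri w (f i) (f j)" "f j \<noteq> f (i + 1)" by (auto simp: E_def)
      then have "fwd w i" using tri_unique[of w "f i" "f j" "f (i + 1)"] by (auto simp: fwd_def bwd_def)
      then show "R i" using w by (auto simp: R_def both_def)
    qed
    moreover have "cnt (\<lambda>i. D i \<and> D (i + 1)) \<le> T"
    proof -
      have "Own (i + 1)" if Di: "D i" "D (i + 1)" for i
      proof (rule ccontr)
        assume "\<not> Own (i + 1)"
        then obtain w' where w': "w' \<in> W" "both w' (i + 1)" using Di D_cases by (auto simp: R_def)
        obtain w where w: "w \<in> W" "bwd w i" using Di by (auto simp: D_def)
        then have e: "w = w'" using bwd_fwd1[of w w' i] w' by (auto simp: both_def)
        then have "own w i" using insertion[of w i] w w' by (auto simp: both_def)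
        then show False using own_facts(8)[of w i] e w' by blast
      qed
      then have "cnt (\<lambda>i. D i \<and> D (i + 1)) \<le> cnt (\<lambda>i. Own (i + 1))" by (intro cnt_mono) blast
      then show ?thesis using cnt_shift[OF perO, of 1] by (simp add: T_def)
    qed
    moreover have "cnt third_in_C + T \<le> c" using third_in_C_bound sum_nown[of W] T_sum by simp
    ultimately have nb: "(\<rho> + T) * (\<rho> + T - 1) \<le> nonadj + 2 * c + \<rho>" unfolding Q \<rho>_def[symmetric] by linarith
    define q where "q = \<rho> + T"
    have m1: "3 * c + nonadj < 4 * q" using main a2 by (simp add: q_def algebra_simps)
    have m2: "q * q - q \<le> nonadj + 2 * c + \<rho>" using nb by (simp add: q_def algebra_simps)
    have m3: "q + \<rho> \<le> c" using b1 by (simp add: q_def)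
    \<comment> \<open>By \<open>m3\<close> the right side of \<open>m2\<close> is at most
      \<open>nonadj + 3 * c - q\<close>, which \<open>m1\<close> bounds by
      \<open>4 * q - q\<close>.\<close>
    have "q * q < 4 * q" using m1 m2 m3 by linarith
    moreover have "q > 0" using m1 c3 na0 by linarith
    ultimately have "q < 4" by simp
    \<comment> \<open>What remains is a cycle of length 3 with all edges owned, but each of the two
      outside vertices owns at most one of them.\<close>
    then have "c = 3" "q = 3" using m1 c3 na0 by linarith+
    then have T3: "T = 3" using m3 nn by (simp add: q_def)
    have "nown w \<le> 1" for w using nown_bound[of w] \<open>c = 3\<close> by simp
    then have "T \<le> (\<Sum>w\<in>W. 1)" unfolding T_sum by (intro sum_mono) auto
    then show False using T3 a2 by (simp add: a_def)
  qed
qed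

end

end

section \<open>Cycles of length k - 2\<close>

context longest_cycle
begin

lemma cnt_or_and: "cnt P + cnt Q = cnt (\<lambda>i. P i \<or> Q i) + cnt (\<lambda>i. P i \<and> Q i)"
proof -
  have "cnt (\<lambda>i. P i \<or> Q i) = cnt (\<lambda>i. (P i \<and> \<not> Q i) \<or> Q i)" by (rule cnt_cong) auto
  also have "\<dots> = cnt (\<lambda>i. P i \<and> \<not> Q i) + cnt Q" by (rule cnt_disj) auto
  finally have 1: "cnt (\<lambda>i. P i \<or> Q i) = cnt (\<lambda>i. P i \<and> \<not> Q i) + cnt Q" .
  have "cnt P = cnt (\<lambda>i. (P i \<and> \<not> Q i) \<or> (P i \<and> Q i))" by (rule cnt_cong) auto
  also have "\<dots> = cnt (\<lambda>i. P i \<and> \<not> Q i) + cnt (\<lambda>i. P i \<and> Q i)" by (rule cnt_disj) auto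
  finally show ?thesis using 1 by simp
qed

lemma cnt_zero_imp: "periodic P \<Longrightarrow> cnt P = 0 \<Longrightarrow> \<not> P i"
proof
  assume P: "periodic P" "cnt P = 0" "P i"
  then have "P (i mod c)" using periodic_mod[OF P(1), of i] by simp
  then have "i mod c \<in> {i. 0 \<le> i \<and> i < c \<and> P i}" using c3 by simp
  then show False using P(2) cnt_finite[of P] by (auto simp: cnt_def)
qed

lemma cnt_sum: "cnt P = (\<Sum>i\<in>{0..<c}. if P i then 1 else 0)"
proof -
  have "{0..<c} \<inter> {i. P i} = {i. 0 \<le> i \<and> i < c \<and> P i}" by auto
  then show ?thesis by (simp add: cnt_def sum.If_cases)
qed

section \<open>Exchanges through adjacent outside vertices\<close>

lemma not_bwd: "nbr w i \<Longrightarrow> \<not> bwd w i \<Longrightarrow> own w (i - 1)"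
  by (auto simp: bwd_def own_def tri_ac)

lemma not_fwd: "nbr w i \<Longrightarrow> \<not> fwd w i \<Longrightarrow> own w i"
  by (auto simp: fwd_def own_def)

text \<open>The ear \<open>v, v'\<close> would replace at most one cycle vertex by two.\<close>

lemma exchange:
  assumes "v \<in> W" "v' \<in> W" "adj v v'" "bwd v i" "fwd v' j" "\<not> tri v v' (f i)" "\<not> tri v v' (f j)"
    "j = i + 1 \<or> j = i + 2"
  shows False
proof -
  have "v \<noteq> v'" using assms adj_irrefl by auto
  then have "int (length [v, v']) < j - i"
    using assms c3 by (intro ear_cycle) (auto simp: bwd_def fwd_def adj_commute tri_ac)
  then show False using assms(8) by auto
qed

text \<open>The condition on \<open>tri\<close> ensures that leaving the cycle into \<open>K\<close>
  along one edge and returning along another never makes a forbidden turn inside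
  \<open>K\<close>.\<close>

definition clique :: "'a set \<Rightarrow> bool" where
  "clique K \<longleftrightarrow> K \<subseteq> W \<and> (\<forall>a\<in>K. \<forall>b\<in>K. a \<noteq> b \<longrightarrow> adj a b \<and> (\<forall>i. \<not> tri a b (f i)))"

lemma clique_exchange:
  assumes "clique K" "a \<in> K" "b \<in> K" "a \<noteq> b" "bwd a i" "fwd b j" "j = i + 1 \<or> j = i + 2"
  shows False
  using assms by (intro exchange[of a b i j]) (auto simp: clique_def)

text \<open>An entry that is blocked in the needed direction belongs to an owned edge, and its other
  end can be used instead. A cycle edge has a single owner, so \<open>a\<close> and \<open>b\<close>
  are not both blocked by the edge before \<open>f j\<close>. In every case the two entries end up
  at distance one or two, and \<open>clique_exchange\<close> applies.\<close>

lemma clique_next: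
  assumes K: "clique K" and ab: "a \<in> K" "b \<in> K" "a \<noteq> b" "nbr a j" "nbr b j" and u: "u \<in> K" "nbr u (j + 1)"
  shows False
proof -
  have 1: False if "v \<in> K" "u \<noteq> v" "bwd v j" for v
  proof (cases "fwd u (j + 1)")
    case True
    then show False using clique_exchange[OF K that(1) u(1) _ that(3), of "j + 1"] that(2) by auto
  next
    case False
    then have "own u (j + 1)" using not_fwd u by blast
    then have "fwd u (j + 2)" using own_facts(2)[of u "j + 1"] by (simp add: add.assoc)
    then show False using clique_exchange[OF K that(1) u(1) _ that(3), of "j + 2"] that(2) by auto
  qed
  have 2: False if v: "v \<in> K" "u \<noteq> v" "nbr v j" "nbr u j" for v
  proof (cases "bwd v j")
    case True
    then show False using 1 v by blast
  next
    case False
    then have "own v (j - 1)" using not_bwd v by blast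
    then have b: "bwd v (j - 1)" by (rule own_facts(1))
    show False
    proof (cases "fwd u (j + 1)")
      case True
      then show False using clique_exchange[OF K v(1) u(1) _ b, of "j + 1"] v(2) by auto
    next
      case nf: False
      then have "own u (j + 1)" using not_fwd u by blast
      then have "fwd u j" using own_facts(9)[of u j] not_fwd v(4) by blast
      then show False using clique_exchange[OF K v(1) u(1) _ b, of j] v(2) by auto
    qed
  qed
  show False
  proof (cases "u = a \<or> u = b")
    case True
    then show False using 2[of a] 2[of b] ab by auto
  next
    case False
    have "bwd a j \<or> bwd b j"
      using not_bwd[of a j] not_bwd[of b j] own_unique[of a "j - 1" b] ab by blast
    then show False using 1[of a] 1[of b] ab False by auto
  qed
qed

lemma clique_prev:
  assumes K: "clique K" and ab: "a \<in> K" "b \<in> K" "a \<noteq> b" "nbr a j" "nbr b j" and u: "u \<in> K" "nbr u (j - 1)"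
  shows False
proof -
  interpret r: longest_cycle adj tri V k "\<lambda>i. f (- i)" c by (rule reflected)
  have "r.clique K" using K reflected_sets by (simp add: clique_def r.clique_def)
  moreover have "adj u (f (- (- j + 1)))" using u by (simp add: add.commute)
  ultimately show False using r.clique_next[of K a b "- j" u] ab u by simp
qed

text \<open>Next to a shared position no vertex of \<open>K\<close> is adjacent to the cycle, so no
  owned edge blocks the entries at \<open>f j\<close> and \<open>f (j + 2)\<close>, and they can be
  exchanged.\<close>

lemma clique_far:
  assumes K: "clique K" and ab: "a \<in> K" "b \<in> K" "a \<noteq> b" "nbr a j" "nbr b j"
    and de: "d \<in> K" "e \<in> K" "d \<noteq> e" "nbr d (j + 2)" "nbr e (j + 2)"
  shows False
proof -
  have b: "bwd v j" if "v \<in> K" "nbr v j" for v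
  proof (rule ccontr)
    assume "\<not> bwd v j"
    then have "own v (j - 1)" using not_bwd that by blast
    then show False using clique_prev[OF K ab that(1)] own_facts(3) by blast
  qed
  have f: "fwd v (j + 2)" if "v \<in> K" "nbr v (j + 2)" for v
  proof (rule ccontr)
    assume "\<not> fwd v (j + 2)"
    then have "own v (j + 2)" using not_fwd that by blast
    then have "nbr v (j + 2 + 1)" by (rule own_facts(4))
    then show False using clique_next[OF K de that(1)] by blast
  qed
  obtain v where v: "v \<in> K" "nbr v j" "v \<noteq> d" using ab by blast
  show False
    using clique_exchange[OF K v(1) de(1) v(3) b[OF v(1,2)] f[OF de(1,4)]] by blast
qed

text \<open>A position with several neighbours in \<open>K\<close> contributes at most two too many.
  Both positions next to it contribute nothing, and by \<open>clique_far\<close> no empty position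
  is charged from both sides.\<close>

lemma clique_degrees:
  assumes K: "clique K" and card: "card K \<le> 3"
  shows "(\<Sum>u\<in>K. deg C u) \<le> c"
proof -
  have fK: "finite K" using K finite_subset[OF _ fin_W] by (simp add: clique_def)
  define m where "m j = int (card {u \<in> K. nbr u j})" for j
  define multi where "multi j \<longleftrightarrow> (\<exists>a\<in>K. \<exists>b\<in>K. a \<noteq> b \<and> nbr a j \<and> nbr b j)" for j
  define zero where "zero j \<longleftrightarrow> (\<forall>u\<in>K. \<not> nbr u j)" for j
  have "(\<Sum>u\<in>K. deg C u) = (\<Sum>u\<in>K. \<Sum>j\<in>{0..<c}. if nbr u j then 1 else 0)"
    by (simp add: deg_cnt cnt_sum)
  also have "\<dots> = (\<Sum>j\<in>{0..<c}. \<Sum>u\<in>K. if nbr u j then 1 else 0)" by (rule sum.swap)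
  also have "\<dots> = (\<Sum>j\<in>{0..<c}. m j)"
    by (rule sum.cong) (use fK in \<open>simp_all add: m_def sum.If_cases Int_def\<close>)
  also have "\<dots> \<le> (\<Sum>j\<in>{0..<c}. 1 + 2 * (if multi j then 1 else 0) - (if zero j then 1 else 0))"
  proof (rule sum_mono)
    fix j
    let ?S = "{u \<in> K. nbr u j}"
    have fS: "finite ?S" using fK by simp
    have le3: "card ?S \<le> 3" using card card_mono[OF fK, of ?S] by auto
    show "m j \<le> 1 + 2 * (if multi j then 1 else 0) - (if zero j then 1 else 0)"
    proof (cases "multi j")
      case True
      then have "\<not> zero j" by (auto simp: multi_def zero_def)
      then show ?thesis using True le3 by (simp add: m_def)
    next
      case False
      then have "card ?S \<le> 1" using fS unfolding One_nat_def card_le_Suc0_iff_eq[OF fS] by (auto simp: multi_def)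
      moreover have "card ?S = 0" if "zero j"
      proof -
        have "?S = {}" using that by (auto simp: zero_def)
        then show ?thesis by (simp only: card.empty)
      qed
      ultimately show ?thesis using False by (auto simp: m_def)
    qed
  qed
  also have "\<dots> = c + 2 * cnt multi - cnt zero"
    using c3 by (simp add: sum.distrib sum_subtractf cnt_sum sum_distrib_left[symmetric])
  also have "2 * cnt multi \<le> cnt zero"
  proof -
    have pm: "periodic multi" by (auto simp: periodic_def multi_def f_per)
    have "cnt (\<lambda>j. multi (j + 1) \<or> multi (j - 1)) = cnt (\<lambda>j. multi (j + 1)) + cnt (\<lambda>j. multi (j - 1))"
    proof (rule cnt_disj)
      fix j assume "multi (j + 1)"
      then obtain d e where de: "d \<in> K" "e \<in> K" "d \<noteq> e" "nbr d (j + 1)" "nbr e (j + 1)" by (auto simp: multi_def)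
      show "\<not> multi (j - 1)"
      proof
        assume "multi (j - 1)"
        then obtain a b where ab: "a \<in> K" "b \<in> K" "a \<noteq> b" "nbr a (j - 1)" "nbr b (j - 1)" by (auto simp: multi_def)
        have "j - 1 + 2 = j + 1" by simp
        then show False using clique_far[OF K ab de(1-3)] de(4,5) by presburger
      qed
    qed
    moreover have "cnt (\<lambda>j. multi (j + 1)) = cnt multi" "cnt (\<lambda>j. multi (j - 1)) = cnt multi"
      using cnt_shift[OF pm, of 1] cnt_shift[OF pm, of "-1"] by simp_all
    moreover have "cnt (\<lambda>j. multi (j + 1) \<or> multi (j - 1)) \<le> cnt zero"
    proof (rule cnt_mono)
      fix j assume "multi (j + 1) \<or> multi (j - 1)"
      then show "zero j"
      proof
        assume "multi (j + 1)"
        then obtain d e where de: "d \<in> K" "e \<in> K" "d \<noteq> e" "nbr d (j + 1)" "nbr e (j + 1)" by (auto simp: multi_def)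
        then show "zero j" using clique_prev[OF K de] by (auto simp: zero_def)
      next
        assume "multi (j - 1)"
        then obtain d e where de: "d \<in> K" "e \<in> K" "d \<noteq> e" "nbr d (j - 1)" "nbr e (j - 1)" by (auto simp: multi_def)
        then show "zero j" using clique_next[OF K de] by (auto simp: zero_def)
      qed
    qed
    ultimately show ?thesis by simp
  qed
  finally show ?thesis by simp
qed

section \<open>Adjacent pairs outside the cycle\<close>

lemma own_not_third:
  assumes "b \<in> W" "own a i" shows "\<not> tri a b (f i)" "\<not> tri a b (f (i + 1))"
proof -
  have t: "tri a (f i) (f (i + 1))" using assms(2) by (simp add: own_def)
  have nb: "b \<noteq> f m" for m using assms(1) f_C[of m] by (auto simp: W_def)
  show "\<not> tri a b (f i)"
  proof
    assume "tri a b (f i)"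
    then have "b = f (i + 1)" using tri_unique[OF tri_perms(2) t] by blast
    then show False using nb by blast
  qed
  show "\<not> tri a b (f (i + 1))"
  proof
    assume "tri a b (f (i + 1))"
    then have "b = f i" using tri_unique[OF tri_perms(2) tri_perms(2)[OF t]] by blast
    then show False using nb by blast
  qed
qed

lemma third_both:
  assumes "a \<in> W" "b \<in> W" "tri a b (f i)" shows "both a i" "both b i"
proof -
  have "both a i" if "a \<in> W" "b \<in> W" "tri a b (f i)" for a b
  proof -
    have "b \<noteq> f m" for m using that(2) f_C[of m] by (auto simp: W_def)
    then have "\<not> tri a (f i) (f m)" for m using tri_unique[OF tri_perms(2)[OF that(3)], of "f m"] by metis
    then show ?thesis using tri_adj_all[OF that(3)] by (simp add: both_def bwd_def fwd_def)
  qed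
  then show "both a i" "both b i" using assms tri_perms(3)[OF assms(3)] by blast+
qed

text \<open>The argument of \<open>clique_next\<close>, but now the edge from \<open>a\<close> to
  \<open>b\<close> may have its third vertex on the cycle. Entries that are ends of owned edges are
  never this vertex. If \<open>f (j + 1)\<close> were, then both \<open>a\<close> and
  \<open>b\<close> would own the edge before \<open>f j\<close>.\<close>

lemma pair_next:
  assumes ab: "a \<in> W" "b \<in> W" "adj a b" and j: "nbr a j" "nbr b j" "\<not> tri a b (f j)" and n: "nbr b (j + 1)"
  shows False
proof -
  have nX: "\<not> tri a b (f (j + 1))"
  proof
    assume t: "tri a b (f (j + 1))"
    note tb = third_both[OF ab(1,2) t]
    have "own u (j - 1)" if "u \<in> W" "nbr u j" "both u (j + 1)" for u
    proof (rule ccontr)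
      assume "\<not> own u (j - 1)"
      then have "bwd u j" using not_bwd that by blast
      then have "own u j" using insertion[of u j] that by (auto simp: both_def)
      then show False using own_facts(8) that by blast
    qed
    then have "a = b" using own_unique[of a "j - 1" b] ab j tb by blast
    then show False using ab adj_irrefl by blast
  qed
  have sym: "tri a b z \<longleftrightarrow> tri b a z" for z using tri_swap by blast
  show False
  proof (cases "bwd a j")
    case True
    show False
    proof (cases "fwd b (j + 1)")
      case True
      then show False using exchange[OF ab \<open>bwd a j\<close> True j(3) nX] by simp
    next
      case False
      then have o: "own b (j + 1)" using not_fwd n by blast
      have "fwd b (j + 1 + 1)" by (rule own_facts(2)[OF o])
      moreover have "\<not> tri a b (f (j + 1 + 1))" using own_not_third(2)[OF ab(1) o] sym by blast
      ultimately show False using exchange[OF ab \<open>bwd a j\<close> _ j(3), of "j + 1 + 1"] by simp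
    qed
  next
    case False
    then have o: "own a (j - 1)" using not_bwd j by blast
    note b1 = own_facts(1)[OF o] own_not_third(1)[OF ab(2) o]
    show False
    proof (cases "fwd b (j + 1)")
      case True
      then show False using exchange[OF ab b1(1) True b1(2) nX] by simp
    next
      case False
      then have "own b (j + 1)" using not_fwd n by blast
      then have "fwd b j" using own_facts(9)[of b j] not_fwd j by blast
      then show False using exchange[OF ab b1(1) _ b1(2) j(3)] by simp
    qed
  qed
qed

text \<open>Common neighbours, other than the third vertex \<open>X\<close> of the edge from
  \<open>a\<close> to \<open>b\<close>, have successors adjacent to neither vertex. The position
  \<open>X\<close> costs one, which is paid by an owned edge if there is one; if there is none, all
  entries are in \<open>both\<close> and \<open>both_indep\<close> covers \<open>X\<close> as
  well.\<close>

lemma pair_degrees: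
  assumes ab: "a \<in> W" "b \<in> W" "adj a b"
  shows "deg C a + deg C b \<le> c + nown a + nown b"
proof -
  define X where "X i \<longleftrightarrow> tri a b (f i)" for i
  define P where "P i \<longleftrightarrow> nbr a i \<or> nbr b i" for i
  define Q where "Q i \<longleftrightarrow> nbr a i \<and> nbr b i" for i
  have pQ: "periodic Q" by (auto simp: periodic_def Q_def f_per)
  have pQX: "periodic (\<lambda>i. Q i \<and> \<not> X i)" by (auto simp: periodic_def Q_def X_def f_per)
  have nn: "nown v \<ge> 0" for v by (simp add: nown_def cnt_nonneg)
  have sum: "deg C a + deg C b = cnt P + cnt Q"
    unfolding deg_cnt P_def Q_def by (rule cnt_or_and)
  have XX: "\<not> P (i + 1)" if "Q i \<and> \<not> X i" for i
  proof -
    have "\<not> nbr b (i + 1)" using pair_next[OF ab, of i] that by (auto simp: Q_def X_def)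
    moreover have "\<not> nbr a (i + 1)"
      using pair_next[OF ab(2,1), of i] that ab(3) tri_swap by (auto simp: Q_def X_def adj_commute)
    ultimately show ?thesis by (simp add: P_def)
  qed
  have bound: "cnt P + cnt Y \<le> c" if Y: "periodic Y" "\<And>i. Y i \<Longrightarrow> \<not> P (i + 1)" for Y
  proof -
    have "cnt (\<lambda>i. P i \<or> Y (i - 1)) = cnt P + cnt (\<lambda>i. Y (i - 1))"
      by (rule cnt_disj) (use Y(2)[of "i - 1" for i] in auto)
    moreover have "cnt (\<lambda>i. Y (i - 1)) = cnt Y" using cnt_shift[OF Y(1), of "-1"] by simp
    ultimately show ?thesis using cnt_le_c[of "\<lambda>i. P i \<or> Y (i - 1)"] by simp
  qed
  show ?thesis
  proof (cases "nown a + nown b = 0")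
    case True
    then have "nown a = 0" "nown b = 0" using nn[of a] nn[of b] by auto
    then have no: "\<not> own a i" "\<not> own b i" for i
      using cnt_zero_imp[OF periodics(1)] by (auto simp: nown_def)
    have bb: "both u i" if "nbr u i" "u = a \<or> u = b" for u i using that nbr_cases no by blast
    have "cnt P + cnt Q \<le> c"
    proof (rule bound[OF pQ])
      fix i assume q: "Q i"
      show "\<not> P (i + 1)"
      proof
        assume "P (i + 1)"
        then obtain u where u: "u = a \<or> u = b" "nbr u (i + 1)" by (auto simp: P_def)
        then have "nbr u i" using q by (auto simp: Q_def)
        then show False using both_indep[of u i] bb u ab by blast
      qed
    qed
    then show ?thesis using sum True by simp
  next
    case False
    have "cnt Q = cnt (\<lambda>i. (Q i \<and> \<not> X i) \<or> X i)"
      by (rule cnt_cong) (use tri_adj_all in \<open>auto simp: Q_def X_def\<close>)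
    also have "\<dots> = cnt (\<lambda>i. Q i \<and> \<not> X i) + cnt X" by (rule cnt_disj) auto
    finally have "cnt Q = cnt (\<lambda>i. Q i \<and> \<not> X i) + cnt X" .
    moreover have "cnt X \<le> 1" by (rule cnt_le_1) (auto simp: X_def intro: tri_unique)
    moreover have "cnt P + cnt (\<lambda>i. Q i \<and> \<not> X i) \<le> c" by (rule bound[OF pQX]) (rule XX)
    ultimately show ?thesis using sum False nn[of a] nn[of b] by linarith
  qed
qed

section \<open>The graph outside a cycle of length k - 2\<close>

context
  assumes k2: "k = c + 2"
begin

lemma deg_ge_3: "v \<in> V \<Longrightarrow> deg V v \<ge> 3"
  using deg_ge[of v] k2 c3 by linarith

lemma no_ear_3:
  assumes "a \<in> W" "b \<in> W" "d \<in> W" "a \<noteq> b" "b \<noteq> d" "a \<noteq> d" "adj a b" "adj b d" "adj d (f i)"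
    "\<not> tri a b d" "\<not> tri b d (f i)"
  shows False
proof -
  have "int (length [a, b, d]) + c \<le> k"
    by (rule ear_path_any[of _ i]) (use assms in auto)
  then show False using k2 by simp
qed

lemma few_nbrs:
  assumes "v \<in> V" "\<And>z. z \<in> V \<Longrightarrow> adj v z \<Longrightarrow> z = a \<or> z = b"
  shows False
proof -
  have "deg V v \<le> int (card {a, b})" by (rule deg_insert_card) (use assms in auto)
  also have "card {a, b} \<le> 2" by (simp add: card_insert_if)
  finally show False using deg_ge_3[OF assms(1)] by simp
qed

text \<open>Otherwise \<open>w\<close> has a single neighbour on the cycle, and as its degree is at
  least 3 it has an outside neighbour \<open>v\<close> besides \<open>w'\<close>. By
  \<open>no_ear_3\<close> the outside neighbours of \<open>v\<close> lie in the triangle on the edge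
  from \<open>w\<close> to \<open>v\<close>, so \<open>v\<close> is attached to the cycle too. Then
  \<open>w', w, v\<close> is a forbidden ear.\<close>

lemma free_attachment:
  assumes w: "w \<in> W" "adj w (f i0)" and w': "w' \<in> W" "adj w w'"
  shows "\<exists>i. adj w (f i) \<and> \<not> tri w (f i) w'"
proof (rule ccontr)
  assume n: "\<not> ?thesis"
  then have all: "tri w (f i) w'" if "adj w (f i)" for i using that by blast
  have t0: "tri w (f i0) w'" using all w by blast
  have same: "f i = f i0" if "adj w (f i)" for i
    using tri_unique[OF tri_perms(2)[OF all[OF that]] tri_perms(2)[OF t0]] .
  have WV: "W \<subseteq> V" by (auto simp: W_def)
  have "\<exists>z\<in>V. adj w z \<and> z \<noteq> w' \<and> z \<noteq> f i0"
    using few_nbrs[of w w' "f i0"] w WV by blast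
  then obtain v where v: "v \<in> V" "adj w v" "v \<noteq> w'" "v \<noteq> f i0" by blast
  have vW: "v \<in> W" using v same by (auto simp: W_def C_def)
  have wv: "w \<noteq> v" "w \<noteq> w'" using v w' adj_irrefl by auto
  have nt: "\<not> tri v w (f i0)"
  proof
    assume "tri v w (f i0)"
    then have "v = w'" using tri_unique[OF tri_perms(4) t0] by blast
    then show False using v by simp
  qed
  have u: "tri w v z" if "z \<in> W" "adj v z" "z \<noteq> w" for z
  proof (rule ccontr)
    assume n: "\<not> tri w v z"
    have "z \<noteq> v" using that adj_irrefl by auto
    moreover have "\<not> tri z v w" using n tri_perms by blast
    ultimately show False
      using no_ear_3[of z v w i0] that vW w v wv nt by (auto simp: adj_commute)
  qed
  obtain m where m: "adj v (f m)"
  proof -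
    have "\<exists>m. adj v (f m)"
    proof (rule ccontr)
      assume nm: "\<not> ?thesis"
      have in_W: "z \<in> W" if "z \<in> V" "adj v z" for z using that nm by (auto simp: W_def C_def)
      show False
      proof (cases "\<exists>z. tri w v z")
        case True
        then obtain y where "tri w v y" by blast
        then show False using few_nbrs[OF v(1), of w y] in_W u tri_unique by blast
      next
        case False
        then show False using few_nbrs[OF v(1), of w w] in_W u by blast
      qed
    qed
    then show ?thesis using that by blast
  qed
  show False
  proof (rule no_ear_3[of w' w v m])
    show "\<not> tri w' w v"
    proof
      assume "tri w' w v"
      then have "v = f i0" using tri_unique[OF tri_perms(3) tri_perms(2)[OF t0]] by blast
      then show False using v by simp
    qed
    show "\<not> tri w v (f m)"
    proof
      assume t: "tri w v (f m)"
      then have "f m = f i0" using same tri_adj_all by blast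
      then have "v = w'" using tri_unique[OF tri_perms(2)[OF t], of w'] t0 by simp
      then show False using v by simp
    qed
  qed (use w w' v vW m wv in \<open>auto simp: adj_commute\<close>)
qed

text \<open>With a free attachment of \<open>w\<close>, the sequence \<open>u, w', w\<close> is an
  ear of three vertices unless it turns inside a triangle.\<close>

lemma W_nbrs_attached:
  assumes w: "w \<in> W" "adj w (f i0)" and w': "w' \<in> W" "adj w w'" and u: "u \<in> W" "adj w' u" "u \<noteq> w"
  shows "tri w w' u"
proof (rule ccontr)
  assume n: "\<not> ?thesis"
  obtain i where i: "adj w (f i)" "\<not> tri w (f i) w'" using free_attachment[OF w w'] by blast
  have "u \<noteq> w'" "w' \<noteq> w" using u w' adj_irrefl by auto
  then show False using no_ear_3[of u w' w i] n i u w w'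
    by (auto simp: adj_commute tri_ac)
qed

lemma W_attached2: "w \<in> W \<Longrightarrow> \<exists>i. adj w (f i)"
proof (rule reach_all)
  fix w w' i assume w: "w \<in> W" "adj w (f i)" "w' \<in> W" "adj w w'"
  show "\<exists>i'. adj w' (f i')"
  proof (rule ccontr)
    assume nm: "\<not> ?thesis"
    have w'V: "w' \<in> V" using w by (auto simp: W_def)
    have in_W: "z \<in> W" if "z \<in> V" "adj w' z" for z using that nm by (auto simp: W_def C_def)
    note u = W_nbrs_attached[OF w]
    show False
    proof (cases "\<exists>z. tri w w' z")
      case True
      then obtain y where "tri w w' y" by blast
      then show False using few_nbrs[OF w'V, of w y] in_W u tri_unique by blast
    next
      case False
      then show False using few_nbrs[OF w'V, of w w] in_W u by blast
    qed
  qed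
qed

lemma W_nbrs:
  assumes "w \<in> W" "w' \<in> W" "adj w w'" "u \<in> W" "adj w' u" "u \<noteq> w"
  shows "tri w w' u"
  using W_attached2[OF assms(1)] W_nbrs_attached assms by blast

lemma deg_outside:
  assumes "K \<subseteq> W" "u \<in> K" "\<And>z. z \<in> W \<Longrightarrow> adj u z \<Longrightarrow> z \<in> K"
  shows "deg (V - K) u = deg C u"
proof -
  have "{z \<in> V - K. adj u z} = {z \<in> C. adj u z}" using assms C_sub by (auto simp: W_def)
  then show ?thesis by (simp add: deg_def)
qed

text \<open>By \<open>W_nbrs\<close> such a triangle has no further neighbours in \<open>W\<close>,
  and it is a clique in the sense above. Then \<open>removal\<close> and
  \<open>clique_degrees\<close> give \<open>3 * (c + 1) < 6 + 2 * c\<close>, against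
  \<open>c \<ge> 3\<close>.\<close>

lemma no_triangle:
  assumes "a \<in> W" "b \<in> W" "d \<in> W" "tri a b d"
  shows False
proof -
  let ?K = "{a, b, d}"
  note td = tri_distinct[OF assms(4)]
  note ta = tri_adj_all[OF assms(4)]
  have cK: "card ?K = 3" using td by auto
  have KW: "?K \<subseteq> W" using assms by auto
  have nf: "z \<noteq> f i" if "z \<in> W" for z i using that f_C[of i] by (auto simp: W_def)
  have K: "clique ?K"
  proof -
    have "adj x y \<and> (\<forall>i. \<not> tri x y (f i))" if xy: "x \<in> ?K" "y \<in> ?K" "x \<noteq> y" for x y
    proof -
      obtain z where z: "z \<in> ?K" "tri x y z" using xy tri_perms[OF assms(4)] by blast
      then have "\<not> tri x y (f i)" for i using tri_unique[OF z(2), of "f i"] nf z KW by blast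
      then show ?thesis using tri_adj_all[OF z(2)] by blast
    qed
    then show ?thesis using KW unfolding clique_def by blast
  qed
  have closed: "z \<in> ?K" if uK: "u \<in> ?K" and "z \<in> W" "adj u z" for u z
  proof (rule ccontr)
    assume n: "z \<notin> ?K"
    have "\<exists>x\<in>?K. \<exists>y\<in>?K. tri x u y"
    proof -
      consider "u = a" | "u = b" | "u = d" using uK by blast
      then show ?thesis
      proof cases
        case 1
        then show ?thesis using tri_perms(3)[OF assms(4)] by blast
      next
        case 2
        then show ?thesis using assms(4) by blast
      next
        case 3
        then show ?thesis using tri_perms(2)[OF assms(4)] by blast
      qed
    qed
    then obtain x y where xy: "x \<in> ?K" "y \<in> ?K" "tri x u y" by blast
    have "x \<in> W" "u \<in> W" "z \<noteq> x" using xy(1) that(1) n KW by blast+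
    then have "tri x u z" using W_nbrs[OF _ _ tri_adj_all(1)[OF xy(3)] that(2,3)] by blast
    then show False using tri_unique[OF xy(3), of z] xy n by blast
  qed
  have "(k - 1) * int (card ?K) < (\<Sum>u\<in>?K. deg ?K u + 2 * deg (V - ?K) u)"
    by (rule removal) (use assms in \<open>auto simp: W_def\<close>)
  also have "\<dots> \<le> (\<Sum>u\<in>?K. 2 + 2 * deg C u)"
  proof (rule sum_mono)
    fix u assume u: "u \<in> ?K"
    have "{z \<in> ?K. adj u z} \<subseteq> ?K - {u}" using adj_irrefl by auto
    then have "deg ?K u \<le> int (card (?K - {u}))" by (intro deg_insert_card) auto
    also have "card (?K - {u}) = card ?K - 1" by (rule card_Diff_singleton[OF u])
    finally have "deg ?K u \<le> 2" unfolding cK by simp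
    moreover have "deg (V - ?K) u = deg C u" by (rule deg_outside[OF KW u]) (use closed[OF u] in blast)
    ultimately show "deg ?K u + 2 * deg (V - ?K) u \<le> 2 + 2 * deg C u" by simp
  qed
  also have "\<dots> = int (card ?K) * 2 + 2 * (\<Sum>u\<in>?K. deg C u)"
    by (simp only: sum.distrib sum_distrib_left[symmetric] sum_constant)
  also have "(\<Sum>u\<in>?K. deg C u) \<le> c" by (rule clique_degrees[OF K]) (simp only: cK order_refl)
  finally show False using k2 c3 unfolding cK by simp
qed

lemma W_matching:
  assumes "w \<in> W" "a \<in> W" "b \<in> W" "adj w a" "adj w b" shows "a = b"
proof (rule ccontr)
  assume "a \<noteq> b"
  then have "tri a w b" using W_nbrs[of a w b] assms by (auto simp: adj_commute)
  then show False using no_triangle assms by blast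
qed

text \<open>Here \<open>removal\<close> demands \<open>deg C a + deg C b > c\<close>, and in
  \<open>pair_degrees\<close> only owned edges allow that.\<close>

lemma pair_owns:
  assumes "a \<in> W" "b \<in> W" "adj a b"
  shows "nown a + nown b \<ge> 1"
proof -
  let ?K = "{a, b}"
  have ne: "a \<noteq> b" using assms adj_irrefl by auto
  have KW: "?K \<subseteq> W" using assms by auto
  have "(k - 1) * int (card ?K) < (\<Sum>u\<in>?K. deg ?K u + 2 * deg (V - ?K) u)"
    by (rule removal) (use assms in \<open>auto simp: W_def\<close>)
  also have "\<dots> \<le> (\<Sum>u\<in>?K. 1 + 2 * deg C u)"
  proof (rule sum_mono)
    fix u assume u: "u \<in> ?K"
    have "{z \<in> ?K. adj u z} \<subseteq> ?K - {u}" using adj_irrefl by auto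
    then have "deg ?K u \<le> int (card (?K - {u}))" by (intro deg_insert_card) auto
    also have "card (?K - {u}) = 1" using u ne by auto
    finally have "deg ?K u \<le> 1" by simp
    moreover have "deg (V - ?K) u = deg C u"
      by (rule deg_outside[OF KW u]) (use W_matching[of a] W_matching[of b] assms u in \<open>auto simp: adj_commute\<close>)
    ultimately show "deg ?K u + 2 * deg (V - ?K) u \<le> 1 + 2 * deg C u" by simp
  qed
  also have "\<dots> = 2 + 2 * (deg C a + deg C b)" using ne by simp
  finally show ?thesis using pair_degrees[OF assms] k2 ne by simp
qed

text \<open>The outside vertices are isolated in \<open>W\<close> or matched in pairs. The excess of
  the counterexample is so large that some isolated vertex \<open>w\<close> uses or owns nearly
  everything on the cycle. The successors of its entries then miss more edges than the remaining
  slack allows.\<close>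

lemma codim_ne_2: False
proof -
  define W1 where "W1 = {w \<in> W. \<forall>z\<in>W. \<not> adj w z}"
  define W2 where "W2 = W - W1"
  define \<mu> where "\<mu> w = (SOME z. z \<in> W \<and> adj w z)" for w
  have W12: "W = W1 \<union> W2" "W1 \<inter> W2 = {}" "W1 \<subseteq> W" "W2 \<subseteq> W" by (auto simp: W1_def W2_def)
  have fin: "finite W1" "finite W2" by (rule finite_subset[OF _ fin_W], rule W12)+
  have \<mu>: "\<mu> w \<in> W" "adj w (\<mu> w)" if "w \<in> W2" for w
  proof -
    have "\<exists>z. z \<in> W \<and> adj w z" using that by (auto simp: W2_def W1_def)
    then have "\<mu> w \<in> W \<and> adj w (\<mu> w)" unfolding \<mu>_def by (rule someI_ex)
    then show "\<mu> w \<in> W" "adj w (\<mu> w)" by blast+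
  qed
  have \<mu>2: "\<mu> w \<in> W2" if "w \<in> W2" for w
    using \<mu>(1)[OF that] adj_sym[OF \<mu>(2)[OF that]] that by (auto simp: W2_def W1_def)
  have \<mu>\<mu>: "\<mu> (\<mu> w) = w" if "w \<in> W2" for w
  proof (rule W_matching)
    show "\<mu> w \<in> W" "adj (\<mu> w) w" using \<mu>(1)[OF that] adj_sym[OF \<mu>(2)[OF that]] .
    show "\<mu> (\<mu> w) \<in> W" "adj (\<mu> w) (\<mu> (\<mu> w))" using \<mu>[OF \<mu>2[OF that]] .
    show "w \<in> W" using that W12(4) by blast
  qed
  have reindex: "(\<Sum>w\<in>W2. g (\<mu> w)) = (\<Sum>w\<in>W2. g w)" for g :: "'a \<Rightarrow> int"
    by (rule sum.reindex_bij_witness[of _ \<mu> \<mu>]) (use \<mu>2 \<mu>\<mu> in auto)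
  define T1 where "T1 = (\<Sum>w\<in>W1. nown w)"
  define T2 where "T2 = (\<Sum>w\<in>W2. nown w)"
  define a1 where "a1 = int (card W1)"
  define a2 where "a2 = int (card W2)"
  define \<xi> where "\<xi> = cnt third_in_C"
  have nn: "nown w \<ge> 0" "nboth w \<ge> 0" for w by (simp_all add: nown_def nboth_def cnt_nonneg)
  have \<xi>0: "\<xi> \<ge> 0" by (simp add: \<xi>_def cnt_nonneg)
  have na0: "nonadj \<ge> 0" by (simp add: nonadj_def)
  have T: "T1 + T2 + \<xi> \<le> c"
  proof -
    have "(\<Sum>w\<in>W. nown w) = T1 + T2"
      unfolding T1_def T2_def by (subst W12(1)) (rule sum.union_disjoint[OF fin W12(2)])
    then show ?thesis using third_in_C_bound sum_nown[of W] by (simp add: \<xi>_def)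
  qed
  have aW: "a1 + a2 = int (card W)"
    using card_Un_disjoint[OF fin W12(2)] W12(1) by (simp add: a1_def a2_def)
  have cV: "int (card V) = c + a1 + a2" using card_W aW by simp
  have a3: "a1 + a2 \<ge> 3" using cV card_V_gt k2 by linarith
  have s2: "(\<Sum>w\<in>W2. deg W w + 2 * deg C w) \<le> (c + 1) * a2 + 2 * T2"
  proof -
    have d1: "deg W w \<le> 1" if "w \<in> W2" for w
    proof -
      have "{z \<in> W. adj w z} \<subseteq> {\<mu> w}" using W_matching[of w _ "\<mu> w"] \<mu>[OF that] that W12 by blast
      then have "deg W w \<le> int (card {\<mu> w})" by (intro deg_insert_card) auto
      then show ?thesis by simp
    qed
    \<comment> \<open>Each matched pair appears twice, which makes \<open>pair_degrees\<close>
      applicable termwise.\<close>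
    have "2 * (\<Sum>w\<in>W2. deg C w) = (\<Sum>w\<in>W2. deg C w + deg C (\<mu> w))"
      using reindex[of "deg C"] by (simp add: sum.distrib)
    also have "\<dots> \<le> (\<Sum>w\<in>W2. c + nown w + nown (\<mu> w))"
      by (rule sum_mono) (use pair_degrees \<mu> W12 in blast)
    also have "\<dots> = c * a2 + 2 * T2"
      using reindex[of nown] by (simp add: sum.distrib T2_def a2_def mult.commute)
    finally have "2 * (\<Sum>w\<in>W2. deg C w) \<le> c * a2 + 2 * T2" .
    moreover have "(\<Sum>w\<in>W2. deg W w) \<le> (\<Sum>w\<in>W2. 1)" by (rule sum_mono) (rule d1)
    ultimately show ?thesis by (simp add: sum.distrib sum_distrib_left[symmetric] a2_def algebra_simps)
  qed
  have s1: "(\<Sum>w\<in>W1. deg W w + 2 * deg C w) = (\<Sum>w\<in>W1. 2 * nboth w + 4 * nown w)"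
  proof (rule sum.cong)
    fix w assume "w \<in> W1"
    then have "deg W w = 0" by (intro deg_eq_0) (auto simp: W1_def)
    then show "deg W w + 2 * deg C w = 2 * nboth w + 4 * nown w" using deg_C by simp
  qed simp
  have dV: "degsum V \<le> c * (c - 1) - nonadj + (\<Sum>w\<in>W1. 2 * nboth w + 4 * nown w) + ((c + 1) * a2 + 2 * T2)"
  proof -
    have "(\<Sum>w\<in>W. deg W w + 2 * deg C w)
      = (\<Sum>w\<in>W1. deg W w + 2 * deg C w) + (\<Sum>w\<in>W2. deg W w + 2 * deg C w)"
      using sum.union_disjoint[OF fin W12(2), of "\<lambda>w. deg W w + 2 * deg C w"] W12(1) by simp
    then show ?thesis using degsum_V degsum_C s1 s2 by linarith
  qed
  have main: "2 * c + nonadj < (\<Sum>w\<in>W1. 2 * nboth w + 4 * nown w - c - 1) + 2 * T2"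
  proof -
    have "(\<Sum>w\<in>W1. 2 * nboth w + 4 * nown w - c - 1) = (\<Sum>w\<in>W1. 2 * nboth w + 4 * nown w) - (c + 1) * a1"
      by (simp add: sum_subtractf a1_def algebra_simps)
    moreover have "(c + 1) * (c + a1 + a2) < degsum V" using counterexample cV k2 by (simp add: add.commute)
    ultimately show ?thesis using dV by (simp add: algebra_simps)
  qed
  \<comment> \<open>The bracket is the number of cycle edges left over in
    \<open>both_own_bound\<close>. If no such \<open>w\<close> existed, every summand of
    \<open>main\<close> would be at most \<open>2 * nown w\<close>, and the right side at most
    \<open>2 * (T1 + T2) \<le> 2 * c\<close>.\<close>
  have "\<exists>w\<in>W1. nown w - (c - 2 * nboth w - nown w) \<ge> 2"
  proof (rule ccontr)
    assume "\<not> ?thesis"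
    then have "2 * nboth w + 4 * nown w - c - 1 \<le> 2 * nown w" if "w \<in> W1" for w using that by force
    then have "(\<Sum>w\<in>W1. 2 * nboth w + 4 * nown w - c - 1) \<le> (\<Sum>w\<in>W1. 2 * nown w)" by (rule sum_mono)
    also have "\<dots> = 2 * T1" by (simp add: T1_def sum_distrib_left)
    finally show False using main T na0 \<xi>0 by linarith
  qed
  then obtain w where w: "w \<in> W1" and big: "nown w - (c - 2 * nboth w - nown w) \<ge> 2" by blast
  have wW: "w \<in> W" using w W12 by auto
  \<comment> \<open>Estimating all summands of \<open>main\<close> by \<open>both_own_bound\<close>
    and then \<open>T1\<close> by \<open>T\<close> bounds the number of missing edges from
    above.\<close>
  have small: "3 * \<xi> + nonadj < c - T2 - a1"
  proof -
    have "(\<Sum>w\<in>W1. 2 * nboth w + 4 * nown w - c - 1) \<le> (\<Sum>w\<in>W1. 3 * nown w - 1)"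
    proof (rule sum_mono)
      fix w assume "w \<in> W1"
      then show "2 * nboth w + 4 * nown w - c - 1 \<le> 3 * nown w - 1" using both_own_bound[of w] W12 by auto
    qed
    also have "\<dots> = 3 * T1 - a1" by (simp add: sum_subtractf T1_def a1_def sum_distrib_left)
    finally show ?thesis using main T by linarith
  qed
  have two: "a1 + T2 \<ge> 2"
  proof (cases "W2 = {}")
    case True
    then have "a2 = 0" "T2 = 0" by (auto simp: a2_def T2_def)
    then show ?thesis using a3 by simp
  next
    case False
    then obtain v where v: "v \<in> W2" by blast
    have "\<mu> v \<noteq> v" using \<mu>[OF v] adj_irrefl by metis
    then have "(\<Sum>u\<in>{v, \<mu> v}. nown u) = nown v + nown (\<mu> v)" by simp
    moreover have "(\<Sum>u\<in>{v, \<mu> v}. nown u) \<le> T2"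
      unfolding T2_def by (rule sum_mono2) (use fin v \<mu>2 nn in auto)
    moreover have "nown v + nown (\<mu> v) \<ge> 1" using pair_owns[of v "\<mu> v"] \<mu>[OF v] v W12 by blast
    moreover have "a1 \<ge> 1" using w fin by (auto simp: a1_def Suc_le_eq card_gt_0_iff)
    ultimately show ?thesis by linarith
  qed
  define r where "r = nboth w"
  define t where "t = nown w"
  define \<rho> where "\<rho> = r + t"
  have "cnt (bwd w) * (cnt (bwd w) - 1) \<le> nonadj + 2 * cnt (\<lambda>i. bwd w i \<and> bwd w (i + 1)) + 2 * cnt third_in_C + cnt (both w)"
  proof (rule nonadj_bound[where E = "\<lambda>i j. bwd w i \<and> tri w (f i) (f j) \<and> f j \<noteq> f (i + 1)"])
    show "periodic (bwd w)" by (rule periodics)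
  next
    fix i j
    assume b: "bwd w i" "bwd w j" and h: "f i \<noteq> f j" "adj (f (i + 1)) (f (j + 1))" "f j \<noteq> f (i + 1)" "f i \<noteq> f (j + 1)"
        "\<not> tri (f (i + 1)) (f (i + 2)) (f (j + 1))" "\<not> tri (f (j + 1)) (f (j + 2)) (f (i + 1))"
    show "bwd w i \<and> tri w (f i) (f j) \<and> f j \<noteq> f (i + 1)" using chord_cycle[OF h wW b] b h(3) by blast
  next
    fix i j j' assume "bwd w i \<and> tri w (f i) (f j) \<and> f j \<noteq> f (i + 1)" "bwd w i \<and> tri w (f i) (f j') \<and> f j' \<noteq> f (i + 1)"
    then show "f j = f j'" using tri_unique by blast
  next
    fix i j assume b: "bwd w i \<and> tri w (f i) (f j) \<and> f j \<noteq> f (i + 1)"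
    then have "fwd w i" using tri_unique[of w "f i" "f j" "f (i + 1)"] by (auto simp: fwd_def bwd_def)
    then show "both w i" using b by (simp add: both_def)
  qed
  moreover have "cnt (\<lambda>i. bwd w i \<and> bwd w (i + 1)) \<le> cnt (both w)"
    by (rule cnt_mono) (use bwd_cases own_facts(6) in blast)
  ultimately have nb: "\<rho> * (\<rho> - 1) \<le> nonadj + 3 * r + 2 * \<xi>"
    unfolding cnt_bwd \<rho>_def r_def t_def \<xi>_def nboth_def[symmetric] by linarith
  have "2 * r + t \<le> c" using both_own_bound[OF wW] by (simp add: r_def t_def)
  moreover have "2 * t + 2 * r - c \<ge> 2" using big by (simp add: r_def t_def)
  ultimately have "c \<le> 2 * \<rho> - 2" "r \<le> \<rho> - 2" by (simp_all add: \<rho>_def)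
  \<comment> \<open>From \<open>small\<close> and \<open>two\<close>,
    \<open>nonadj + 2 * \<xi> \<le> c - 3 \<le> 2 * \<rho> - 5\<close>, and
    \<open>3 * r \<le> 3 * \<rho> - 6\<close>.\<close>
  then have "\<rho> * \<rho> - \<rho> \<le> 5 * \<rho> - 11" using nb small two \<xi>0 by (simp add: algebra_simps)
  then have "(\<rho> - 3) * (\<rho> - 3) \<le> - 2" by (simp add: algebra_simps)
  then show False using zero_le_square[of "\<rho> - 3"] by linarith
qed

end

lemma impossible: False
proof -
  have "k = c + 1 \<or> k = c + 2" using c_less codim_le_2 by linarith
  then show False using codim_ne_1 codim_ne_2 by blast
qed

end

lemma (in critical_graph) critical_impossible: False
proof -
  obtain f c where "longest_cycle adj tri V k f c" using longest_cycle_exists by blast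
  then interpret longest_cycle adj tri V k f c .
  show False by (rule impossible)
qed

section \<open>Linear 3-uniform hypergraphs\<close>

text \<open>The relations \<open>adj\<close> and \<open>tri\<close> stay fixed while
  \<open>V\<close> shrinks, so the induction on \<open>card V\<close> stays within one locale and a
  smallest failing \<open>V\<close> is a \<open>critical_graph\<close>.\<close>

theorem (in triangle_graph) degsum_bound:
  assumes "finite V" "k \<ge> 4" "\<And>xs. is_path V xs \<Longrightarrow> int (length xs) \<le> k"
  shows "degsum V \<le> (k - 1) * int (card V)"
  using assms(1,3)
proof (induction "card V" arbitrary: V rule: less_induct)
  case less
  show ?case
  proof (rule ccontr)
    assume "\<not> ?thesis"
    then have "critical_graph adj tri V k"
    proof unfold_locales
      fix U assume U: "U \<subset> V"
      show "degsum U \<le> (k - 1) * int (card U)"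
      proof (rule less.hyps)
        show "card U < card V" by (rule psubset_card_mono[OF less.prems(1) U])
        show "finite U" using U less.prems(1) finite_subset by blast
        show "int (length xs) \<le> k" if "is_path U xs" for xs
          using less.prems(2)[of xs] that U by (auto simp: is_path_def)
      qed
    qed (use less.prems assms(2) in auto)
    then show False by (rule critical_graph.critical_impossible)
  qed
qed

section \<open>The 2-section of a linear 3-uniform hypergraph\<close>

definition hg_adj :: "'a set set \<Rightarrow> 'a \<Rightarrow> 'a \<Rightarrow> bool" where
  "hg_adj H a b \<longleftrightarrow> a \<noteq> b \<and> (\<exists>h\<in>H. a \<in> h \<and> b \<in> h)"

definition hg_tri :: "'a set set \<Rightarrow> 'a \<Rightarrow> 'a \<Rightarrow> 'a \<Rightarrow> bool" where
  "hg_tri H a b d \<longleftrightarrow> a \<noteq> b \<and> b \<noteq> d \<and> a \<noteq> d \<and> (\<exists>h\<in>H. a \<in> h \<and> b \<in> h \<and> d \<in> h)"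

locale linear_3graph =
  fixes H :: "'a set set"
  assumes u3: "uniform3 H" and lin: "linear_hg H"
begin

lemma edge_card: "h \<in> H \<Longrightarrow> card h = 3" "h \<in> H \<Longrightarrow> finite h"
  using u3 by (auto simp: uniform3_def intro: card_ge_0_finite)

lemma edge_unique:
  assumes "h \<in> H" "h' \<in> H" "a \<noteq> b" "a \<in> h" "b \<in> h" "a \<in> h'" "b \<in> h'"
  shows "h = h'"
proof (rule ccontr)
  assume "h \<noteq> h'"
  then have "card (h \<inter> h') \<le> 1" using lin assms by (auto simp: linear_hg_def)
  moreover have "card {a, b} \<le> card (h \<inter> h')" using assms edge_card by (intro card_mono) auto
  ultimately show False using assms(3) by simp
qed

lemma edge_no_4:
  assumes "h \<in> H" "{a, b, d, e} \<subseteq> h" "distinct [a, b, d, e]"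
  shows False
proof -
  have "card {a, b, d, e} \<le> card h" using assms edge_card by (intro card_mono) auto
  then show False using assms(3) edge_card(1)[OF assms(1)] by simp
qed

sublocale triangle_graph "hg_adj H" "hg_tri H"
proof
  fix a b d e
  assume t: "hg_tri H a b d" "hg_tri H a b e"
  obtain h where h: "h \<in> H" "a \<in> h" "b \<in> h" "d \<in> h" using t by (auto simp: hg_tri_def)
  obtain h' where h': "h' \<in> H" "a \<in> h'" "b \<in> h'" "e \<in> h'" using t by (auto simp: hg_tri_def)
  have ne: "a \<noteq> b" "b \<noteq> d" "a \<noteq> d" "b \<noteq> e" "a \<noteq> e" using t by (auto simp: hg_tri_def)
  have "h = h'" by (rule edge_unique[of _ _ a b]) (use h h' ne in auto)
  then show "d = e" using edge_no_4[of h a b d e] h h' ne by auto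
qed (auto simp: hg_adj_def hg_tri_def)

lemma good_take: "good xs \<Longrightarrow> good (take n xs)"
  using good_append[of "take n xs" "drop n xs"] by (cases "take n xs = [] \<or> drop n xs = []") auto

text \<open>Choose a hyperedge for each step. Two consecutive choices differ because the path does
  not turn inside a triangle; two others differ because a hyperedge cannot contain four
  vertices.\<close>

lemma berge_path_of_good:
  assumes "distinct xs" "good xs" "length xs = Suc n"
  shows "has_berge_path H n"
proof -
  define e where "e i = (SOME h. h \<in> H \<and> xs ! i \<in> h \<and> xs ! Suc i \<in> h)" for i
  have e: "e i \<in> H" "xs ! i \<in> e i" "xs ! Suc i \<in> e i" if "i < n" for i
  proof -
    have "\<exists>h. h \<in> H \<and> xs ! i \<in> h \<and> xs ! Suc i \<in> h"
      using good_nth(1)[OF assms(2), of i] that assms(3) by (auto simp: hg_adj_def)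
    then have "e i \<in> H \<and> xs ! i \<in> e i \<and> xs ! Suc i \<in> e i" unfolding e_def by (rule someI_ex)
    then show "e i \<in> H" "xs ! i \<in> e i" "xs ! Suc i \<in> e i" by auto
  qed
  have neq: "e i \<noteq> e j" if ij: "i < j" "j < n" for i j
  proof
    assume eq: "e i = e j"
    have in_e: "xs ! i \<in> e i" "xs ! Suc i \<in> e i" "xs ! j \<in> e i" "xs ! Suc j \<in> e i"
      using e[of i] e[of j] ij eq by auto
    have d: "xs ! l = xs ! m \<longleftrightarrow> l = m" if "l \<le> n" "m \<le> n" for l m
      using that assms by (simp add: nth_eq_iff_index_eq)
    show False
    proof (cases "j = Suc i")
      case True
      then have "hg_tri H (xs ! i) (xs ! Suc i) (xs ! Suc (Suc i))"
        using in_e e[of i] ij d by (auto simp: hg_tri_def)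
      then show False using good_nth(2)[OF assms(2), of i] ij True assms(3) by auto
    next
      case False
      then show False
        using edge_no_4[of "e i" "xs ! i" "xs ! Suc i" "xs ! j" "xs ! Suc j"] in_e e(1)[of i] ij d by auto
    qed
  qed
  have "distinct (map e [0..<n])"
    unfolding distinct_map inj_on_def using neq by (metis atLeastLessThan_upt distinct_upt linorder_neqE_nat atLeastLessThan_iff)
  then have "berge_path H xs (map e [0..<n]) n"
    using assms e by (auto simp: berge_path_def)
  then show ?thesis unfolding has_berge_path_def by blast
qed

text \<open>A hyperedge contributes its six ordered pairs of distinct vertices, and linearity makes
  these sets disjoint.\<close>

lemma degsum_hypergraph:
  assumes "finite V" "\<forall>h\<in>H. h \<subseteq> V"
  shows "degsum V = 6 * int (card H)"
proof -
  define P where "P h = {(a, b). a \<in> h \<and> b \<in> h \<and> a \<noteq> b}" for h :: "'a set"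
  have cP: "card (P h) = 6" "finite (P h)" if "h \<in> H" for h
  proof -
    have fh: "finite h" "card h = 3" using edge_card that by auto
    show fP: "finite (P h)" by (rule finite_subset[of _ "h \<times> h"]) (use fh in \<open>auto simp: P_def\<close>)
    have e: "P h \<union> (\<lambda>a. (a, a)) ` h = h \<times> h" by (auto simp: P_def)
    have "card (P h \<union> (\<lambda>a. (a, a)) ` h) = card (P h) + card ((\<lambda>a. (a, a)) ` h)"
      by (rule card_Un_disjoint) (use fP fh in \<open>auto simp: P_def\<close>)
    moreover have "card ((\<lambda>a. (a, a)) ` h) = 3" using fh by (simp add: card_image inj_on_def)
    ultimately show "card (P h) = 6" using fh by (simp add: e card_cartesian_product)
  qed
  have "H \<subseteq> Pow V" using assms(2) by auto
  then have fH: "finite H" using assms(1) finite_subset by blast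
  have "(\<Union>h\<in>H. P h) = (SIGMA a:V. {b \<in> V. hg_adj H a b})"
    using assms(2) by (auto simp: P_def hg_adj_def)
  then have "card (\<Union>h\<in>H. P h) = (\<Sum>a\<in>V. card {b \<in> V. hg_adj H a b})"
    using assms(1) by simp
  then have "degsum V = int (card (\<Union>h\<in>H. P h))" by (simp add: degsum_def deg_def)
  also have "card (\<Union>h\<in>H. P h) = (\<Sum>h\<in>H. card (P h))"
  proof (rule card_UN_disjoint[OF fH])
    show "\<forall>i\<in>H. \<forall>j\<in>H. i \<noteq> j \<longrightarrow> P i \<inter> P j = {}"
      using edge_unique by (fastforce simp: P_def)
  qed (use cP in auto)
  also have "\<dots> = 6 * card H" using cP by simp
  finally show ?thesis by simp
qed

end

theorem theorem2:
  fixes V :: "'a set" and H :: "'a set set" and k :: nat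
  assumes "k \<ge> 4"
    and "finite V"
    and "\<forall>h\<in>H. h \<subseteq> V"
    and "uniform3 H"
    and "linear_hg H"
    and "\<not> has_berge_path H k"
  shows "real (card H) \<le> (real k - 1) / 6 * real (card V)"
proof -
  interpret linear_3graph H by unfold_locales (rule assms(4), rule assms(5))
  have "degsum V \<le> (int k - 1) * int (card V)"
  proof (rule degsum_bound[OF assms(2)])
    show "4 \<le> int k" using assms(1) by simp
    show "int (length xs) \<le> int k" if "is_path V xs" for xs
    proof (rule ccontr)
      assume "\<not> ?thesis"
      \<comment> \<open>A path that is too long is cut to exactly \<open>k + 1\<close> vertices, so
        that its Berge path has length exactly \<open>k\<close>.\<close>
      then have "length (take (Suc k) xs) = Suc k" by simp
      moreover have "distinct (take (Suc k) xs)" "good (take (Suc k) xs)"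
        using that good_take by (auto simp: is_path_def)
      ultimately show False using berge_path_of_good assms(6) by blast
    qed
  qed
  then have "6 * int (card H) \<le> (int k - 1) * int (card V)" using degsum_hypergraph[OF assms(2,3)] by simp
  then have "real_of_int (6 * int (card H)) \<le> real_of_int ((int k - 1) * int (card V))" by (simp only: of_int_le_iff)
  then show ?thesis by (simp add: field_simps)
qed

end
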